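(* Let $\mathcal{F}$ be the family of the eleven graphs $K_3\,\dot\cup\, K_3$, $K_3\,\dot\cup\, K_{1,3}$, $K_{1,3}\,\dot\cup\, K_{1,3}$, $C_4$, Campstool, $H$-tree, $3$-sun, $K_{1,6}$, $S(2,1,1,1,1)$, $S(2,2,1,1)$, $S(2,2,2)$. Let $G$ be a graph. (1) If $G$ is connected and none of the graphs in $\mathcal{F}$ is a minor of $G$, then every matrix $A\in\mathcal{S}(G)$ has at most one multiple eigenvalue. (2) There exists a matrix $A\in\mathcal{S}(G)$ with the SSP having more than one multiple eigenvalue if and only if one of the graphs in $\mathcal{F}$ is a minor of $G$. The same equivalence holds with the SMP in place of the SSP.
   Context: All matrices are real and symmetric, all graphs simple, undirected and finite. For a graph $G$ on vertices $\{1,\dots,n\}$, $\mathcal{S}(G)$ is the set of real symmetric $n\times n$ matrices $A=[a_{ij}]$ such that, for $i\neq j$, $a_{ij}\ne 0$ if and only if $ij$ is an edge of $G$ (diagonal entries are free). An eigenvalue is multiple if its multiplicity is at least two. Let $\circ$ be the entrywise product and $[A,X]=AX-XA$. $A$ has the Strong Spectral Property (SSP) if the only symmetric $X$ with $A\circ X=O$, $I\circ X=O$, $[A,X]=O$ is $X=O$. An $n\times n$ matrix $A$ has the Strong Multiplicity Property (SMP) if the only symmetric $X$ with $A\circ X=O$, $I\circ X=O$, $[A,X]=O$ and $\operatorname{tr}(A^iX)=0$ for $i=2,\dots,n-1$ is $X=O$. Graphs: $\dot\cup$ denotes disjoint union. Campstool: a triangle with two pendant vertices attached at the same vertex (5 vertices).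 $H$-tree: the tree on 6 vertices with two adjacent vertices of degree 3, each adjacent to two leaves. $3$-sun: a triangle with one pendant vertex attached at each of its three vertices (6 vertices). $S(k_1,\dots,k_d)$: the tree obtained from a central vertex by attaching $d$ paths (arms) having $k_1,\dots,k_d$ vertices, each joined to the center at one end. *)

theory Defs
  imports
    "Jordan_Normal_Form.Char_Poly"
    "Graph_Theory.Digraph_Isomorphism"
begin

text \<open>
  A simple, undirected, finite graph is a \<^locale>\<open>pair_graph\<close>: a finite vertex set together
  with a symmetric, irreflexive set of arcs, an edge \<open>uv\<close> being the two arcs \<open>(u, v)\<close> and
  \<open>(v, u)\<close>.  Matrix rows and columns are numbered from 0, so a graph on \<open>n\<close> labelled vertices
  has the vertex set \<open>{..<n}\<close>.
\<close>

section \<open>Matrices\<close>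

definition sym_mats :: "nat \<Rightarrow> real mat set" where
  "sym_mats n = {A \<in> carrier_mat n n. transpose_mat A = A}"

definition mats_of_graph :: "nat \<Rightarrow> nat pair_pre_digraph \<Rightarrow> real mat set" where
  "mats_of_graph n G =
    {A \<in> sym_mats n. \<forall>i<n. \<forall>j<n. i \<noteq> j \<longrightarrow> (A $$ (i, j) \<noteq> 0 \<longleftrightarrow> (i, j) \<in> parcs G)}"

definition multiple_eigenvalue :: "real mat \<Rightarrow> real \<Rightarrow> bool" where
  "multiple_eigenvalue A x \<longleftrightarrow> eigenvalue A x \<and> 2 \<le> order x (char_poly A)"

definition hadamard :: "real mat \<Rightarrow> real mat \<Rightarrow> real mat" where
  "hadamard A B = mat (dim_row A) (dim_col A) (\<lambda>ij. A $$ ij * B $$ ij)"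

definition trace_mat :: "real mat \<Rightarrow> real" where
  "trace_mat A = (\<Sum>i<dim_row A. A $$ (i, i))"

text \<open>Both properties are meant for square matrices; \<open>n\<close> is the order of \<open>A\<close>.\<close>

definition has_SSP :: "real mat \<Rightarrow> bool" where
  "has_SSP A \<longleftrightarrow> (let n = dim_row A in
    \<forall>X \<in> sym_mats n.
      hadamard A X = 0\<^sub>m n n \<and> hadamard (1\<^sub>m n) X = 0\<^sub>m n n \<and> A * X - X * A = 0\<^sub>m n n
      \<longrightarrow> X = 0\<^sub>m n n)"

definition has_SMP :: "real mat \<Rightarrow> bool" where
  "has_SMP A \<longleftrightarrow> (let n = dim_row A in
    \<forall>X \<in> sym_mats n.
      hadamard A X = 0\<^sub>m n n \<and> hadamard (1\<^sub>m n) X = 0\<^sub>m n n \<and> A * X - X * A = 0\<^sub>m n n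
      \<and> (\<forall>i \<in> {2..n - 1}. trace_mat ((A ^\<^sub>m i) * X) = 0)
      \<longrightarrow> X = 0\<^sub>m n n)"

section \<open>Graph minors\<close>

definition delete_edge :: "'a \<Rightarrow> 'a \<Rightarrow> 'a pair_pre_digraph \<Rightarrow> 'a pair_pre_digraph" where
  "delete_edge u v G = \<lparr>pverts = pverts G, parcs = parcs G - {(u, v), (v, u)}\<rparr>"

definition delete_vertex :: "'a \<Rightarrow> 'a pair_pre_digraph \<Rightarrow> 'a pair_pre_digraph" where
  "delete_vertex v G =
    \<lparr>pverts = pverts G - {v}, parcs = {(a, b) \<in> parcs G. a \<noteq> v \<and> b \<noteq> v}\<rparr>"

text \<open>
  Contracting \<open>uv\<close> merges \<open>v\<close> into \<open>u\<close>; the resulting loop is dropped, and parallel edges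
  disappear because arcs form a set.
\<close>

definition contract_edge :: "'a \<Rightarrow> 'a \<Rightarrow> 'a pair_pre_digraph \<Rightarrow> 'a pair_pre_digraph" where
  "contract_edge u v G = (let f = id(v := u) in
    \<lparr>pverts = f ` pverts G, parcs = {(f a, f b) | a b. (a, b) \<in> parcs G \<and> f a \<noteq> f b}\<rparr>)"

inductive minor_step :: "'a pair_pre_digraph \<Rightarrow> 'a pair_pre_digraph \<Rightarrow> bool" where
  edge_deletion: "(u, v) \<in> parcs G \<Longrightarrow> minor_step G (delete_edge u v G)"
| vertex_deletion: "v \<in> pverts G \<Longrightarrow> minor_step G (delete_vertex v G)"
| edge_contraction: "(u, v) \<in> parcs G \<Longrightarrow> minor_step G (contract_edge u v G)"

definition is_minor :: "'b pair_pre_digraph \<Rightarrow> 'a pair_pre_digraph \<Rightarrow> bool" where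
  "is_minor H G \<longleftrightarrow> (\<exists>K. minor_step\<^sup>*\<^sup>* G K \<and> digraph_iso (with_proj K) (with_proj H))"

section \<open>The eleven graphs\<close>

definition graph_of_edges :: "nat \<Rightarrow> (nat \<times> nat) set \<Rightarrow> nat pair_pre_digraph" where
  "graph_of_edges n E = \<lparr>pverts = {..<n}, parcs = E \<union> E\<inverse>\<rparr>"

definition complete_graph :: "nat \<Rightarrow> nat pair_pre_digraph" where
  "complete_graph n = graph_of_edges n {(i, j). i < j \<and> j < n}"

definition complete_bipartite :: "nat \<Rightarrow> nat \<Rightarrow> nat pair_pre_digraph" where
  "complete_bipartite m n = graph_of_edges (m + n) ({..<m} \<times> {m..<m + n})"

definition cycle_graph :: "nat \<Rightarrow> nat pair_pre_digraph" where
  "cycle_graph n = graph_of_edges n {(i, Suc i mod n) | i. i < n}"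

text \<open>The vertices of the first summand become even numbers, those of the second odd ones.\<close>

definition disjoint_union ::
  "nat pair_pre_digraph \<Rightarrow> nat pair_pre_digraph \<Rightarrow> nat pair_pre_digraph" where
  "disjoint_union G H =
    \<lparr>pverts = (\<lambda>i. 2 * i) ` pverts G \<union> (\<lambda>i. 2 * i + 1) ` pverts H,
     parcs = (\<lambda>(i, j). (2 * i, 2 * j)) ` parcs G
       \<union> (\<lambda>(i, j). (2 * i + 1, 2 * j + 1)) ` parcs H\<rparr>"

text \<open>
  The tree \<open>S(k\<^sub>1, \<dots>, k\<^sub>d)\<close>: the centre is 0 and arm number \<open>a\<close> consists of the consecutive
  vertices \<open>s + 1, \<dots>, s + ks ! a\<close>, where \<open>s\<close> is the total length of the preceding arms.
\<close>

definition spider :: "nat list \<Rightarrow> nat pair_pre_digraph" where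
  "spider ks = graph_of_edges (Suc (sum_list ks))
    {(if j = 0 then 0 else sum_list (take a ks) + j, sum_list (take a ks) + j + 1) | a j.
      a < length ks \<and> j < ks ! a}"

definition campstool :: "nat pair_pre_digraph" where
  "campstool = graph_of_edges 5 {(0, 1), (0, 2), (1, 2), (0, 3), (0, 4)}"

definition H_tree :: "nat pair_pre_digraph" where
  "H_tree = graph_of_edges 6 {(0, 1), (0, 2), (0, 3), (1, 4), (1, 5)}"

definition three_sun :: "nat pair_pre_digraph" where
  "three_sun = graph_of_edges 6 {(0, 1), (0, 2), (1, 2), (0, 3), (1, 4), (2, 5)}"

definition minor_family :: "nat pair_pre_digraph set" where
  "minor_family =
    {disjoint_union (complete_graph 3) (complete_graph 3),
     disjoint_union (complete_graph 3) (complete_bipartite 1 3),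
     disjoint_union (complete_bipartite 1 3) (complete_bipartite 1 3),
     cycle_graph 4,
     campstool,
     H_tree,
     three_sun,
     complete_bipartite 1 6,
     spider [2, 1, 1, 1, 1],
     spider [2, 2, 1, 1],
     spider [2, 2, 2]}"

end

theory Submission
  imports Defs
begin

text \<open>
  \<^emph>\<open>From minors to matrices.\<close>  Each of the eleven graphs carries an explicit matrix with the SSP and
  two double eigenvalues, and the existence of such a matrix is inherited from a minor.  The SSP
  says that at \<open>A\<close> the isospectral manifold is transversal to the matrices with the pattern of
  \<open>A\<close>, so the implicit function theorem yields cospectral matrices with small prescribed entries on
  additional edges.  A contracted edge \<open>uv\<close> is restored by a matrix that contains a large multiple
  of \<open>(e\<^sub>u - e\<^sub>v) (e\<^sub>u - e\<^sub>v)\<^sup>T\<close>: one eigenvalue escapes to infinity, and in the limit the others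
  are those of a matrix of the contracted graph.  The SSP survives because it is an open condition.

  \<^emph>\<open>From matrices to minors.\<close>  A longest path in a connected graph without the eleven minors either
  is spanning and has at most one chord, which then skips one vertex, or all remaining vertices are
  leaves attached at one inner vertex of the path, and there are few of them.  Following an
  eigenvector that vanishes at an end of the path determines the multiple eigenvalue.  For a
  disconnected graph the SMP forbids a common eigenvalue of two components; a component with a
  multiple eigenvalue contains a triangle or a claw, and two such components give a disjoint union.
\<close>

section \<open>Strict differentiability and an implicit function theorem\<close>

text \<open>The properties form a cycle: the SSP implies the SMP, a matrix with the SMP and two
  multiple eigenvalues forces one of the minors, and a minor yields such a matrix with the SSP. So
  inheritance from minors is proved for the SSP alone. Edge additions and vertex splittings come
  from the same system of equations, written for an intertwining matrix and not for eigenvalues: if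
  \<open>M T = T A\<close> with \<open>T\<close> injective, multiplicities carry over. In a
  splitting the new matrices diverge as the parameter tends to 0, so they do not approach a matrix
  with the SSP; instead, normalized violations of the SSP are taken to the limit and compressed to a
  violation for the contracted graph. In the other direction, a two-dimensional eigenspace contains
  a nonzero vector that vanishes at any chosen vertex. The difficulty with several components is
  that a multiple eigenvalue of the whole matrix may be simple on each of them; this is the only
  place where the SMP enters.\<close>

lemma gram_right_inverse:
  fixes c :: "'e \<Rightarrow> 'i \<Rightarrow> real"
  assumes fI: "finite I" and fE: "finite E"
    and inj: "\<And>u. (\<And>i. i \<in> I \<Longrightarrow> (\<Sum>e\<in>E. u e * c e i) = 0) \<Longrightarrow> \<forall>e\<in>E. u e = 0"
  obtains R where "\<And>e e'. e \<in> E \<Longrightarrow> e' \<in> E \<Longrightarrow>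
    (\<Sum>i\<in>I. c e i * R i e') = (if e = e' then 1 else 0)"
proof -
  define N where "N = card E"
  obtain b where b: "bij_betw b {..<N} E"
    using ex_bij_betw_nat_finite[OF fE] by (auto simp: N_def atLeast0LessThan)
  define g where "g = inv_into {..<N} b"
  have gb: "g (b k) = k" if "k < N" for k
    using b that by (simp add: g_def bij_betw_inv_into_left)
  have bg: "b (g e) = e" and gN: "g e < N" if "e \<in> E" for e
    using b that by (auto simp: g_def bij_betw_inv_into_right)
      (metis bij_betw_apply bij_betw_inv_into lessThan_iff)
  have sumE: "(\<Sum>e\<in>E. h e) = (\<Sum>k<N. h (b k))" for h :: "'e \<Rightarrow> real"
    using sum.reindex_bij_betw[OF b, of h] by simp
  \<comment> \<open>The Gram matrix \<open>c c^T\<close> of the rows of \<open>c\<close>: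
    \<open>v^T M v\<close> is the squared norm of \<open>c^T v\<close>, so independent rows make it
    invertible, and \<open>c^T M^(-1)\<close> is the required right inverse.\<close>
  define M where "M = mat N N (\<lambda>(k, l). \<Sum>i\<in>I. c (b k) i * c (b l) i)"
  have M: "M \<in> carrier_mat N N" by (simp add: M_def)
  have "det M \<noteq> 0"
  proof
    assume "det M = 0"
    then obtain v where v: "v \<in> carrier_vec N" "v \<noteq> 0\<^sub>v N" "M *\<^sub>v v = 0\<^sub>v N"
      using det_0_iff_vec_prod_zero_field[OF M] by auto
    define u where "u e = v $ g e" for e
    have row: "(\<Sum>l<N. (\<Sum>i\<in>I. c (b k) i * c (b l) i) * v $ l) = 0" if "k < N" for k
    proof -
      have "(M *\<^sub>v v) $ k = 0" using v that by simp
      then show ?thesis using that v(1)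
        by (simp add: M_def scalar_prod_def atLeast0LessThan)
    qed
    have "0 = (\<Sum>k<N. v $ k * (\<Sum>l<N. (\<Sum>i\<in>I. c (b k) i * c (b l) i) * v $ l))"
      using row by simp
    also have "\<dots> = (\<Sum>k<N. \<Sum>l<N. \<Sum>i\<in>I. (v $ k * c (b k) i) * (v $ l * c (b l) i))"
      by (simp add: sum_distrib_left sum_distrib_right mult.assoc mult.left_commute mult.commute)
    also have "\<dots> = (\<Sum>k<N. \<Sum>i\<in>I. \<Sum>l<N. (v $ k * c (b k) i) * (v $ l * c (b l) i))"
      by (intro sum.cong refl sum.swap)
    also have "\<dots> = (\<Sum>i\<in>I. \<Sum>k<N. \<Sum>l<N. (v $ k * c (b k) i) * (v $ l * c (b l) i))"
      by (rule sum.swap)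
    also have "\<dots> = (\<Sum>i\<in>I. (\<Sum>k<N. v $ k * c (b k) i) * (\<Sum>l<N. v $ l * c (b l) i))"
      by (simp add: sum_product)
    finally have *: "(\<Sum>i\<in>I. (\<Sum>k<N. v $ k * c (b k) i)^2) = 0"
      by (simp add: power2_eq_square)
    have "\<forall>e\<in>E. u e = 0"
    proof (rule inj)
      fix i assume "i \<in> I"
      with * have "(\<Sum>k<N. v $ k * c (b k) i) = 0"
        using fI by (simp add: sum_nonneg_eq_0_iff)
      then show "(\<Sum>e\<in>E. u e * c e i) = 0"
        by (simp add: sumE u_def gb)
    qed
    then have "v $ k = 0" if "k < N" for k
      using that b gb[OF that] unfolding u_def by (metis bij_betw_apply lessThan_iff)
    with v(1) have "v = 0\<^sub>v N" by (intro eq_vecI) auto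
    with v(2) show False by simp
  qed
  then have "M \<in> Units (ring_mat TYPE(real) N ())"
    by (rule det_non_zero_imp_unit[OF M])
  then obtain B where B: "B \<in> carrier_mat N N" "M * B = 1\<^sub>m N"
    by (auto simp: Units_def ring_mat_simps)
  show ?thesis
  proof
    fix e e' assume e: "e \<in> E" "e' \<in> E"
    have "(M * B) $$ (g e, g e') = (if e = e' then 1 else 0)"
      using e gN bg B(2) by (simp) (metis bg)
    then have "(\<Sum>l<N. (\<Sum>i\<in>I. c (b (g e)) i * c (b l) i) * B $$ (l, g e')) = (if e = e' then 1 else 0)"
      using gN[OF e(1)] gN[OF e(2)] B(1) by (simp add: M_def scalar_prod_def atLeast0LessThan)
    moreover have "(\<Sum>l<N. (\<Sum>i\<in>I. c e i * c (b l) i) * B $$ (l, g e'))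
       = (\<Sum>i\<in>I. c e i * (\<Sum>l<N. c (b l) i * B $$ (l, g e')))"
      by (simp add: sum_distrib_left sum_distrib_right mult.assoc) (rule sum.swap)
    ultimately show "(\<Sum>i\<in>I. c e i * (\<Sum>l<N. c (b l) i * B $$ (l, g e'))) = (if e = e' then 1 else 0)"
      using bg[OF e(1)] by simp
  qed
qed

text \<open>Banach's fixed point theorem in the \<open>l1\<close> norm of the coordinates in
  \<open>E\<close>, for a map that contracts only near 0. The first step has length at most
  \<open>\<rho> / 2\<close> and the later ones halve, so the iterates starting at 0 never leave the
  region where the contraction is assumed.\<close>

lemma contraction_fixpoint:
  fixes T :: "('e \<Rightarrow> real) \<Rightarrow> 'e \<Rightarrow> real"
  assumes fE: "finite E" and \<rho>: "\<rho> > 0"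
    and contr: "\<And>x y. (\<And>e. e \<in> E \<Longrightarrow> \<bar>x e\<bar> \<le> \<rho> \<and> \<bar>y e\<bar> \<le> \<rho>) \<Longrightarrow>
      (\<Sum>e\<in>E. \<bar>T x e - T y e\<bar>) \<le> (\<Sum>e\<in>E. \<bar>x e - y e\<bar>) / 2"
    and start: "(\<Sum>e\<in>E. \<bar>T (\<lambda>_. 0) e\<bar>) \<le> \<rho> / 2"
  obtains y where "\<And>e. e \<in> E \<Longrightarrow> \<bar>y e\<bar> \<le> \<rho>" "\<And>e. e \<in> E \<Longrightarrow> T y e = y e"
proof -
  define Y where "Y k = (T ^^ k) (\<lambda>_. 0)" for k
  have Y0: "Y 0 = (\<lambda>_. 0)" and YS: "Y (Suc k) = T (Y k)" for k by (simp_all add: Y_def)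
  have le: "\<bar>x e\<bar> \<le> (\<Sum>e\<in>E. \<bar>x e\<bar>)" if "e \<in> E" for x :: "'e \<Rightarrow> real" and e
    using member_le_sum[of e E "\<lambda>e. \<bar>x e\<bar>"] fE that by simp
  have st: "(\<Sum>e\<in>E. \<bar>Y k e\<bar>) \<le> \<rho> * (1 - (1/2)^k) \<and>
      (\<Sum>e\<in>E. \<bar>Y (Suc k) e - Y k e\<bar>) \<le> \<rho> / 2 * (1/2)^k" for k
  proof (induction k)
    case 0 then show ?case using start by (simp add: Y0 YS)
  next
    case (Suc k)
    have "(\<Sum>e\<in>E. \<bar>Y (Suc k) e\<bar>) \<le> (\<Sum>e\<in>E. \<bar>Y k e\<bar> + \<bar>Y (Suc k) e - Y k e\<bar>)"
      by (rule sum_mono) auto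
    also have "\<dots> \<le> \<rho> * (1 - (1/2)^k) + \<rho> / 2 * (1/2)^k"
      using Suc by (simp add: sum.distrib)
    also have "\<dots> = \<rho> * (1 - (1/2)^Suc k)" by (simp add: algebra_simps)
    finally have A: "(\<Sum>e\<in>E. \<bar>Y (Suc k) e\<bar>) \<le> \<rho> * (1 - (1/2)^Suc k)" .
    have b1: "\<rho> * (1 - (1/2)^k) \<le> \<rho>" "\<rho> * (1 - (1/2)^Suc k) \<le> \<rho>" using \<rho> by (auto simp: algebra_simps)
    have "(\<Sum>e\<in>E. \<bar>T (Y (Suc k)) e - T (Y k) e\<bar>) \<le> (\<Sum>e\<in>E. \<bar>Y (Suc k) e - Y k e\<bar>) / 2"
      by (rule contr) (use A Suc b1 le in \<open>meson order_trans\<close>)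
    with Suc A show ?case by (simp add: YS)
  qed
  have b: "\<bar>Y k e\<bar> \<le> \<rho>" if "e \<in> E" for k e
  proof -
    have "\<rho> * (1 - (1/2)^k) \<le> \<rho>" using \<rho> by (auto simp: algebra_simps)
    then show ?thesis using st[of k] le[OF that, of "Y k"] by linarith
  qed
  have conv: "\<exists>l. (\<lambda>k. Y k e) \<longlonglongrightarrow> l" if "e \<in> E" for e
  proof -
    have "summable (\<lambda>k. Y (Suc k) e - Y k e)"
    proof (rule summable_comparison_test')
      show "summable (\<lambda>k. \<rho> / 2 * (1/2::real)^k)" by (intro summable_mult summable_geometric) simp
      show "norm (Y (Suc k) e - Y k e) \<le> \<rho> / 2 * (1/2)^k" if "k \<ge> 0" for k
        using st[of k] le[OF \<open>e \<in> E\<close>, of "\<lambda>e. Y (Suc k) e - Y k e"] by simp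
    qed
    then have "(\<lambda>n. \<Sum>k<n. Y (Suc k) e - Y k e) \<longlonglongrightarrow> (\<Sum>k. Y (Suc k) e - Y k e)"
      by (rule summable_LIMSEQ)
    then show ?thesis using sum_lessThan_telescope[of "\<lambda>k. Y k e"] by (auto simp: Y0)
  qed
  define y where "y e = (SOME l. (\<lambda>k. Y k e) \<longlonglongrightarrow> l)" for e
  have y: "(\<lambda>k. Y k e) \<longlonglongrightarrow> y e" if "e \<in> E" for e
    unfolding y_def by (rule someI_ex[OF conv[OF that]])
  have yb: "\<bar>y e\<bar> \<le> \<rho>" if "e \<in> E" for e
    by (rule LIMSEQ_le_const2[OF tendsto_rabs[OF y[OF that]]]) (use b that in auto)
  have "T y e = y e" if e: "e \<in> E" for e
  proof -
    have "(\<lambda>k. (\<Sum>e\<in>E. \<bar>y e - Y k e\<bar>) / 2 + \<bar>Y (Suc k) e - y e\<bar>) \<longlonglongrightarrow> (\<Sum>e\<in>E. \<bar>y e - y e\<bar>) / 2 + \<bar>y e - y e\<bar>"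
      by (intro tendsto_intros y e LIMSEQ_Suc[OF y[OF e]]) simp_all
    moreover have "\<bar>T y e - y e\<bar> \<le> (\<Sum>e\<in>E. \<bar>y e - Y k e\<bar>) / 2 + \<bar>Y (Suc k) e - y e\<bar>" for k
    proof -
      have "\<bar>T y e - T (Y k) e\<bar> \<le> (\<Sum>e\<in>E. \<bar>y e - Y k e\<bar>) / 2"
        by (rule order_trans[OF le[OF e, of "\<lambda>e. T y e - T (Y k) e"] contr]) (use yb b in auto)
      then show ?thesis unfolding YS by linarith
    qed
    ultimately have "\<bar>T y e - y e\<bar> \<le> (\<Sum>e\<in>E. \<bar>y e - y e\<bar>) / 2 + \<bar>y e - y e\<bar>"
      by (intro LIMSEQ_le_const) auto
    then show ?thesis by simp
  qed
  with yb show ?thesis using that by blast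
qed

section \<open>Strict derivatives and the implicit function theorem\<close>

text \<open>Both points vary near \<open>z\<close>, so \<open>f - L\<close> is Lipschitz there with
  an arbitrarily small constant, which is what a contraction argument needs. The notion replaces
  continuous differentiability and is closed under sums and products, hence covers all polynomials
  in the coordinates.\<close>

definition strict_deriv :: "'i set \<Rightarrow> (('i \<Rightarrow> real) \<Rightarrow> real) \<Rightarrow> (('i \<Rightarrow> real) \<Rightarrow> real) \<Rightarrow> ('i \<Rightarrow> real) \<Rightarrow> bool" where
  "strict_deriv J f L z \<longleftrightarrow> (\<exists>c. \<forall>h. L h = (\<Sum>i\<in>J. c i * h i)) \<and>
    (\<forall>\<eta>>0. \<exists>r>0. \<forall>x y. (\<forall>i\<in>J. \<bar>x i - z i\<bar> \<le> r \<and> \<bar>y i - z i\<bar> \<le> r) \<longrightarrow>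
      \<bar>f x - f y - L (\<lambda>i. x i - y i)\<bar> \<le> \<eta> * (\<Sum>i\<in>J. \<bar>x i - y i\<bar>))"

lemma strict_derivD:
  assumes "strict_deriv J f L z" "\<eta> > 0"
  obtains r where "r > 0" "\<And>x y. (\<And>i. i \<in> J \<Longrightarrow> \<bar>x i - z i\<bar> \<le> r) \<Longrightarrow> (\<And>i. i \<in> J \<Longrightarrow> \<bar>y i - z i\<bar> \<le> r) \<Longrightarrow>
      \<bar>f x - f y - L (\<lambda>i. x i - y i)\<bar> \<le> \<eta> * (\<Sum>i\<in>J. \<bar>x i - y i\<bar>)"
proof -
  from assms have "\<exists>r>0. \<forall>x y. (\<forall>i\<in>J. \<bar>x i - z i\<bar> \<le> r \<and> \<bar>y i - z i\<bar> \<le> r) \<longrightarrow>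
      \<bar>f x - f y - L (\<lambda>i. x i - y i)\<bar> \<le> \<eta> * (\<Sum>i\<in>J. \<bar>x i - y i\<bar>)"
    unfolding strict_deriv_def by blast
  then obtain r where "r > 0" and r: "\<forall>x y. (\<forall>i\<in>J. \<bar>x i - z i\<bar> \<le> r \<and> \<bar>y i - z i\<bar> \<le> r) \<longrightarrow>
      \<bar>f x - f y - L (\<lambda>i. x i - y i)\<bar> \<le> \<eta> * (\<Sum>i\<in>J. \<bar>x i - y i\<bar>)" by blast
  show ?thesis by (rule that[OF \<open>r > 0\<close>]) (simp add: r)
qed

lemma strict_deriv_bound:
  assumes "strict_deriv J f L z" "finite J"
  obtains K where "K \<ge> 0" "\<And>h. \<bar>L h\<bar> \<le> K * (\<Sum>i\<in>J. \<bar>h i\<bar>)"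
proof -
  obtain c where c: "\<And>h. L h = (\<Sum>i\<in>J. c i * h i)" using assms by (auto simp: strict_deriv_def)
  show ?thesis
  proof (rule that[of "\<Sum>i\<in>J. \<bar>c i\<bar>"])
    fix h
    have "\<bar>L h\<bar> \<le> (\<Sum>i\<in>J. \<bar>c i * h i\<bar>)" unfolding c by (rule sum_abs)
    also have "\<dots> \<le> (\<Sum>i\<in>J. (\<Sum>i\<in>J. \<bar>c i\<bar>) * \<bar>h i\<bar>)"
      by (rule sum_mono) (use assms(2) in \<open>auto simp: abs_mult intro!: mult_right_mono member_le_sum\<close>)
    finally show "\<bar>L h\<bar> \<le> (\<Sum>i\<in>J. \<bar>c i\<bar>) * (\<Sum>i\<in>J. \<bar>h i\<bar>)" by (simp add: sum_distrib_left)
  qed (simp add: sum_nonneg)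
qed

lemma strict_deriv_cont:
  assumes "strict_deriv J f L z" "finite J" "\<eta> > 0"
  obtains r where "r > 0" "\<And>x. (\<And>i. i \<in> J \<Longrightarrow> \<bar>x i - z i\<bar> \<le> r) \<Longrightarrow> \<bar>f x - f z\<bar> \<le> \<eta>"
proof -
  obtain r where r: "r > 0" "\<And>x y. (\<And>i. i \<in> J \<Longrightarrow> \<bar>x i - z i\<bar> \<le> r) \<Longrightarrow> (\<And>i. i \<in> J \<Longrightarrow> \<bar>y i - z i\<bar> \<le> r) \<Longrightarrow>
      \<bar>f x - f y - L (\<lambda>i. x i - y i)\<bar> \<le> 1 * (\<Sum>i\<in>J. \<bar>x i - y i\<bar>)"
    using strict_derivD[OF assms(1), of 1] by auto
  obtain K where K: "K \<ge> 0" "\<And>h. \<bar>L h\<bar> \<le> K * (\<Sum>i\<in>J. \<bar>h i\<bar>)"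
    using strict_deriv_bound[OF assms(1,2)] by blast
  define q where "q = (K + 1) * (card J + 1)"
  have q: "q > 0" using K by (simp add: q_def add_nonneg_pos)
  show ?thesis
  proof (rule that[of "min r (\<eta> / q)"])
    show "0 < min r (\<eta> / q)" using r q assms by simp
    fix x assume x: "\<And>i. i \<in> J \<Longrightarrow> \<bar>x i - z i\<bar> \<le> min r (\<eta> / q)"
    have "\<bar>f x - f z - L (\<lambda>i. x i - z i)\<bar> \<le> 1 * (\<Sum>i\<in>J. \<bar>x i - z i\<bar>)"
      by (rule r(2)) (use x r(1) in auto)
    with K(2)[of "\<lambda>i. x i - z i"] have "\<bar>f x - f z\<bar> \<le> (K + 1) * (\<Sum>i\<in>J. \<bar>x i - z i\<bar>)"
      by (simp add: algebra_simps)
    also have "\<dots> \<le> (K + 1) * (\<Sum>i\<in>J. \<eta> / q)"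
      using x K(1) by (intro mult_left_mono sum_mono) auto
    also have "\<dots> \<le> (K + 1) * ((card J + 1) * (\<eta> / q))"
      using K(1) assms(3) q by (intro mult_left_mono) (auto simp: divide_simps)
    also have "\<dots> = q * (\<eta> / q)" by (simp add: q_def)
    also have "\<dots> = \<eta>" using q by simp
    finally show "\<bar>f x - f z\<bar> \<le> \<eta>" .
  qed
qed

lemma strict_deriv_const: "strict_deriv J (\<lambda>_. a) (\<lambda>_. 0) z"
  unfolding strict_deriv_def by (auto intro!: exI[of _ "\<lambda>_. 0"] exI[of _ 1] mult_nonneg_nonneg sum_nonneg)

lemma strict_deriv_coord: "finite J \<Longrightarrow> i \<in> J \<Longrightarrow> strict_deriv J (\<lambda>x. x i) (\<lambda>h. h i) z"
  unfolding strict_deriv_def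
  by (auto intro!: exI[of _ "\<lambda>j. if j = i then 1 else 0"] exI[of _ 1] mult_nonneg_nonneg sum_nonneg
      simp: sum.delta if_distrib if_distribR cong: if_cong)

lemma strict_deriv_add:
  assumes "strict_deriv J f L z" "strict_deriv J g M z"
  shows "strict_deriv J (\<lambda>x. f x + g x) (\<lambda>h. L h + M h) z"
  unfolding strict_deriv_def
proof (intro conjI allI impI)
  obtain c d where "\<And>h. L h = (\<Sum>i\<in>J. c i * h i)" "\<And>h. M h = (\<Sum>i\<in>J. d i * h i)"
    using assms by (auto simp: strict_deriv_def)
  then show "\<exists>c. \<forall>h. L h + M h = (\<Sum>i\<in>J. c i * h i)"
    by (intro exI[of _ "\<lambda>i. c i + d i"]) (simp add: algebra_simps sum.distrib)
  fix \<eta> :: real assume "\<eta> > 0"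
  then have \<eta>: "\<eta> / 2 > 0" by simp
  obtain r where r: "r > 0" "\<And>x y. (\<And>i. i \<in> J \<Longrightarrow> \<bar>x i - z i\<bar> \<le> r) \<Longrightarrow> (\<And>i. i \<in> J \<Longrightarrow> \<bar>y i - z i\<bar> \<le> r) \<Longrightarrow>
      \<bar>f x - f y - L (\<lambda>i. x i - y i)\<bar> \<le> \<eta> / 2 * (\<Sum>i\<in>J. \<bar>x i - y i\<bar>)"
    using strict_derivD[OF assms(1) \<eta>] by blast
  obtain s where s: "s > 0" "\<And>x y. (\<And>i. i \<in> J \<Longrightarrow> \<bar>x i - z i\<bar> \<le> s) \<Longrightarrow> (\<And>i. i \<in> J \<Longrightarrow> \<bar>y i - z i\<bar> \<le> s) \<Longrightarrow>
      \<bar>g x - g y - M (\<lambda>i. x i - y i)\<bar> \<le> \<eta> / 2 * (\<Sum>i\<in>J. \<bar>x i - y i\<bar>)"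
    using strict_derivD[OF assms(2) \<eta>] by blast
  show "\<exists>r>0. \<forall>x y. (\<forall>i\<in>J. \<bar>x i - z i\<bar> \<le> r \<and> \<bar>y i - z i\<bar> \<le> r) \<longrightarrow>
      \<bar>f x + g x - (f y + g y) - (L (\<lambda>i. x i - y i) + M (\<lambda>i. x i - y i))\<bar> \<le> \<eta> * (\<Sum>i\<in>J. \<bar>x i - y i\<bar>)"
  proof (rule exI[of _ "min r s"], intro conjI allI impI)
    fix x y assume "\<forall>i\<in>J. \<bar>x i - z i\<bar> \<le> min r s \<and> \<bar>y i - z i\<bar> \<le> min r s"
    with r(2)[of x y] s(2)[of x y]
    have "\<bar>f x - f y - L (\<lambda>i. x i - y i)\<bar> \<le> \<eta> / 2 * (\<Sum>i\<in>J. \<bar>x i - y i\<bar>)"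
      "\<bar>g x - g y - M (\<lambda>i. x i - y i)\<bar> \<le> \<eta> / 2 * (\<Sum>i\<in>J. \<bar>x i - y i\<bar>)" by auto
    then show "\<bar>f x + g x - (f y + g y) - (L (\<lambda>i. x i - y i) + M (\<lambda>i. x i - y i))\<bar> \<le> \<eta> * (\<Sum>i\<in>J. \<bar>x i - y i\<bar>)"
      by linarith
  qed (use r s in auto)
qed

lemma strict_deriv_mult:
  assumes "strict_deriv J f L z" "strict_deriv J g M z" "finite J"
  shows "strict_deriv J (\<lambda>x. f x * g x) (\<lambda>h. f z * M h + L h * g z) z"
  unfolding strict_deriv_def
proof (intro conjI allI impI)
  obtain c d where "\<And>h. L h = (\<Sum>i\<in>J. c i * h i)" "\<And>h. M h = (\<Sum>i\<in>J. d i * h i)"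
    using assms by (auto simp: strict_deriv_def)
  then show "\<exists>c. \<forall>h. f z * M h + L h * g z = (\<Sum>i\<in>J. c i * h i)"
    by (intro exI[of _ "\<lambda>i. f z * d i + c i * g z"])
      (simp add: algebra_simps sum.distrib sum_distrib_left sum_distrib_right)
  fix \<eta> :: real assume \<eta>0: "\<eta> > 0"
  obtain K where K: "K \<ge> 0" "\<And>h. \<bar>L h\<bar> \<le> K * (\<Sum>i\<in>J. \<bar>h i\<bar>)"
    using strict_deriv_bound[OF assms(1,3)] by blast
  obtain K' where K': "K' \<ge> 0" "\<And>h. \<bar>M h\<bar> \<le> K' * (\<Sum>i\<in>J. \<bar>h i\<bar>)"
    using strict_deriv_bound[OF assms(2,3)] by blast
  \<comment> \<open>The sum of the coefficients in the final estimate. The two summands 1 arise from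
    bounding \<open>f x\<close> and \<open>g y\<close> by their values at \<open>z\<close>; this is
    the reason for \<open>min e 1\<close> below.\<close>
  define Q where "Q = (\<bar>f z\<bar> + 1) + (\<bar>g z\<bar> + 1) + K + K'"
  have Q: "Q > 0" using K K' by (simp add: Q_def add_pos_nonneg)
  define e where "e = \<eta> / Q"
  have e: "e > 0" using \<eta>0 Q by (simp add: e_def)
  then have e1: "min e 1 > 0" by simp
  obtain r where r: "r > 0" "\<And>x y. (\<And>i. i \<in> J \<Longrightarrow> \<bar>x i - z i\<bar> \<le> r) \<Longrightarrow> (\<And>i. i \<in> J \<Longrightarrow> \<bar>y i - z i\<bar> \<le> r) \<Longrightarrow>
      \<bar>f x - f y - L (\<lambda>i. x i - y i)\<bar> \<le> e * (\<Sum>i\<in>J. \<bar>x i - y i\<bar>)"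
    using strict_derivD[OF assms(1) e] by blast
  obtain s where s: "s > 0" "\<And>x y. (\<And>i. i \<in> J \<Longrightarrow> \<bar>x i - z i\<bar> \<le> s) \<Longrightarrow> (\<And>i. i \<in> J \<Longrightarrow> \<bar>y i - z i\<bar> \<le> s) \<Longrightarrow>
      \<bar>g x - g y - M (\<lambda>i. x i - y i)\<bar> \<le> e * (\<Sum>i\<in>J. \<bar>x i - y i\<bar>)"
    using strict_derivD[OF assms(2) e] by blast
  obtain r' where r': "r' > 0" "\<And>x. (\<And>i. i \<in> J \<Longrightarrow> \<bar>x i - z i\<bar> \<le> r') \<Longrightarrow> \<bar>f x - f z\<bar> \<le> min e 1"
    using strict_deriv_cont[OF assms(1,3) e1] by blast
  obtain s' where s': "s' > 0" "\<And>x. (\<And>i. i \<in> J \<Longrightarrow> \<bar>x i - z i\<bar> \<le> s') \<Longrightarrow> \<bar>g x - g z\<bar> \<le> min e 1"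
    using strict_deriv_cont[OF assms(2,3) e1] by blast
  show "\<exists>r>0. \<forall>x y. (\<forall>i\<in>J. \<bar>x i - z i\<bar> \<le> r \<and> \<bar>y i - z i\<bar> \<le> r) \<longrightarrow>
      \<bar>f x * g x - f y * g y - (f z * M (\<lambda>i. x i - y i) + L (\<lambda>i. x i - y i) * g z)\<bar> \<le> \<eta> * (\<Sum>i\<in>J. \<bar>x i - y i\<bar>)"
  proof (rule exI[of _ "min (min r s) (min r' s')"], intro conjI allI impI)
    fix x y assume xy: "\<forall>i\<in>J. \<bar>x i - z i\<bar> \<le> min (min r s) (min r' s') \<and> \<bar>y i - z i\<bar> \<le> min (min r s) (min r' s')"
    define D where "D = (\<Sum>i\<in>J. \<bar>x i - y i\<bar>)"
    have D: "D \<ge> 0" by (simp add: D_def sum_nonneg)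
    define l where "l = L (\<lambda>i. x i - y i)"
    define m where "m = M (\<lambda>i. x i - y i)"
    have 1: "\<bar>f x - f y - l\<bar> \<le> e * D" unfolding D_def l_def by (rule r(2)) (use xy in auto)
    have 2: "\<bar>g x - g y - m\<bar> \<le> e * D" unfolding D_def m_def by (rule s(2)) (use xy in auto)
    have 3: "\<bar>f x - f z\<bar> \<le> min e 1" by (rule r'(2)) (use xy in auto)
    have 4: "\<bar>g y - g z\<bar> \<le> min e 1" by (rule s'(2)) (use xy in auto)
    have 5: "\<bar>l\<bar> \<le> K * D" "\<bar>m\<bar> \<le> K' * D" using K(2) K'(2) by (auto simp: l_def m_def D_def)
    \<comment> \<open>In every term of this decomposition one factor is bounded by a constant or by
      a multiple of \<open>D\<close>, and the other one contributes the small factor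
      \<open>e\<close>.\<close>
    have eq: "f x * g x - f y * g y - (f z * m + l * g z)
      = f x * (g x - g y - m) + (f x - f z) * m + g y * (f x - f y - l) + (g y - g z) * l"
      by (simp add: algebra_simps)
    have "\<bar>f x * g x - f y * g y - (f z * m + l * g z)\<bar> \<le> \<bar>f x\<bar> * \<bar>g x - g y - m\<bar> + \<bar>f x - f z\<bar> * \<bar>m\<bar> + \<bar>g y\<bar> * \<bar>f x - f y - l\<bar> + \<bar>g y - g z\<bar> * \<bar>l\<bar>"
      unfolding eq abs_mult[symmetric] by linarith
    also have "\<dots> \<le> (\<bar>f z\<bar> + 1) * (e * D) + e * (K' * D) + (\<bar>g z\<bar> + 1) * (e * D) + e * (K * D)"
    proof -
      have "\<bar>f x\<bar> \<le> \<bar>f z\<bar> + 1" "\<bar>g y\<bar> \<le> \<bar>g z\<bar> + 1" "\<bar>f x - f z\<bar> \<le> e" "\<bar>g y - g z\<bar> \<le> e"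
        using 3 4 by linarith+
      moreover have "e \<ge> 0" "e * D \<ge> 0" using e D by simp_all
      ultimately show ?thesis using 1 2 5
        by (intro add_mono mult_mono) (assumption | rule abs_ge_zero add_nonneg_nonneg zero_le_one)+
    qed
    also have "\<dots> = Q * e * D" by (simp add: Q_def algebra_simps)
    also have "\<dots> = \<eta> * D" using Q by (simp add: e_def)
    finally show "\<bar>f x * g x - f y * g y - (f z * M (\<lambda>i. x i - y i) + L (\<lambda>i. x i - y i) * g z)\<bar> \<le> \<eta> * (\<Sum>i\<in>J. \<bar>x i - y i\<bar>)"
      unfolding l_def m_def D_def .
  qed (use r s r' s' in auto)
qed

lemma strict_deriv_minus:
  assumes "strict_deriv J f L z"
  shows "strict_deriv J (\<lambda>x. - f x) (\<lambda>h. - L h) z"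
  unfolding strict_deriv_def
proof (intro conjI allI impI)
  obtain c where "\<And>h. L h = (\<Sum>i\<in>J. c i * h i)" using assms by (auto simp: strict_deriv_def)
  then show "\<exists>c. \<forall>h. - L h = (\<Sum>i\<in>J. c i * h i)"
    by (intro exI[of _ "\<lambda>i. - c i"]) (simp add: sum_negf)
  fix \<eta> :: real assume "\<eta> > 0"
  obtain r where r: "r > 0" "\<And>x y. (\<And>i. i \<in> J \<Longrightarrow> \<bar>x i - z i\<bar> \<le> r) \<Longrightarrow> (\<And>i. i \<in> J \<Longrightarrow> \<bar>y i - z i\<bar> \<le> r) \<Longrightarrow>
      \<bar>f x - f y - L (\<lambda>i. x i - y i)\<bar> \<le> \<eta> * (\<Sum>i\<in>J. \<bar>x i - y i\<bar>)"
    using strict_derivD[OF assms(1) \<open>\<eta> > 0\<close>] by blast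
  have *: "\<bar>- a - - b - - c\<bar> = \<bar>a - b - c\<bar>" for a b c :: real by simp
  show "\<exists>r>0. \<forall>x y. (\<forall>i\<in>J. \<bar>x i - z i\<bar> \<le> r \<and> \<bar>y i - z i\<bar> \<le> r) \<longrightarrow>
      \<bar>- f x - - f y - - L (\<lambda>i. x i - y i)\<bar> \<le> \<eta> * (\<Sum>i\<in>J. \<bar>x i - y i\<bar>)"
    unfolding * using r by blast
qed

lemma strict_deriv_diff:
  "strict_deriv J f L z \<Longrightarrow> strict_deriv J g M z \<Longrightarrow> strict_deriv J (\<lambda>x. f x - g x) (\<lambda>h. L h - M h) z"
  using strict_deriv_add[OF _ strict_deriv_minus, of J f L z g M] by simp

lemma strict_deriv_sum:
  assumes "finite S" "\<And>s. s \<in> S \<Longrightarrow> strict_deriv J (f s) (L s) z"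
  shows "strict_deriv J (\<lambda>x. \<Sum>s\<in>S. f s x) (\<lambda>h. \<Sum>s\<in>S. L s h) z"
  using assms by (induction S rule: finite_induct) (auto simp: strict_deriv_const intro: strict_deriv_add)

text \<open>\<open>t\<close> is the parameter, and \<open>inj\<close> says in dual form that the
  derivative in the remaining directions is onto. With a right inverse \<open>R\<close> of the
  derivative, the ansatz \<open>x = z + R y\<close> leaves as many unknowns as equations, and a zero
  is a fixed point of the simplified Newton step that maps \<open>y\<close> to
  \<open>y - f (X y)\<close>.\<close>

lemma implicit_zero:
  fixes f :: "'e \<Rightarrow> ('i \<Rightarrow> real) \<Rightarrow> real"
  assumes fI: "finite I" and fE: "finite E" and tI: "t \<notin> I"
    and strict_deriv: "\<And>e. e \<in> E \<Longrightarrow> strict_deriv (insert t I) (f e) (L e) z"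
    and zt: "z t = 0" and fz: "\<And>e. e \<in> E \<Longrightarrow> f e z = 0"
    and inj: "\<And>u. (\<And>h. h t = 0 \<Longrightarrow> (\<Sum>e\<in>E. u e * L e h) = 0) \<Longrightarrow> \<forall>e\<in>E. u e = 0"
    and r: "r > 0"
  obtains \<delta> where "\<delta> > 0" "\<And>s. \<bar>s\<bar> \<le> \<delta> \<Longrightarrow>
    \<exists>x. x t = s \<and> (\<forall>i\<in>I. \<bar>x i - z i\<bar> \<le> r) \<and> (\<forall>e\<in>E. f e x = 0)"
proof -
  have "\<forall>e\<in>E. \<exists>c. \<forall>h. L e h = (\<Sum>i\<in>insert t I. c i * h i)"
    using strict_deriv by (auto simp: strict_deriv_def)
  then obtain c where c: "\<And>e h. e \<in> E \<Longrightarrow> L e h = (\<Sum>i\<in>insert t I. c e i * h i)" by metis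
  have cI: "L e h = (\<Sum>i\<in>I. c e i * h i)" if "e \<in> E" "h t = 0" for e h
    using c[OF that(1), of h] that(2) fI tI by simp
  have inj': "\<forall>e\<in>E. u e = 0" if u: "\<And>i. i \<in> I \<Longrightarrow> (\<Sum>e\<in>E. u e * c e i) = 0" for u
  proof (rule inj)
    fix h :: "'i \<Rightarrow> real" assume h: "h t = 0"
    have "(\<Sum>e\<in>E. u e * L e h) = (\<Sum>e\<in>E. \<Sum>i\<in>I. u e * c e i * h i)"
      by (intro sum.cong) (auto simp: cI h sum_distrib_left mult.assoc)
    also have "\<dots> = (\<Sum>i\<in>I. (\<Sum>e\<in>E. u e * c e i) * h i)"
      by (subst sum.swap) (simp add: sum_distrib_right)
    finally show "(\<Sum>e\<in>E. u e * L e h) = 0" using u by simp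
  qed
  obtain R where R: "\<And>e e'. e \<in> E \<Longrightarrow> e' \<in> E \<Longrightarrow> (\<Sum>i\<in>I. c e i * R i e') = (if e = e' then 1 else 0)"
    using gram_right_inverse[of I E c] fI fE inj' by blast
  define K where "K = (\<Sum>i\<in>I. \<Sum>e\<in>E. \<bar>R i e\<bar>) + 1"
  have K: "K \<ge> 1" by (simp add: K_def sum_nonneg)
  \<comment> \<open>Makes \<open>card E * \<eta> * K\<close> at most 1/2, the contraction
    factor.\<close>
  define \<eta> where "\<eta> = 1 / (2 * K * (card E + 1))"
  have \<eta>: "\<eta> > 0" using K by (simp add: \<eta>_def)
  have "\<forall>e\<in>E. \<exists>r>0. \<forall>x y. (\<forall>i\<in>insert t I. \<bar>x i - z i\<bar> \<le> r \<and> \<bar>y i - z i\<bar> \<le> r) \<longrightarrow>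
      \<bar>f e x - f e y - L e (\<lambda>i. x i - y i)\<bar> \<le> \<eta> * (\<Sum>i\<in>insert t I. \<bar>x i - y i\<bar>)"
    using strict_deriv[unfolded strict_deriv_def, THEN conjunct2, THEN spec, THEN mp, OF _ \<eta>] by (rule ballI)
  then obtain rr where rr: "\<And>e. e \<in> E \<Longrightarrow> rr e > 0"
    "\<And>e x y. e \<in> E \<Longrightarrow> (\<forall>i\<in>insert t I. \<bar>x i - z i\<bar> \<le> rr e \<and> \<bar>y i - z i\<bar> \<le> rr e) \<Longrightarrow>
      \<bar>f e x - f e y - L e (\<lambda>i. x i - y i)\<bar> \<le> \<eta> * (\<Sum>i\<in>insert t I. \<bar>x i - y i\<bar>)"
    by (elim bchoice[THEN exE]) blast
  define r0 where "r0 = Min (insert r (rr ` E))"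
  have r0: "r0 > 0" "r0 \<le> r" "\<And>e. e \<in> E \<Longrightarrow> r0 \<le> rr e"
    using fE r rr(1) by (auto simp: r0_def)
  \<comment> \<open>If all coordinates of \<open>y\<close> are at most \<open>\<rho>\<close>, then
    \<open>X y\<close> stays within \<open>r0\<close> of \<open>z\<close>. The bound
    \<open>q\<close> below makes the total residual at the starting point at most
    \<open>\<rho> / 2\<close>.\<close>
  define \<rho> where "\<rho> = r0 / (K * (card E + 1))"
  have \<rho>: "\<rho> > 0" using r0 K by (simp add: \<rho>_def)
  define q where "q = \<rho> / (2 * (card E + 1))"
  have q: "q > 0" using \<rho> by (simp add: q_def)
  have "\<forall>e\<in>E. \<exists>r>0. \<forall>x. (\<forall>i\<in>insert t I. \<bar>x i - z i\<bar> \<le> r) \<longrightarrow> \<bar>f e x - f e z\<bar> \<le> q"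
  proof
    fix e assume "e \<in> E"
    show "\<exists>r>0. \<forall>x. (\<forall>i\<in>insert t I. \<bar>x i - z i\<bar> \<le> r) \<longrightarrow> \<bar>f e x - f e z\<bar> \<le> q"
    proof (rule strict_deriv_cont[OF strict_deriv[OF \<open>e \<in> E\<close>] _ q])
      fix r assume r: "0 < r" "\<And>x. (\<And>i. i \<in> insert t I \<Longrightarrow> \<bar>x i - z i\<bar> \<le> r) \<Longrightarrow> \<bar>f e x - f e z\<bar> \<le> q"
      show ?thesis
      proof (intro exI[of _ r] conjI allI impI r)
        fix x i assume "\<forall>i\<in>insert t I. \<bar>x i - z i\<bar> \<le> r" "i \<in> insert t I"
        then show "\<bar>x i - z i\<bar> \<le> r" by blast
      qed
    qed (use fI in simp)
  qed
  then obtain ss where ss: "\<And>e. e \<in> E \<Longrightarrow> ss e > 0"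
    "\<And>e x. e \<in> E \<Longrightarrow> (\<forall>i\<in>insert t I. \<bar>x i - z i\<bar> \<le> ss e) \<Longrightarrow> \<bar>f e x - f e z\<bar> \<le> q" by metis
  define \<delta> where "\<delta> = Min (insert r0 (ss ` E))"
  have \<delta>: "\<delta> > 0" "\<delta> \<le> r0" "\<And>e. e \<in> E \<Longrightarrow> \<delta> \<le> ss e"
    using fE r0 ss(1) by (auto simp: \<delta>_def)
  show ?thesis
  proof (rule that[OF \<delta>(1)])
    fix s :: real assume s: "\<bar>s\<bar> \<le> \<delta>"
    define X where "X y i = (if i = t then s else z i + (\<Sum>e\<in>E. R i e * y e))" for y :: "'e \<Rightarrow> real" and i
    define T where "T y e = y e - f e (X y)" for y e
    have sumb: "\<bar>\<Sum>e\<in>E. R i e * y e\<bar> \<le> K * (\<Sum>e\<in>E. \<bar>y e\<bar>)" if "i \<in> I" for i y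
    proof -
      have "\<bar>\<Sum>e\<in>E. R i e * y e\<bar> \<le> (\<Sum>e\<in>E. \<bar>R i e\<bar> * \<bar>y e\<bar>)"
        using sum_abs[of "\<lambda>e. R i e * y e" E] by (simp add: abs_mult)
      also have "\<dots> \<le> (\<Sum>e\<in>E. K * \<bar>y e\<bar>)"
      proof (intro sum_mono mult_right_mono)
        fix e assume e: "e \<in> E"
        have "\<bar>R i e\<bar> \<le> (\<Sum>e\<in>E. \<bar>R i e\<bar>)" by (rule member_le_sum) (use e fE in auto)
        also have "\<dots> \<le> (\<Sum>i\<in>I. \<Sum>e\<in>E. \<bar>R i e\<bar>)" by (rule member_le_sum) (use that fI in \<open>auto simp: sum_nonneg\<close>)
        finally show "\<bar>R i e\<bar> \<le> K" by (simp add: K_def)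
      qed simp
      finally show ?thesis by (simp add: sum_distrib_left)
    qed
    have sumb2: "(\<Sum>i\<in>I. \<bar>\<Sum>e\<in>E. R i e * y e\<bar>) \<le> K * (\<Sum>e\<in>E. \<bar>y e\<bar>)" for y
    proof -
      have "(\<Sum>i\<in>I. \<bar>\<Sum>e\<in>E. R i e * y e\<bar>) \<le> (\<Sum>i\<in>I. \<Sum>e\<in>E. \<bar>R i e\<bar> * (\<Sum>e\<in>E. \<bar>y e\<bar>))"
      proof (intro sum_mono)
        fix i assume "i \<in> I"
        have "\<bar>\<Sum>e\<in>E. R i e * y e\<bar> \<le> (\<Sum>e\<in>E. \<bar>R i e\<bar> * \<bar>y e\<bar>)"
          using sum_abs[of "\<lambda>e. R i e * y e" E] by (simp add: abs_mult)
        also have "\<dots> \<le> (\<Sum>e\<in>E. \<bar>R i e\<bar> * (\<Sum>e\<in>E. \<bar>y e\<bar>))"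
          using fE by (intro sum_mono mult_left_mono member_le_sum) auto
        finally show "\<bar>\<Sum>e\<in>E. R i e * y e\<bar> \<le> (\<Sum>e\<in>E. \<bar>R i e\<bar> * (\<Sum>e\<in>E. \<bar>y e\<bar>))" .
      qed
      also have "\<dots> = (K - 1) * (\<Sum>e\<in>E. \<bar>y e\<bar>)"
        by (simp add: K_def sum_distrib_right)
      also have "\<dots> \<le> K * (\<Sum>e\<in>E. \<bar>y e\<bar>)"
        by (intro mult_right_mono) (auto simp: sum_nonneg)
      finally show ?thesis .
    qed
    have Xz: "\<bar>X y i - z i\<bar> \<le> r0" if "i \<in> insert t I" "\<And>e. e \<in> E \<Longrightarrow> \<bar>y e\<bar> \<le> \<rho>" for y i
    proof (cases "i = t")
      case True then show ?thesis using s \<delta>(2) zt by (simp add: X_def)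
    next
      case False
      then have "\<bar>X y i - z i\<bar> \<le> K * (\<Sum>e\<in>E. \<bar>y e\<bar>)" using sumb that by (simp add: X_def)
      also have "\<dots> \<le> K * (\<Sum>e\<in>E. \<rho>)" using K that(2) by (intro mult_left_mono sum_mono) auto
      also have "\<dots> \<le> K * ((card E + 1) * \<rho>)" using K \<rho> by (intro mult_left_mono) auto
      also have "\<dots> = r0" using K by (simp add: \<rho>_def)
      finally show ?thesis .
    qed
    obtain y where y: "\<And>e. e \<in> E \<Longrightarrow> \<bar>y e\<bar> \<le> \<rho>" "\<And>e. e \<in> E \<Longrightarrow> T y e = y e"
    proof (rule contraction_fixpoint[OF fE \<rho>, of T])
      fix x y assume xy: "\<And>e. e \<in> E \<Longrightarrow> \<bar>x e\<bar> \<le> \<rho> \<and> \<bar>y e\<bar> \<le> \<rho>"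
      have one: "\<bar>T x e - T y e\<bar> \<le> \<eta> * (K * (\<Sum>e\<in>E. \<bar>x e - y e\<bar>))" if e: "e \<in> E" for e
      proof -
        have d: "X x i - X y i = (\<Sum>e\<in>E. R i e * (x e - y e))" if "i \<in> I" for i
          using that tI by (auto simp: X_def right_diff_distrib sum_subtractf)
        \<comment> \<open>As \<open>R\<close> is a right inverse, \<open>L\<close> returns
          \<open>x e - y e\<close>, so \<open>T x e - T y e\<close> is just the error of the linear
          approximation.\<close>
        have "L e (\<lambda>i. X x i - X y i) = (\<Sum>i\<in>I. c e i * (X x i - X y i))"
          by (rule cI[OF e]) (simp add: X_def)
        also have "\<dots> = (\<Sum>i\<in>I. \<Sum>e'\<in>E. c e i * R i e' * (x e' - y e'))"
          by (intro sum.cong) (auto simp: d sum_distrib_left mult.assoc)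
        also have "\<dots> = (\<Sum>e'\<in>E. (\<Sum>i\<in>I. c e i * R i e') * (x e' - y e'))"
          by (subst sum.swap) (simp add: sum_distrib_right)
        also have "\<dots> = (\<Sum>e'\<in>E. (if e = e' then 1 else 0) * (x e' - y e'))"
          by (intro sum.cong) (auto simp: R e)
        also have "\<dots> = (\<Sum>e'\<in>E. if e = e' then x e' - y e' else 0)" by (intro sum.cong) auto
        also have "\<dots> = x e - y e" using fE e by (simp add: sum.delta)
        finally have Le: "L e (\<lambda>i. X x i - X y i) = x e - y e" .
        have "\<bar>f e (X x) - f e (X y) - L e (\<lambda>i. X x i - X y i)\<bar> \<le> \<eta> * (\<Sum>i\<in>insert t I. \<bar>X x i - X y i\<bar>)"
          by (rule rr(2)[OF e], intro ballI conjI; rule order_trans[OF Xz r0(3)[OF e]]) (use xy in auto)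
        also have "(\<Sum>i\<in>insert t I. \<bar>X x i - X y i\<bar>) = (\<Sum>i\<in>I. \<bar>\<Sum>e\<in>E. R i e * (x e - y e)\<bar>)"
          using fI tI by (simp add: X_def d[unfolded X_def] cong: sum.cong)
        also have "\<eta> * \<dots> \<le> \<eta> * (K * (\<Sum>e\<in>E. \<bar>x e - y e\<bar>))"
          using \<eta> sumb2 by (intro mult_left_mono) auto
        finally show ?thesis unfolding T_def Le by (simp add: abs_minus_commute algebra_simps)
      qed
      have "(\<Sum>e\<in>E. \<bar>T x e - T y e\<bar>) \<le> card E * (\<eta> * (K * (\<Sum>e\<in>E. \<bar>x e - y e\<bar>)))"
        using sum_bounded_above[of E "\<lambda>e. \<bar>T x e - T y e\<bar>", OF one] by simp
      also have "\<dots> \<le> (card E + 1) * (\<eta> * (K * (\<Sum>e\<in>E. \<bar>x e - y e\<bar>)))"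
        using \<eta> K by (intro mult_right_mono) (auto intro!: mult_nonneg_nonneg sum_nonneg)
      also have "\<dots> = ((card E + 1) * \<eta> * K) * (\<Sum>e\<in>E. \<bar>x e - y e\<bar>)" by (simp add: mult.assoc)
      also have "(card E + 1) * \<eta> * K = (K * (card E + 1)) / (2 * (K * (card E + 1)))"
        by (simp add: \<eta>_def mult_ac)
      also have "\<dots> = 1 / 2"
      proof -
        have "K * (card E + 1) > 0" using K by (intro mult_pos_pos) auto
        then show ?thesis using K by auto
      qed
      finally show "(\<Sum>e\<in>E. \<bar>T x e - T y e\<bar>) \<le> (\<Sum>e\<in>E. \<bar>x e - y e\<bar>) / 2" by simp
    next
      have "\<bar>T (\<lambda>_. 0) e\<bar> \<le> q" if e: "e \<in> E" for e
      proof -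
        have "\<bar>f e (X (\<lambda>_. 0)) - f e z\<bar> \<le> q"
          by (rule ss(2)[OF e]) (use s \<delta>(1) \<delta>(3)[OF e] zt in \<open>auto simp: X_def\<close>)
        then show ?thesis using fz[OF e] by (simp add: T_def)
      qed
      then have "(\<Sum>e\<in>E. \<bar>T (\<lambda>_. 0) e\<bar>) \<le> card E * q"
        using sum_bounded_above[of E "\<lambda>e. \<bar>T (\<lambda>_. 0) e\<bar>" q] by simp
      also have "\<dots> \<le> (card E + 1) * q" using q by simp
      also have "\<dots> = \<rho> / 2" unfolding q_def by (simp add: field_simps)
      finally show "(\<Sum>e\<in>E. \<bar>T (\<lambda>_. 0) e\<bar>) \<le> \<rho> / 2" .
    qed blast
    show "\<exists>x. x t = s \<and> (\<forall>i\<in>I. \<bar>x i - z i\<bar> \<le> r) \<and> (\<forall>e\<in>E. f e x = 0)"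
    proof (intro exI[of _ "X y"] conjI ballI)
      show "X y t = s" by (simp add: X_def)
      show "\<bar>X y i - z i\<bar> \<le> r" if "i \<in> I" for i
        using Xz[of i y] y(1) that r0(2) by auto
      show "f e (X y) = 0" if "e \<in> E" for e using y(2)[OF that] by (simp add: T_def)
    qed
  qed
qed

section \<open>Perturbing a matrix with the SSP\<close>

text \<open>Matrices are functions here, and all notions look only at indices in a vertex set
  \<open>V\<close>; vertices can then be added and merged without renumbering rows.\<close>

definition sym_on :: "'v set \<Rightarrow> ('v \<Rightarrow> 'v \<Rightarrow> real) \<Rightarrow> bool" where
  "sym_on V A \<longleftrightarrow> (\<forall>i\<in>V. \<forall>j\<in>V. A i j = A j i)"

definition comm_on :: "'v set \<Rightarrow> ('v \<Rightarrow> 'v \<Rightarrow> real) \<Rightarrow> ('v \<Rightarrow> 'v \<Rightarrow> real) \<Rightarrow> bool" where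
  "comm_on V A X \<longleftrightarrow> (\<forall>i\<in>V. \<forall>j\<in>V. (\<Sum>k\<in>V. A i k * X k j) = (\<Sum>k\<in>V. X i k * A k j))"

definition ssp_on :: "'v set \<Rightarrow> ('v \<Rightarrow> 'v \<Rightarrow> real) \<Rightarrow> bool" where
  "ssp_on V A \<longleftrightarrow> (\<forall>X. sym_on V X \<longrightarrow> (\<forall>i\<in>V. \<forall>j\<in>V. i = j \<or> A i j \<noteq> 0 \<longrightarrow> X i j = 0) \<longrightarrow>
     comm_on V A X \<longrightarrow> (\<forall>i\<in>V. \<forall>j\<in>V. X i j = 0))"

lemma sym_onD: "sym_on V A \<Longrightarrow> i \<in> V \<Longrightarrow> j \<in> V \<Longrightarrow> A i j = A j i"
  by (simp add: sym_on_def)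

lemma comm_onD: "comm_on V A X \<Longrightarrow> i \<in> V \<Longrightarrow> j \<in> V \<Longrightarrow>
    (\<Sum>k\<in>V. A i k * X k j) = (\<Sum>k\<in>V. X i k * A k j)"
  by (simp add: comm_on_def)

lemma ssp_onD: "ssp_on V A \<Longrightarrow> sym_on V X \<Longrightarrow>
    (\<And>i j. i \<in> V \<Longrightarrow> j \<in> V \<Longrightarrow> i = j \<or> A i j \<noteq> 0 \<Longrightarrow> X i j = 0) \<Longrightarrow>
    comm_on V A X \<Longrightarrow> i \<in> V \<Longrightarrow> j \<in> V \<Longrightarrow> X i j = 0"
  unfolding ssp_on_def by blast

definition kron :: "'v \<Rightarrow> 'v \<Rightarrow> real" where
  "kron i j = (if i = j then 1 else 0)"

lemma sum_kron:
  assumes "finite V" "i \<in> V"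
  shows "(\<Sum>l\<in>V. kron l i * g l) = g i" "(\<Sum>l\<in>V. kron i l * g l) = g i"
    "(\<Sum>l\<in>V. g l * kron l i) = g i" "(\<Sum>l\<in>V. g l * kron i l) = g i"
proof -
  have "(\<Sum>l\<in>V. kron l i * g l) = (\<Sum>l\<in>V. if l = i then g l else 0)"
    by (rule sum.cong) (auto simp: kron_def)
  with assms show "(\<Sum>l\<in>V. kron l i * g l) = g i" by simp
  then show "(\<Sum>l\<in>V. kron i l * g l) = g i" "(\<Sum>l\<in>V. g l * kron l i) = g i" "(\<Sum>l\<in>V. g l * kron i l) = g i"
    by (simp_all add: mult.commute[of "g _"] kron_def eq_commute[of i])
qed

lemma sum_kron2:
  assumes "finite V" "k \<in> V" "l \<in> V"
  shows "(\<Sum>i\<in>V. \<Sum>j\<in>V. U i j * (kron i k * kron j l)) = U k l"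
    "(\<Sum>i\<in>V. \<Sum>j\<in>V. U i j * (kron j k * kron i l)) = U l k"
proof -
  have "(\<Sum>i\<in>V. \<Sum>j\<in>V. U i j * (kron i k * kron j l)) = (\<Sum>i\<in>V. kron i k * (\<Sum>j\<in>V. U i j * kron j l))"
    by (simp add: sum_distrib_left mult_ac)
  then show "(\<Sum>i\<in>V. \<Sum>j\<in>V. U i j * (kron i k * kron j l)) = U k l" using assms by (simp add: sum_kron)
  have "(\<Sum>i\<in>V. \<Sum>j\<in>V. U i j * (kron j k * kron i l)) = (\<Sum>i\<in>V. kron i l * (\<Sum>j\<in>V. U i j * kron j k))"
    by (simp add: sum_distrib_left mult_ac)
  then show "(\<Sum>i\<in>V. \<Sum>j\<in>V. U i j * (kron j k * kron i l)) = U l k" using assms by (simp add: sum_kron)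
qed

lemma strict_deriv_if:
  assumes "c \<Longrightarrow> strict_deriv J f L z" "\<not> c \<Longrightarrow> strict_deriv J g M z"
  shows "strict_deriv J (\<lambda>x. if c then f x else g x) (\<lambda>h. if c then L h else M h) z"
  using assms by (cases c) auto

text \<open>At a coordinate of largest absolute value \<open>M\<close>, the equation gives
  \<open>M \<le> card V / (card V + 1) * M\<close>.\<close>

lemma near_identity_kernel:
  fixes Q :: "'v \<Rightarrow> 'v \<Rightarrow> real"
  assumes fV: "finite V" and Q: "\<And>i j. i \<in> V \<Longrightarrow> j \<in> V \<Longrightarrow> \<bar>Q i j - kron i j\<bar> \<le> 1 / (card V + 1)"
    and x: "\<And>i. i \<in> V \<Longrightarrow> (\<Sum>j\<in>V. Q i j * x j) = 0"
  shows "\<forall>i\<in>V. x i = 0"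
proof (cases "V = {}")
  case False
  define M where "M = Max ((\<lambda>i. \<bar>x i\<bar>) ` V)"
  have M: "\<bar>x i\<bar> \<le> M" if "i \<in> V" for i using fV that by (simp add: M_def)
  have "M \<in> (\<lambda>i. \<bar>x i\<bar>) ` V" unfolding M_def by (rule Max_in) (use fV False in auto)
  then obtain i where i: "i \<in> V" "M = \<bar>x i\<bar>" by auto
  have M0: "M \<ge> 0" using i by simp
  have "(\<Sum>j\<in>V. Q i j * x j) = (\<Sum>j\<in>V. (Q i j - kron i j) * x j) + x i"
    using fV i(1) by (simp add: left_diff_distrib sum_subtractf sum_kron)
  then have "x i = - (\<Sum>j\<in>V. (Q i j - kron i j) * x j)" using x[OF i(1)] by simp
  then have "M = \<bar>\<Sum>j\<in>V. (Q i j - kron i j) * x j\<bar>" using i(2) by simp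
  also have "\<dots> \<le> (\<Sum>j\<in>V. \<bar>(Q i j - kron i j) * x j\<bar>)" by (rule sum_abs)
  also have "\<dots> \<le> (\<Sum>j\<in>V. 1 / (card V + 1) * M)"
    unfolding abs_mult by (intro sum_mono mult_mono Q i(1) M) (use M0 in auto)
  also have "\<dots> = card V / (card V + 1) * M" by simp
  finally have "(card V + 1) * M \<le> card V * M" by (simp add: divide_simps) (simp add: algebra_simps)
  then have "M \<le> 0" by (simp add: algebra_simps)
  with M show ?thesis by fastforce
qed simp

text \<open>
  Put \<open>w\<^sub>i = s\<^sub>i C\<^sub>i\<^sub>u\<close>, and let \<open>M\<close> have the blocks \<open>C\<close>, \<open>w\<close>, \<open>w\<^sup>T\<close>, \<open>1/\<epsilon>\<close> and \<open>V\<close> the blocks \<open>Q\<close>, \<open>\<epsilon> q\<^sup>T\<close>.  The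
  last two conclusions say \<open>M V = V A\<close>.  The system that is solved consists of \<open>V\<^sup>T V = I\<close>, of the
  last row of \<open>M V = V A\<close>, and of
  \<open>Q\<^sup>T C Q = A + \<epsilon> q q\<^sup>T - \<epsilon>\<^sup>2 (A q q\<^sup>T + q q\<^sup>T A)\<close>; these imply the upper block of \<open>M V = V A\<close> and, unlike
  it, are polynomial with a solution \<open>Q = I\<close>, \<open>C = A\<close>, \<open>q = -w\<close> at \<open>\<epsilon> = 0\<close>, where the SSP is precisely the
  surjectivity of the derivative.  The unknowns are tagged: 0 for \<open>Q\<close>, 1 for the change of \<open>C\<close> on
  the pattern of \<open>A\<close>, 4 for \<open>q\<close>, 5 for \<open>\<epsilon>\<close>.  Tags 2 and 3 are dummies whose skew-symmetric part makes
  up for the symmetry of the two matrix equations.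
\<close>

lemma perturbation:
  fixes A B :: "nat \<Rightarrow> nat \<Rightarrow> real" and s :: "nat \<Rightarrow> real"
  assumes fV: "finite V" and uV: "u \<in> V" and symA: "sym_on V A" and sspA: "ssp_on V A"
    and symB: "sym_on V B" and r: "r > 0"
  obtains \<epsilon> C Q q where "0 < \<epsilon>" "\<epsilon> \<le> r" "sym_on V C"
    "\<And>i j. i \<in> V \<Longrightarrow> j \<in> V \<Longrightarrow> i \<noteq> j \<Longrightarrow> A i j = 0 \<Longrightarrow> C i j = \<epsilon> * B i j"
    "\<And>i j. i \<in> V \<Longrightarrow> j \<in> V \<Longrightarrow> \<bar>C i j - A i j\<bar> \<le> r"
    "\<And>x. (\<And>i. i \<in> V \<Longrightarrow> (\<Sum>j\<in>V. Q i j * x j) = 0) \<Longrightarrow> \<forall>i\<in>V. x i = 0"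
    "\<And>i j. i \<in> V \<Longrightarrow> j \<in> V \<Longrightarrow>
       (\<Sum>l\<in>V. C i l * Q l j) + \<epsilon> * (s i * C i u) * q j = (\<Sum>l\<in>V. Q i l * A l j)"
    "\<And>j. j \<in> V \<Longrightarrow> (\<Sum>i\<in>V. (s i * C i u) * Q i j) + q j = \<epsilon> * (\<Sum>i\<in>V. q i * A i j)"
proof -
  define t :: "nat \<times> nat \<times> nat" where "t = (5, 0, 0)"
  define I :: "(nat \<times> nat \<times> nat) set" where "I = {0,1,2,3} \<times> V \<times> V \<union> {4} \<times> V \<times> {0}"
  define E :: "(nat \<times> nat \<times> nat) set" where "E = {0} \<times> V \<times> V \<union> ({1} \<times> V \<times> V \<union> {2} \<times> V \<times> {0})"
  \<comment> \<open>On the diagonal and the pattern of \<open>A\<close>, the symmetrized change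
    keeps \<open>C\<close> symmetric without further equations; all other entries are prescribed as
    the parameter times \<open>B\<close>.\<close>
  define C where "C x i j = A i j + (if i = j \<or> A i j \<noteq> 0 then x (1, i, j) + x (1, j, i) else x t * B i j)"
    for x :: "nat \<times> nat \<times> nat \<Rightarrow> real" and i j :: nat
  define f0 where "f0 i j x = (\<Sum>l\<in>V. x (0, l, i) * x (0, l, j)) + x t * x t * (x (4, i, 0) * x (4, j, 0))
      - kron i j + (x (2, i, j) - x (2, j, i))" for x :: "nat \<times> nat \<times> nat \<Rightarrow> real" and i j :: nat
  define f1 where "f1 i j x = (\<Sum>k\<in>V. x (0, k, i) * (\<Sum>l\<in>V. C x k l * x (0, l, j))) - x t * (x (4, i, 0) * x (4, j, 0))
      + x t * x t * ((\<Sum>l\<in>V. A i l * x (4, l, 0)) * x (4, j, 0) + x (4, i, 0) * (\<Sum>l\<in>V. x (4, l, 0) * A l j))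
      - A i j + (x (3, i, j) - x (3, j, i))" for x :: "nat \<times> nat \<times> nat \<Rightarrow> real" and i j :: nat
  define f2 where "f2 j x = x (4, j, 0) + (\<Sum>i\<in>V. (s i * C x i u) * x (0, i, j)) - x t * (\<Sum>i\<in>V. x (4, i, 0) * A i j)"
    for x :: "nat \<times> nat \<times> nat \<Rightarrow> real" and j :: nat
  define f where "f e = (case e of (k, i, j) \<Rightarrow> if k = 0 then f0 i j else if k = 1 then f1 i j else f2 i)"
    for e :: "nat \<times> nat \<times> nat"
  define z where "z e = (case e of (k, i, j) \<Rightarrow> if k = 0 then kron i j else if k = 4 then - (s i * A i u) else 0)"
    for e :: "nat \<times> nat \<times> nat"
  have z_simps: "z t = 0" "z (0, i, j) = kron i j" "z (1, i, j) = 0" "z (2, i, j) = 0" "z (3, i, j) = 0"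
    "z (4, i, j) = - (s i * A i u)" "C z i j = A i j" for i j
    by (simp_all add: z_def C_def t_def)
  have fI: "finite I" and fJ: "finite (insert t I)" and fE: "finite E" and tI: "t \<notin> I"
    using fV by (auto simp: I_def E_def t_def)
  note sds = strict_deriv_const strict_deriv_coord strict_deriv_if strict_deriv_add strict_deriv_diff strict_deriv_mult strict_deriv_sum
  have inJ: "t \<in> insert t I" "i \<in> V \<Longrightarrow> j \<in> V \<Longrightarrow> (0, i, j) \<in> insert t I" "i \<in> V \<Longrightarrow> j \<in> V \<Longrightarrow> (1, i, j) \<in> insert t I"
    "i \<in> V \<Longrightarrow> j \<in> V \<Longrightarrow> (2, i, j) \<in> insert t I" "i \<in> V \<Longrightarrow> j \<in> V \<Longrightarrow> (3, i, j) \<in> insert t I"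
    "i \<in> V \<Longrightarrow> (4, i, 0) \<in> insert t I" for i j by (auto simp: I_def)
  define CL where "CL h i j = (if i = j \<or> A i j \<noteq> 0 then h (1, i, j) + h (1, j, i) else 0)"
    for h :: "nat \<times> nat \<times> nat \<Rightarrow> real" and i j :: nat
  have L0: "\<exists>L. strict_deriv (insert t I) (f0 i j) L z \<and> (\<forall>h. h t = 0 \<longrightarrow>
      L h = h (0, i, j) + h (0, j, i) + (h (2, i, j) - h (2, j, i)))" if ij: "i \<in> V" "j \<in> V" for i j
    unfolding f0_def
    \<comment> \<open>The derivative stays schematic and is assembled by the calculus rules. Only
      its values for \<open>h t = 0\<close> are recorded, because surjectivity is tested in these
      directions.\<close>
    apply (rule exI, rule conjI)
     apply ((rule sds fJ fV inJ ij | assumption)+)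
    using ij fV by (simp add: z_simps sum.distrib sum_kron)
  have LC: "\<exists>L. strict_deriv (insert t I) (\<lambda>x. C x i j) L z \<and> (\<forall>h. h t = 0 \<longrightarrow> L h = CL h i j)" if ij: "i \<in> V" "j \<in> V" for i j
    unfolding C_def CL_def
    apply (rule exI, rule conjI)
     apply ((rule sds fJ fV inJ ij | assumption)+)
    using ij fV by (simp add: z_simps)
  then obtain LC where LC: "\<And>i j. i \<in> V \<Longrightarrow> j \<in> V \<Longrightarrow> strict_deriv (insert t I) (\<lambda>x. C x i j) (LC i j) z"
    "\<And>i j h. i \<in> V \<Longrightarrow> j \<in> V \<Longrightarrow> h t = 0 \<Longrightarrow> LC i j h = CL h i j"
    by metis
  have L1: "\<exists>L. strict_deriv (insert t I) (f1 i j) L z \<and> (\<forall>h. h t = 0 \<longrightarrow>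
      L h = (\<Sum>k\<in>V. h (0, k, i) * A k j) + (\<Sum>k\<in>V. A i k * h (0, k, j)) + CL h i j + (h (3, i, j) - h (3, j, i)))" if ij: "i \<in> V" "j \<in> V" for i j
    unfolding f1_def
    apply (rule exI, rule conjI)
     apply ((rule sds LC(1) fJ fV inJ ij | assumption)+)
    using ij fV by (simp add: z_simps sum.distrib sum_kron LC(2) distrib_left)
  have L2: "\<exists>L. strict_deriv (insert t I) (f2 j) L z \<and> (\<forall>h. h t = 0 \<longrightarrow>
      L h = h (4, j, 0) + (\<Sum>i\<in>V. s i * A i u * h (0, i, j)) + s j * CL h j u)" if j: "j \<in> V" for j
    unfolding f2_def
    apply (rule exI, rule conjI)
     apply ((rule sds LC(1) fJ fV inJ j uV | assumption)+)
    using j fV uV by (simp add: z_simps sum.distrib sum_kron LC(2))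
  define LL where "LL e h = (case e of (k, i, j) \<Rightarrow>
      if k = 0 then h (0, i, j) + h (0, j, i) + (h (2, i, j) - h (2, j, i))
      else if k = 1 then (\<Sum>k\<in>V. h (0, k, i) * A k j) + (\<Sum>k\<in>V. A i k * h (0, k, j)) + CL h i j + (h (3, i, j) - h (3, j, i))
      else h (4, i, 0) + (\<Sum>l\<in>V. s l * A l u * h (0, l, i)) + s i * CL h i u)"
    for e :: "nat \<times> nat \<times> nat" and h :: "nat \<times> nat \<times> nat \<Rightarrow> real"
  have "\<forall>e\<in>E. \<exists>L. strict_deriv (insert t I) (f e) L z \<and> (\<forall>h. h t = 0 \<longrightarrow> L h = LL e h)"
    using L0 L1 L2 by (auto simp: E_def f_def LL_def)
  then obtain L where L: "\<And>e. e \<in> E \<Longrightarrow> strict_deriv (insert t I) (f e) (L e) z"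
    "\<And>e h. e \<in> E \<Longrightarrow> h t = 0 \<Longrightarrow> L e h = LL e h" by metis
  have sumE: "(\<Sum>e\<in>E. g e) = (\<Sum>i\<in>V. \<Sum>j\<in>V. g (0, i, j)) + ((\<Sum>i\<in>V. \<Sum>j\<in>V. g (1, i, j)) + (\<Sum>i\<in>V. g (2, i, 0)))"
    for g :: "nat \<times> nat \<times> nat \<Rightarrow> real"
  proof -
    have "(\<Sum>e\<in>E. g e) = (\<Sum>e\<in>{0} \<times> V \<times> V. g e) + ((\<Sum>e\<in>{1} \<times> V \<times> V. g e) + (\<Sum>e\<in>{2} \<times> V \<times> {0}. g e))"
      unfolding E_def using fV by (subst sum.union_disjoint; (subst sum.union_disjoint)?) auto
    then show ?thesis by (simp add: sum.cartesian_product')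
  qed
  \<comment> \<open>A combination \<open>(U, Y, y)\<close> of the equations that kills the
    derivative is tested on unit directions. Tag 4 gives \<open>y = 0\<close>, tags 2 and 3 make
    \<open>U\<close> and \<open>Y\<close> symmetric, tag 1 makes \<open>Y\<close> vanish on the
    diagonal and the pattern, and tag 0 gives \<open>A Y = - U\<close>. So \<open>A Y\<close> is
    symmetric, that is, \<open>Y\<close> commutes with \<open>A\<close>; the SSP yields
    \<open>Y = 0\<close>, and then \<open>U = 0\<close>.\<close>
  have inj: "\<forall>e\<in>E. w e = 0" if w: "\<And>h. h t = 0 \<Longrightarrow> (\<Sum>e\<in>E. w e * L e h) = 0" for w
  proof -
    define U where "U i j = w (0, i, j)" for i j
    define Y where "Y i j = w (1, i, j)" for i j
    define y where "y i = w (2, i, 0)" for i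
    have main: "(\<Sum>i\<in>V. \<Sum>j\<in>V. U i j * LL (0, i, j) h) + ((\<Sum>i\<in>V. \<Sum>j\<in>V. Y i j * LL (1, i, j) h) + (\<Sum>i\<in>V. y i * LL (2, i, 0) h)) = 0"
      if "h t = 0" for h
    proof -
      have "(\<Sum>e\<in>E. w e * LL e h) = 0" using w[of h] L(2)[of _ h] that by simp
      then show ?thesis unfolding sumE by (simp add: U_def Y_def y_def)
    qed
    have y0: "y k = 0" if "k \<in> V" for k
      using main[of "\<lambda>(a, b, c). if a = 4 then kron b k else 0"] that fV
      by (simp add: t_def LL_def CL_def sum_kron cong: if_cong)
    have Us: "U k l = U l k" if "k \<in> V" "l \<in> V" for k l
      using main[of "\<lambda>(a, b, c). if a = 2 then kron b k * kron c l else 0"] that fV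
      by (simp add: t_def LL_def CL_def sum_kron2 right_diff_distrib sum_subtractf cong: if_cong)
    have Ys: "Y k l = Y l k" if "k \<in> V" "l \<in> V" for k l
      using main[of "\<lambda>(a, b, c). if a = 3 then kron b k * kron c l else 0"] that fV
      by (simp add: t_def LL_def CL_def sum_kron2 right_diff_distrib sum_subtractf cong: if_cong)
    have Yp: "Y k l = 0" if kl: "k \<in> V" "l \<in> V" "k = l \<or> A k l \<noteq> 0" for k l
    proof -
      let ?h = "\<lambda>(a::nat, b, c). if a = 1 then kron b k * kron c l else 0"
      have "Y i j * CL ?h i j = Y i j * (kron i k * kron j l) + Y i j * (kron j k * kron i l)" if "i \<in> V" "j \<in> V" for i j
        using kl symA that by (auto simp: CL_def kron_def sym_on_def)
      then have "(\<Sum>i\<in>V. \<Sum>j\<in>V. Y i j * CL ?h i j) = Y k l + Y l k"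
        using kl fV by (simp add: sum.distrib sum_kron2)
      then show ?thesis using main[of ?h] Ys[OF kl(1,2)] y0
        by (simp add: t_def LL_def)
    qed
    have UY: "2 * U k l + (\<Sum>j\<in>V. Y l j * A k j) + (\<Sum>i\<in>V. Y i l * A i k) = 0" if kl: "k \<in> V" "l \<in> V" for k l
    proof -
      let ?h = "\<lambda>(a::nat, b, c). if a = 0 then kron b k * kron c l else 0"
      have 1: "(\<Sum>i\<in>V. \<Sum>j\<in>V. U i j * LL (0, i, j) ?h) = U k l + U l k"
        using fV kl by (simp add: LL_def distrib_left sum.distrib sum_kron2)
      have "(\<Sum>m\<in>V. kron m k * kron i l * A m j) = kron i l * A k j" "(\<Sum>m\<in>V. A i m * (kron m k * kron j l)) = A i k * kron j l"
        if "i \<in> V" "j \<in> V" for i j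
        using sum_kron(1)[OF fV kl(1), of "\<lambda>m. kron i l * A m j"] sum_kron(1)[OF fV kl(1), of "\<lambda>m. A i m * kron j l"]
        by (simp_all add: mult_ac)
      then have "(\<Sum>i\<in>V. \<Sum>j\<in>V. Y i j * LL (1, i, j) ?h) = (\<Sum>i\<in>V. \<Sum>j\<in>V. Y i j * (kron i l * A k j) + Y i j * (A i k * kron j l))"
        by (simp add: LL_def CL_def distrib_left cong: if_cong)
      also have "\<dots> = (\<Sum>i\<in>V. kron i l * (\<Sum>j\<in>V. Y i j * A k j)) + (\<Sum>i\<in>V. \<Sum>j\<in>V. (Y i j * A i k) * kron j l)"
        by (simp add: sum.distrib sum_distrib_left mult_ac)
      also have "\<dots> = (\<Sum>j\<in>V. Y l j * A k j) + (\<Sum>i\<in>V. Y i l * A i k)"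
        using fV kl by (simp add: sum_kron)
      finally show ?thesis using main[of ?h] 1 y0 Us[OF kl] by (simp add: t_def)
    qed
    have AY: "(\<Sum>j\<in>V. A k j * Y j l) = - U k l" if kl: "k \<in> V" "l \<in> V" for k l
    proof -
      have "(\<Sum>j\<in>V. Y l j * A k j) = (\<Sum>j\<in>V. A k j * Y j l)" "(\<Sum>i\<in>V. Y i l * A i k) = (\<Sum>j\<in>V. A k j * Y j l)"
        using kl Ys symA by (auto intro!: sum.cong simp: sym_on_def mult.commute)
      then show ?thesis using UY[OF kl] by linarith
    qed
    have comm: "comm_on V A Y"
      unfolding comm_on_def
    proof (intro ballI)
      fix i j assume ij: "i \<in> V" "j \<in> V"
      have "(\<Sum>k\<in>V. Y i k * A k j) = (\<Sum>k\<in>V. A j k * Y k i)"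
        using ij Ys symA by (auto intro!: sum.cong simp: sym_on_def mult.commute)
      then show "(\<Sum>k\<in>V. A i k * Y k j) = (\<Sum>k\<in>V. Y i k * A k j)"
        using AY[OF ij] AY[OF ij(2,1)] Us[OF ij] by simp
    qed
    have Y0: "Y i j = 0" if "i \<in> V" "j \<in> V" for i j
      by (rule ssp_onD[OF sspA _ _ comm that]) (use Ys Yp in \<open>auto simp: sym_on_def\<close>)
    have U0: "U i j = 0" if "i \<in> V" "j \<in> V" for i j
      using AY[OF that] Y0 that by simp
    show ?thesis using Y0 U0 y0 by (auto simp: E_def U_def Y_def y_def)
  qed
  have fz: "f e z = 0" if "e \<in> E" for e
    using that fV by (auto simp: E_def f_def f0_def f1_def f2_def z_simps sum_kron uV)
  \<comment> \<open>Half of \<open>r\<close>, since an entry of \<open>C - A\<close> on the pattern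
    is a sum of two unknowns; the other bound is what \<open>near_identity_kernel\<close> requires
    of \<open>Q\<close>.\<close>
  define r' where "r' = min (r / 2) (1 / (card V + 1))"
  have r': "r' > 0" "2 * r' \<le> r" "r' \<le> 1 / (card V + 1)" using r by (auto simp: r'_def)
  obtain \<delta> where \<delta>: "\<delta> > 0" "\<And>s. \<bar>s\<bar> \<le> \<delta> \<Longrightarrow>
    \<exists>x. x t = s \<and> (\<forall>i\<in>I. \<bar>x i - z i\<bar> \<le> r') \<and> (\<forall>e\<in>E. f e x = 0)"
    using implicit_zero[OF fI fE tI, where f = f and L = L and z = z, OF L(1) z_simps(1) fz inj r'(1)] by blast
  define M where "M = (\<Sum>i\<in>V. \<Sum>j\<in>V. \<bar>B i j\<bar>)"
  have M: "\<bar>B i j\<bar> \<le> M" if "i \<in> V" "j \<in> V" for i j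
  proof -
    have "\<bar>B i j\<bar> \<le> (\<Sum>j\<in>V. \<bar>B i j\<bar>)" by (rule member_le_sum) (use that fV in auto)
    also have "\<dots> \<le> M" unfolding M_def by (rule member_le_sum) (use that fV in \<open>auto simp: sum_nonneg\<close>)
    finally show ?thesis .
  qed
  have M0: "M \<ge> 0" by (simp add: M_def sum_nonneg)
  \<comment> \<open>The bound \<open>r / (M + 1)\<close> keeps the prescribed entries
    \<open>\<epsilon> * B i j\<close> below \<open>r\<close>.\<close>
  define \<epsilon> where "\<epsilon> = min \<delta> (min r (r / (M + 1)))"
  have \<epsilon>: "\<epsilon> > 0" "\<epsilon> \<le> \<delta>" "\<epsilon> \<le> r" "\<epsilon> \<le> r / (M + 1)" using \<delta>(1) r M0 by (auto simp: \<epsilon>_def)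
  have \<epsilon>M: "\<epsilon> * M \<le> r"
  proof -
    have "\<epsilon> * M \<le> \<epsilon> * (M + 1)" using \<epsilon>(1) by simp
    also have "\<dots> \<le> r" using \<epsilon>(4) M0 by (simp add: pos_le_divide_eq)
    finally show ?thesis .
  qed
  obtain x where x: "x t = \<epsilon>" "\<And>i. i \<in> I \<Longrightarrow> \<bar>x i - z i\<bar> \<le> r'" "\<And>e. e \<in> E \<Longrightarrow> f e x = 0"
    using \<delta>(2)[of \<epsilon>] \<epsilon> by auto
  define Q where "Q i j = x (0, i, j)" for i j
  define q where "q i = x (4, i, 0)" for i
  have Qn: "\<bar>Q i j - kron i j\<bar> \<le> 1 / (card V + 1)" if "i \<in> V" "j \<in> V" for i j
    using x(2)[of "(0, i, j)"] that r'(3) by (simp add: I_def z_simps Q_def)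
  have xn: "\<bar>x (1, i, j)\<bar> \<le> r'" if "i \<in> V" "j \<in> V" for i j
    using x(2)[of "(1, i, j)"] that unfolding z_simps by (simp add: I_def)
  have Cs: "C x i j = C x j i" if "i \<in> V" "j \<in> V" for i j
    using symA symB that by (auto simp: C_def sym_on_def)
  have e0: "(\<Sum>l\<in>V. Q l i * Q l j) = kron i j - \<epsilon> * \<epsilon> * (q i * q j)" if ij: "i \<in> V" "j \<in> V" for i j
  proof -
    \<comment> \<open>Adding the equations for \<open>(i, j)\<close> and \<open>(j, i)\<close>
      cancels the dummy unknowns.\<close>
    have "f (0, i, j) x = 0" "f (0, j, i) x = 0" using ij by (auto intro: x(3) simp: E_def)
    then have "f0 i j x + f0 j i x = 0" by (simp add: f_def)
    moreover have "(\<Sum>l\<in>V. Q l j * Q l i) = (\<Sum>l\<in>V. Q l i * Q l j)" by (simp add: mult.commute)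
    moreover have "kron j i = kron i j" by (simp add: kron_def)
    ultimately show ?thesis by (simp add: f0_def x(1) Q_def q_def algebra_simps)
  qed
  have e2: "(\<Sum>i\<in>V. (s i * C x i u) * Q i j) + q j = \<epsilon> * (\<Sum>i\<in>V. q i * A i j)" if j: "j \<in> V" for j
  proof -
    have "f (2, j, 0) x = 0" using j by (auto intro: x(3) simp: E_def)
    then show ?thesis by (simp add: f_def f2_def x(1) Q_def q_def)
  qed
  have e1: "(\<Sum>k\<in>V. Q k i * (\<Sum>l\<in>V. C x k l * Q l j)) =
      A i j + \<epsilon> * (q i * q j) - \<epsilon> * \<epsilon> * ((\<Sum>l\<in>V. A i l * q l) * q j + q i * (\<Sum>l\<in>V. q l * A l j))"
    if ij: "i \<in> V" "j \<in> V" for i j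
  proof -
    define G where "G i j = (\<Sum>k\<in>V. Q k i * (\<Sum>l\<in>V. C x k l * Q l j))" for i j
    have "G i j = (\<Sum>k\<in>V. \<Sum>l\<in>V. Q k i * C x k l * Q l j)"
      by (simp add: G_def sum_distrib_left mult.assoc)
    also have "\<dots> = (\<Sum>l\<in>V. \<Sum>k\<in>V. Q k i * C x k l * Q l j)" by (rule sum.swap)
    also have "\<dots> = (\<Sum>l\<in>V. \<Sum>k\<in>V. Q l j * C x l k * Q k i)"
      using Cs by (intro sum.cong refl) (simp add: mult_ac)
    also have "\<dots> = G j i" by (simp add: G_def sum_distrib_left mult.assoc)
    finally have G: "G j i = G i j" ..
    have Aq: "(\<Sum>l\<in>V. A i l * q l) = (\<Sum>l\<in>V. q l * A l i)" if "i \<in> V" for i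
      using symA that by (intro sum.cong) (auto simp: sym_on_def mult.commute)
    have "f (1, i, j) x = 0" "f (1, j, i) x = 0" using ij by (auto intro: x(3) simp: E_def)
    then have "f1 i j x + f1 j i x = 0" by (simp add: f_def)
    then have "2 * G i j = 2 * (A i j + \<epsilon> * (q i * q j) - \<epsilon> * \<epsilon> * ((\<Sum>l\<in>V. A i l * q l) * q j + q i * (\<Sum>l\<in>V. q l * A l j)))"
      using G sym_onD[OF symA ij] Aq[OF ij(1)] Aq[OF ij(2)]
      unfolding f1_def x(1) Q_def[symmetric] q_def[symmetric] G_def[symmetric] by (simp add: algebra_simps)
    then show ?thesis by (simp add: G_def)
  qed
  have top: "(\<Sum>l\<in>V. C x i l * Q l j) + \<epsilon> * (s i * C x i u) * q j = (\<Sum>l\<in>V. Q i l * A l j)"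
    if ij: "i \<in> V" "j \<in> V" for i j
  proof -
    \<comment> \<open>Column \<open>j\<close> of the defect of the upper block. Multiplied by
      \<open>Q^T\<close> and reduced with \<open>e0\<close>, \<open>e1\<close> and
      \<open>e2\<close>, it becomes 0, and \<open>Q^T\<close> is injective. The terms in
      \<open>\<epsilon>\<close> on the right of \<open>e1\<close> are exactly those that this
      computation cancels.\<close>
    define T where "T i = (\<Sum>l\<in>V. C x i l * Q l j) + \<epsilon> * (s i * C x i u) * q j - (\<Sum>l\<in>V. Q i l * A l j)" for i
    have "\<forall>i\<in>V. T i = 0"
    proof (rule near_identity_kernel[OF fV, of "\<lambda>i k. Q k i"])
      show "\<bar>Q j i - kron i j\<bar> \<le> 1 / (card V + 1)" if "i \<in> V" "j \<in> V" for i j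
        using Qn[OF that(2,1)] by (simp add: kron_def eq_commute)
      fix i assume i: "i \<in> V"
      have "(\<Sum>k\<in>V. Q k i * (\<Sum>l\<in>V. Q k l * A l j)) = (\<Sum>k\<in>V. \<Sum>l\<in>V. Q k i * Q k l * A l j)"
        by (simp add: sum_distrib_left mult.assoc)
      also have "\<dots> = (\<Sum>l\<in>V. \<Sum>k\<in>V. Q k i * Q k l * A l j)" by (rule sum.swap)
      also have "\<dots> = (\<Sum>l\<in>V. (kron i l - \<epsilon> * \<epsilon> * (q i * q l)) * A l j)"
        by (intro sum.cong refl) (simp add: sum_distrib_right[symmetric] e0 i)
      also have "\<dots> = A i j - \<epsilon> * \<epsilon> * (q i * (\<Sum>l\<in>V. q l * A l j))"
        using fV i by (simp add: left_diff_distrib right_diff_distrib sum_subtractf sum_kron sum_distrib_left mult_ac)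
      finally have 3: "(\<Sum>k\<in>V. Q k i * (\<Sum>l\<in>V. Q k l * A l j)) = A i j - \<epsilon> * \<epsilon> * (q i * (\<Sum>l\<in>V. q l * A l j))" .
      have "(\<Sum>k\<in>V. Q k i * (\<epsilon> * (s k * C x k u) * q j)) = \<epsilon> * q j * (\<Sum>k\<in>V. (s k * C x k u) * Q k i)"
        by (simp add: sum_distrib_left mult_ac)
      also have "(\<Sum>k\<in>V. (s k * C x k u) * Q k i) = \<epsilon> * (\<Sum>l\<in>V. A i l * q l) - q i"
      proof -
        have "(\<Sum>l\<in>V. A i l * q l) = (\<Sum>l\<in>V. q l * A l i)"
          using symA i by (intro sum.cong) (auto simp: sym_on_def mult.commute)
        then show ?thesis using e2[OF i] by simp
      qed
      finally have 2: "(\<Sum>k\<in>V. Q k i * (\<epsilon> * (s k * C x k u) * q j)) = \<epsilon> * q j * (\<epsilon> * (\<Sum>l\<in>V. A i l * q l) - q i)" .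
      have "(\<Sum>k\<in>V. Q k i * T k) = (\<Sum>k\<in>V. Q k i * (\<Sum>l\<in>V. C x k l * Q l j))
          + (\<Sum>k\<in>V. Q k i * (\<epsilon> * (s k * C x k u) * q j)) - (\<Sum>k\<in>V. Q k i * (\<Sum>l\<in>V. Q k l * A l j))"
        by (simp only: T_def distrib_left right_diff_distrib sum.distrib sum_subtractf)
      also have "\<dots> = 0" unfolding 2 3 e1[OF i ij(2)] by (simp add: algebra_simps)
      finally show "(\<Sum>k\<in>V. Q k i * T k) = 0" .
    qed
    then show ?thesis using ij by (simp add: T_def)
  qed
  show ?thesis
  proof (rule that[of \<epsilon> "C x" Q q])
    show "sym_on V (C x)" using Cs by (simp add: sym_on_def)
    show "\<bar>C x i j - A i j\<bar> \<le> r" if "i \<in> V" "j \<in> V" for i j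
    proof (cases "i = j \<or> A i j \<noteq> 0")
      case True
      then show ?thesis using xn[OF that] xn[OF that(2,1)] r'(2) by (simp add: C_def)
    next
      case False
      then have "\<bar>C x i j - A i j\<bar> = \<epsilon> * \<bar>B i j\<bar>" using \<epsilon>(1) by (simp add: C_def x(1) abs_mult)
      also have "\<dots> \<le> \<epsilon> * M" using M[OF that] \<epsilon>(1) by simp
      finally show ?thesis using \<epsilon>M by linarith
    qed
    show "\<forall>i\<in>V. y i = 0" if "\<And>i. i \<in> V \<Longrightarrow> (\<Sum>j\<in>V. Q i j * y j) = 0" for y
      by (rule near_identity_kernel[OF fV Qn that])
  qed (use \<epsilon> top e2 in \<open>auto simp: C_def x(1)\<close>)
qed

section \<open>Edge additions and vertex splittings\<close>

definition eigvec :: "'v set \<Rightarrow> ('v \<Rightarrow> 'v \<Rightarrow> real) \<Rightarrow> real \<Rightarrow> ('v \<Rightarrow> real) \<Rightarrow> bool" where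
  "eigvec V A l x \<longleftrightarrow> (\<forall>i\<in>V. (\<Sum>k\<in>V. A i k * x k) = l * x i)"

text \<open>Geometric multiplicity at least two. For symmetric matrices it is identified later with
  the order of the root of the characteristic polynomial.\<close>

definition mult2 :: "'v set \<Rightarrow> ('v \<Rightarrow> 'v \<Rightarrow> real) \<Rightarrow> real \<Rightarrow> bool" where
  "mult2 V A l \<longleftrightarrow> (\<exists>x y. eigvec V A l x \<and> eigvec V A l y \<and>
     (\<forall>a b. (\<forall>i\<in>V. a * x i + b * y i = 0) \<longrightarrow> a = 0 \<and> b = 0))"

definition realizes :: "'v set \<Rightarrow> 'v rel \<Rightarrow> ('v \<Rightarrow> 'v \<Rightarrow> real) \<Rightarrow> bool" where
  "realizes V R A \<longleftrightarrow> sym_on V A \<and> (\<forall>i\<in>V. \<forall>j\<in>V. i \<noteq> j \<longrightarrow> (A i j \<noteq> 0 \<longleftrightarrow> (i, j) \<in> R))"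

text \<open>The property that passes from a minor to the graph.\<close>

definition ssp_realizable :: "nat set \<Rightarrow> nat rel \<Rightarrow> bool" where
  "ssp_realizable V R \<longleftrightarrow> (\<exists>A. realizes V R A \<and> ssp_on V A \<and> (\<exists>l m. l \<noteq> m \<and> mult2 V A l \<and> mult2 V A m))"

text \<open>From \<open>M T = T A\<close> with \<open>T\<close> injective, \<open>T\<close> maps the
  eigenspace of \<open>A\<close> injectively into that of \<open>M\<close>. The matrices may have
  different sizes, as in a vertex splitting.\<close>

lemma mult2_transfer:
  assumes fU: "finite U" and fW: "finite W"
    and inj: "\<And>x. (\<And>i. i \<in> W \<Longrightarrow> (\<Sum>j\<in>U. T i j * x j) = 0) \<Longrightarrow> \<forall>j\<in>U. x j = 0"
    and int: "\<And>i j. i \<in> W \<Longrightarrow> j \<in> U \<Longrightarrow> (\<Sum>k\<in>W. M i k * T k j) = (\<Sum>k\<in>U. T i k * A k j)"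
    and m: "mult2 U A l"
  shows "mult2 W M l"
proof -
  define S where "S x i = (\<Sum>j\<in>U. T i j * x j)" for x i
  have ev: "eigvec W M l (S x)" if x: "eigvec U A l x" for x
    unfolding eigvec_def
  proof
    fix i assume i: "i \<in> W"
    have "(\<Sum>k\<in>W. M i k * S x k) = (\<Sum>k\<in>W. \<Sum>j\<in>U. M i k * T k j * x j)"
      by (simp add: S_def sum_distrib_left mult.assoc)
    also have "\<dots> = (\<Sum>j\<in>U. \<Sum>k\<in>W. M i k * T k j * x j)" by (rule sum.swap)
    also have "\<dots> = (\<Sum>j\<in>U. \<Sum>k\<in>U. T i k * A k j * x j)"
      by (intro sum.cong refl) (simp add: sum_distrib_right[symmetric] int i)
    also have "\<dots> = (\<Sum>k\<in>U. \<Sum>j\<in>U. T i k * A k j * x j)" by (rule sum.swap)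
    also have "\<dots> = (\<Sum>k\<in>U. T i k * (\<Sum>j\<in>U. A k j * x j))"
      by (simp add: sum_distrib_left mult.assoc)
    also have "\<dots> = l * S x i" using x by (simp add: eigvec_def S_def sum_distrib_left mult_ac)
    finally show "(\<Sum>k\<in>W. M i k * S x k) = l * S x i" .
  qed
  obtain x y where xy: "eigvec U A l x" "eigvec U A l y"
    "\<And>a b. \<forall>i\<in>U. a * x i + b * y i = 0 \<Longrightarrow> a = 0 \<and> b = 0"
    using m unfolding mult2_def by blast
  show ?thesis unfolding mult2_def
  proof (intro exI conjI allI impI)
    show "eigvec W M l (S x)" "eigvec W M l (S y)" using ev xy by auto
    fix a b assume ab: "\<forall>i\<in>W. a * S x i + b * S y i = 0"
    have "\<forall>j\<in>U. a * x j + b * y j = 0"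
    proof (rule inj)
      fix i assume "i \<in> W"
      with ab have "a * S x i + b * S y i = 0" by blast
      then show "(\<Sum>j\<in>U. T i j * (a * x j + b * y j)) = 0"
        by (simp add: S_def sum_distrib_left sum.distrib distrib_left mult_ac)
    qed
    from xy(3)[OF this] show "a = 0" "b = 0" by auto
  qed
qed

section \<open>Limits of violations of the SSP\<close>

lemma bounded_family_convergent_subseq:
  fixes X :: "nat \<Rightarrow> 'a \<Rightarrow> real"
  assumes "finite S" "\<And>n a. a \<in> S \<Longrightarrow> \<bar>X n a\<bar> \<le> K"
  obtains f x where "strict_mono f" "\<And>a. a \<in> S \<Longrightarrow> (\<lambda>n. X (f n) a) \<longlonglongrightarrow> x a"
proof -
  have "\<exists>f x. strict_mono f \<and> (\<forall>a\<in>S. (\<lambda>n. X (f n) a) \<longlonglongrightarrow> x a)"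
    using assms
  proof (induction S rule: finite_induct)
    case empty then show ?case by (auto intro: exI[of _ id] simp: strict_mono_def)
  next
    case (insert b S)
    then obtain f x where f: "strict_mono f" "\<And>a. a \<in> S \<Longrightarrow> (\<lambda>n. X (f n) a) \<longlonglongrightarrow> x a"
      by (metis insertCI)
    obtain g where g: "strict_mono g" "monoseq (\<lambda>n. X (f (g n)) b)"
      using seq_monosub[of "\<lambda>n. X (f n) b"] by auto
    have "Bseq (\<lambda>n. X (f (g n)) b)"
      by (rule BseqI'[of _ K]) (use insert in auto)
    with g obtain y where y: "(\<lambda>n. X (f (g n)) b) \<longlonglongrightarrow> y"
      using Bseq_monoseq_convergent by (auto simp: convergent_def)
    show ?case
    proof (intro exI conjI ballI)
      show "strict_mono (f \<circ> g)" using f g by (simp add: strict_mono_o)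
      fix a assume a: "a \<in> insert b S"
      show "(\<lambda>n. X ((f \<circ> g) n) a) \<longlonglongrightarrow> (if a = b then y else x a)"
      proof (cases "a = b")
        case False
        then have "((\<lambda>n. X (f n) a) \<circ> g) \<longlonglongrightarrow> x a" using a f g by (intro LIMSEQ_subseq_LIMSEQ) auto
        then show ?thesis using False by (simp add: o_def)
      qed (use y in \<open>simp add: o_def\<close>)
    qed
  qed
  then show ?thesis using that by blast
qed

lemma not_ssp_normalized:
  assumes fV: "finite V" and n: "\<not> ssp_on V A"
  obtains X where "sym_on V X" "\<And>i j. i \<in> V \<Longrightarrow> j \<in> V \<Longrightarrow> i = j \<or> A i j \<noteq> 0 \<Longrightarrow> X i j = 0"
    "comm_on V A X" "(\<Sum>i\<in>V. \<Sum>j\<in>V. \<bar>X i j\<bar>) = 1" "\<And>i j. i \<in> V \<Longrightarrow> j \<in> V \<Longrightarrow> \<bar>X i j\<bar> \<le> 1"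
proof -
  obtain X a b where X: "sym_on V X" "\<And>i j. i \<in> V \<Longrightarrow> j \<in> V \<Longrightarrow> i = j \<or> A i j \<noteq> 0 \<Longrightarrow> X i j = 0"
    "comm_on V A X" and ab: "a \<in> V" "b \<in> V" "X a b \<noteq> 0"
    using n unfolding ssp_on_def by blast
  define N where "N = (\<Sum>i\<in>V. \<Sum>j\<in>V. \<bar>X i j\<bar>)"
  have le: "\<bar>X i j\<bar> \<le> N" if "i \<in> V" "j \<in> V" for i j
  proof -
    have "\<bar>X i j\<bar> \<le> (\<Sum>j\<in>V. \<bar>X i j\<bar>)" by (rule member_le_sum) (use that fV in auto)
    also have "\<dots> \<le> N" unfolding N_def by (rule member_le_sum) (use that fV in \<open>auto simp: sum_nonneg\<close>)
    finally show ?thesis .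
  qed
  have N: "N > 0" using le[OF ab(1,2)] ab(3) by linarith
  show ?thesis
  proof (rule that[of "\<lambda>i j. X i j / N"])
    show "sym_on V (\<lambda>i j. X i j / N)" using X(1) by (simp add: sym_on_def)
    show "comm_on V A (\<lambda>i j. X i j / N)" using X(3)
      by (simp add: comm_on_def sum_divide_distrib[symmetric])
    show "(\<Sum>i\<in>V. \<Sum>j\<in>V. \<bar>X i j / N\<bar>) = 1"
      using N by (simp add: sum_divide_distrib[symmetric] N_def[symmetric])
    show "\<bar>X i j / N\<bar> \<le> 1" if "i \<in> V" "j \<in> V" for i j using le[OF that] N by simp
  qed (use X(2) in auto)
qed

text \<open>Violations of the SSP can be scaled to norm 1, so a convergent subsequence has a nonzero
  limit. No convergence of the matrices \<open>A n\<close> is assumed, which allows the use for the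
  diverging matrices of a vertex splitting.\<close>

lemma not_ssp_cluster:
  fixes A :: "nat \<Rightarrow> 'v \<Rightarrow> 'v \<Rightarrow> real"
  assumes fV: "finite V" and n: "\<And>n. \<not> ssp_on V (A n)"
  obtains f X Y where "strict_mono f" "\<And>n. sym_on V (X n)"
    "\<And>n i j. i \<in> V \<Longrightarrow> j \<in> V \<Longrightarrow> i = j \<or> A (f n) i j \<noteq> 0 \<Longrightarrow> X n i j = 0"
    "\<And>n. comm_on V (A (f n)) (X n)"
    "\<And>i j. i \<in> V \<Longrightarrow> j \<in> V \<Longrightarrow> (\<lambda>n. X n i j) \<longlonglongrightarrow> Y i j"
    "\<not> (\<forall>i\<in>V. \<forall>j\<in>V. Y i j = 0)"
proof -
  have "\<forall>n. \<exists>X. sym_on V X \<and> (\<forall>i\<in>V. \<forall>j\<in>V. i = j \<or> A n i j \<noteq> 0 \<longrightarrow> X i j = 0) \<and>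
    comm_on V (A n) X \<and> (\<Sum>i\<in>V. \<Sum>j\<in>V. \<bar>X i j\<bar>) = 1 \<and> (\<forall>i\<in>V. \<forall>j\<in>V. \<bar>X i j\<bar> \<le> 1)"
    (is "\<forall>n. \<exists>X. ?P n X")
  proof
    fix n show "\<exists>X. ?P n X"
      by (rule not_ssp_normalized[OF fV n[of n]]) blast
  qed
  then obtain X where X: "\<And>n. ?P n (X n)" by metis
  have b: "\<bar>X n (fst p) (snd p)\<bar> \<le> 1" if "p \<in> V \<times> V" for n p using X that by auto
  obtain f Z where f: "strict_mono f" "\<And>p. p \<in> V \<times> V \<Longrightarrow> (\<lambda>n. X (f n) (fst p) (snd p)) \<longlonglongrightarrow> Z p"
    using bounded_family_convergent_subseq[of "V \<times> V" "\<lambda>n p. X n (fst p) (snd p)" 1] fV b by blast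
  have lim: "(\<lambda>n. X (f n) i j) \<longlonglongrightarrow> Z (i, j)" if "i \<in> V" "j \<in> V" for i j
    using f(2)[of "(i, j)"] that by simp
  have "(\<lambda>n. \<Sum>i\<in>V. \<Sum>j\<in>V. \<bar>X (f n) i j\<bar>) \<longlonglongrightarrow> (\<Sum>i\<in>V. \<Sum>j\<in>V. \<bar>Z (i, j)\<bar>)"
    by (intro tendsto_intros lim)
  moreover have "(\<lambda>n. \<Sum>i\<in>V. \<Sum>j\<in>V. \<bar>X (f n) i j\<bar>) = (\<lambda>n. 1)" using X by auto
  ultimately have "(\<Sum>i\<in>V. \<Sum>j\<in>V. \<bar>Z (i, j)\<bar>) = 1" by (simp add: LIMSEQ_const_iff)
  then have nz: "\<not> (\<forall>i\<in>V. \<forall>j\<in>V. Z (i, j) = 0)" by (intro notI) simp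
  show ?thesis
    by (rule that[of f "\<lambda>n. X (f n)" "\<lambda>i j. Z (i, j)"]) (use f X lim nz in \<open>auto simp: o_def\<close>)
qed

lemma limits_eq:
  fixes f g :: "nat \<Rightarrow> real"
  assumes "f \<longlonglongrightarrow> a" "g \<longlonglongrightarrow> b" "\<And>n. f n = g n"
  shows "a = b"
proof -
  have "f = g" using assms(3) by (rule ext)
  with assms(1,2) show ?thesis by (auto intro: LIMSEQ_unique)
qed

text \<open>Variant with the equation first, so that it fixes both sequences before their limits are
  computed.\<close>

lemma limits_eq':
  fixes f g :: "nat \<Rightarrow> real"
  assumes "\<forall>n. f n = g n" "f \<longlonglongrightarrow> a" "g \<longlonglongrightarrow> b"
  shows "a = b"
  using assms by (auto intro: limits_eq)

lemma sym_on_limit: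
  assumes "\<And>n. sym_on V (X n)" "\<And>i j. i \<in> V \<Longrightarrow> j \<in> V \<Longrightarrow> (\<lambda>n. X n i j) \<longlonglongrightarrow> Y i j"
  shows "sym_on V Y"
  unfolding sym_on_def
proof (intro ballI)
  fix i j assume ij: "i \<in> V" "j \<in> V"
  show "Y i j = Y j i"
    by (rule limits_eq[OF assms(2)[OF ij] assms(2)[OF ij(2,1)] sym_onD[OF assms(1) ij]])
qed

text \<open>A limit of violations for \<open>C n\<close> is a violation for \<open>A\<close>: where
  \<open>A\<close> is nonzero, so is \<open>C n\<close>, and the violations vanish there; the
  commutator equation passes to the limit.\<close>

lemma ssp_eventually:
  assumes fV: "finite V" and ssp: "ssp_on V A"
    and lim: "\<And>i j. i \<in> V \<Longrightarrow> j \<in> V \<Longrightarrow> (\<lambda>n. C n i j) \<longlonglongrightarrow> A i j"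
    and nz: "\<And>n i j. i \<in> V \<Longrightarrow> j \<in> V \<Longrightarrow> i \<noteq> j \<Longrightarrow> A i j \<noteq> 0 \<Longrightarrow> C n i j \<noteq> 0"
  shows "\<exists>n. ssp_on V (C n)"
proof (rule ccontr)
  assume "\<not> ?thesis"
  then have n: "\<And>n. \<not> ssp_on V (C n)" by blast
  obtain f X Y where X: "strict_mono f" "\<And>n. sym_on V (X n)"
    "\<And>n i j. i \<in> V \<Longrightarrow> j \<in> V \<Longrightarrow> i = j \<or> C (f n) i j \<noteq> 0 \<Longrightarrow> X n i j = 0"
    "\<And>n. comm_on V (C (f n)) (X n)"
    "\<And>i j. i \<in> V \<Longrightarrow> j \<in> V \<Longrightarrow> (\<lambda>n. X n i j) \<longlonglongrightarrow> Y i j"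
    "\<not> (\<forall>i\<in>V. \<forall>j\<in>V. Y i j = 0)"
    by (rule not_ssp_cluster[OF fV n]) (rule that; assumption)
  have limf: "(\<lambda>n. C (f n) i j) \<longlonglongrightarrow> A i j" if "i \<in> V" "j \<in> V" for i j
    using LIMSEQ_subseq_LIMSEQ[OF lim[OF that] X(1)] by (simp add: o_def)
  have "Y i j = 0" if ij: "i \<in> V" "j \<in> V" for i j
  proof (rule ssp_onD[OF ssp _ _ _ ij])
    show "sym_on V Y" by (rule sym_on_limit[OF X(2) X(5)])
    show "Y i j = 0" if "i \<in> V" "j \<in> V" "i = j \<or> A i j \<noteq> 0" for i j
    proof -
      have "X n i j = 0" for n using X(3)[OF that(1,2)] nz that by metis
      then show ?thesis using X(5)[OF that(1,2)] by (simp add: LIMSEQ_const_iff)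
    qed
    show "comm_on V A Y" unfolding comm_on_def
    proof (intro ballI)
      fix i j assume ij: "i \<in> V" "j \<in> V"
      show "(\<Sum>k\<in>V. A i k * Y k j) = (\<Sum>k\<in>V. Y i k * A k j)"
      proof (rule limits_eq)
        show "(\<lambda>n. \<Sum>k\<in>V. C (f n) i k * X n k j) \<longlonglongrightarrow> (\<Sum>k\<in>V. A i k * Y k j)"
          "(\<lambda>n. \<Sum>k\<in>V. X n i k * C (f n) k j) \<longlonglongrightarrow> (\<Sum>k\<in>V. Y i k * A k j)"
          by (intro tendsto_intros limf X(5) ij; assumption)+
        show "(\<Sum>k\<in>V. C (f n) i k * X n k j) = (\<Sum>k\<in>V. X n i k * C (f n) k j)" for n
          by (rule comm_onD[OF X(4) ij])
      qed
    qed
  qed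
  with X(6) show False by blast
qed

lemma mult2_nonempty: "mult2 V A l \<Longrightarrow> V \<noteq> {}"
  by (auto simp: mult2_def) (metis zero_neq_one)

lemma inverse_Suc_limit:
  fixes a :: "nat \<Rightarrow> real"
  assumes "\<And>n. \<bar>a n - b\<bar> \<le> 1 / Suc n"
  shows "a \<longlonglongrightarrow> b"
proof -
  have "(\<lambda>n. a n - b) \<longlonglongrightarrow> 0"
    by (rule tendsto_rabs_zero_cancel, rule tendsto_sandwich[OF _ _ tendsto_const LIMSEQ_inverse_real_of_nat])
      (use assms in \<open>auto simp: inverse_eq_divide\<close>)
  then show ?thesis by (simp add: LIM_zero_iff)
qed

section \<open>Undoing deletions and contractions\<close>

text \<open>With \<open>s = 0\<close> the border in \<open>perturbation\<close> decouples from the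
  block \<open>C\<close>, and \<open>C Q = Q A\<close> with injective \<open>Q\<close> transfers the
  multiplicities. The entries on new edges equal the positive parameter, non-edges stay 0, and close
  to \<open>A\<close> the old edges stay nonzero and the SSP persists.\<close>

lemma ssp_realizable_add_edges:
  assumes fV: "finite V" and g: "ssp_realizable V R"
    and sub: "\<And>i j. i \<in> V \<Longrightarrow> j \<in> V \<Longrightarrow> (i, j) \<in> R \<Longrightarrow> (i, j) \<in> R'"
    and symR: "\<And>i j. i \<in> V \<Longrightarrow> j \<in> V \<Longrightarrow> (i, j) \<in> R' \<Longrightarrow> (j, i) \<in> R'"
  shows "ssp_realizable V R'"
proof -
  obtain A l m where A: "realizes V R A" "ssp_on V A" and lm: "l \<noteq> m" "mult2 V A l" "mult2 V A m"
    using g by (auto simp: ssp_realizable_def)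
  have symA: "sym_on V A" and patA: "\<And>i j. i \<in> V \<Longrightarrow> j \<in> V \<Longrightarrow> i \<noteq> j \<Longrightarrow> A i j \<noteq> 0 \<longleftrightarrow> (i, j) \<in> R"
    using A(1) by (auto simp: realizes_def)
  obtain u where u: "u \<in> V" using mult2_nonempty[OF lm(2)] by blast
  define B where "B i j = (if (i, j) \<in> R' then 1 else 0 :: real)" for i j
  have symB: "sym_on V B" using symR by (auto simp: sym_on_def B_def)
  define P where "P n e C Q \<longleftrightarrow> 0 < e \<and> sym_on V C \<and>
    (\<forall>i\<in>V. \<forall>j\<in>V. i \<noteq> j \<and> A i j = 0 \<longrightarrow> C i j = e * B i j) \<and>
    (\<forall>i\<in>V. \<forall>j\<in>V. \<bar>C i j - A i j\<bar> \<le> 1 / Suc n) \<and>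
    (\<forall>x. (\<forall>i\<in>V. (\<Sum>j\<in>V. Q i j * x j) = 0) \<longrightarrow> (\<forall>i\<in>V. x i = 0)) \<and>
    (\<forall>i\<in>V. \<forall>j\<in>V. (\<Sum>l\<in>V. C i l * Q l j) = (\<Sum>l\<in>V. Q i l * A l j))"
    for n :: nat and e :: real and C Q :: "nat \<Rightarrow> nat \<Rightarrow> real"
  have "\<exists>e C Q. P n e C Q" for n
  proof -
    have r: "1 / real (Suc n) > 0" by simp
    show "\<exists>e C Q. P n e C Q"
    proof (rule perturbation[OF fV u symA A(2) symB r, where s = "\<lambda>_. 0"])
      fix e C Q q
      assume "0 < e" "sym_on V C"
        "\<And>i j. i \<in> V \<Longrightarrow> j \<in> V \<Longrightarrow> i \<noteq> j \<Longrightarrow> A i j = 0 \<Longrightarrow> C i j = e * B i j"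
        "\<And>i j. i \<in> V \<Longrightarrow> j \<in> V \<Longrightarrow> \<bar>C i j - A i j\<bar> \<le> 1 / real (Suc n)"
        "\<And>x. (\<And>i. i \<in> V \<Longrightarrow> (\<Sum>j\<in>V. Q i j * x j) = 0) \<Longrightarrow> \<forall>i\<in>V. x i = 0"
        "\<And>i j. i \<in> V \<Longrightarrow> j \<in> V \<Longrightarrow>
         (\<Sum>l\<in>V. C i l * Q l j) + e * (0 * C i u) * q j = (\<Sum>l\<in>V. Q i l * A l j)"
      then show ?thesis unfolding P_def by (intro exI[of _ e] exI[of _ C] exI[of _ Q]) auto
    qed
  qed
  then obtain e C Q where "\<And>n. P n (e n) (C n) (Q n)" by metis
  note P = this[unfolded P_def]
  have lim: "(\<lambda>n. C n i j) \<longlonglongrightarrow> A i j" if "i \<in> V" "j \<in> V" for i j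
    by (rule inverse_Suc_limit) (use P that in auto)
  have "\<forall>\<^sub>F n in sequentially. \<forall>i\<in>V. \<forall>j\<in>V. A i j \<noteq> 0 \<longrightarrow> C n i j \<noteq> 0"
  proof (intro eventually_ball_finite fV ballI)
    fix i j assume ij: "i \<in> V" "j \<in> V"
    show "\<forall>\<^sub>F n in sequentially. A i j \<noteq> 0 \<longrightarrow> C n i j \<noteq> 0"
    proof (cases "A i j = 0")
      case False
      then show ?thesis using tendsto_imp_eventually_ne[OF lim[OF ij] False] by simp
    qed simp
  qed
  then obtain N where N: "\<And>n i j. n \<ge> N \<Longrightarrow> i \<in> V \<Longrightarrow> j \<in> V \<Longrightarrow> A i j \<noteq> 0 \<Longrightarrow> C n i j \<noteq> 0"
    by (auto simp: eventually_sequentially)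
  have "\<exists>n. ssp_on V (C (n + N))"
    by (rule ssp_eventually[OF fV A(2)]) (use N LIMSEQ_ignore_initial_segment[OF lim] in auto)
  then obtain n where n: "n \<ge> N" "ssp_on V (C n)" by (meson le_add2)
  have tr: "mult2 V (C n) k" if "mult2 V A k" for k
    by (rule mult2_transfer[OF fV fV _ _ that, of "Q n"]) (use P[of n] in blast)+
  have "realizes V R' (C n)"
    unfolding realizes_def
  proof (intro conjI ballI impI)
    fix i j assume ij: "i \<in> V" "j \<in> V" "i \<noteq> j"
    show "(C n i j \<noteq> 0) = ((i, j) \<in> R')"
    proof (cases "A i j = 0")
      case True
      then have "C n i j = e n * B i j" "e n > 0" using P ij by auto
      then show ?thesis by (auto simp: B_def)
    next
      case False
      then show ?thesis using N[OF n(1) ij(1,2)] patA[OF ij] sub[OF ij(1,2)] by auto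
    qed
  qed (use P in blast)
  then show ?thesis unfolding ssp_realizable_def using n(2) tr lm by blast
qed

lemma eigenvalue_bound:
  assumes fV: "finite V" and ev: "eigvec V A l x" and l: "l > (\<Sum>i\<in>V. \<Sum>j\<in>V. \<bar>A i j\<bar>)"
  shows "\<forall>i\<in>V. x i = 0"
proof (cases "V = {}")
  case False
  define M where "M = Max ((\<lambda>i. \<bar>x i\<bar>) ` V)"
  have M: "\<bar>x i\<bar> \<le> M" if "i \<in> V" for i using fV that by (simp add: M_def)
  have "M \<in> (\<lambda>i. \<bar>x i\<bar>) ` V" unfolding M_def by (rule Max_in) (use fV False in auto)
  then obtain i where i: "i \<in> V" "M = \<bar>x i\<bar>" by auto
  have M0: "M \<ge> 0" using i by simp
  have s0: "(\<Sum>i\<in>V. \<Sum>j\<in>V. \<bar>A i j\<bar>) \<ge> 0" by (simp add: sum_nonneg)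
  have "l * M = \<bar>l * x i\<bar>" using i l s0 by (simp add: abs_mult)
  also have "\<dots> = \<bar>\<Sum>k\<in>V. A i k * x k\<bar>" using ev i by (simp add: eigvec_def)
  also have "\<dots> \<le> (\<Sum>k\<in>V. \<bar>A i k\<bar> * \<bar>x k\<bar>)"
    using sum_abs[of "\<lambda>k. A i k * x k" V] by (simp add: abs_mult)
  also have "\<dots> \<le> (\<Sum>k\<in>V. \<bar>A i k\<bar> * M)" using M by (intro sum_mono mult_left_mono) auto
  also have "\<dots> = (\<Sum>k\<in>V. \<bar>A i k\<bar>) * M" by (simp add: sum_distrib_right)
  also have "\<dots> \<le> (\<Sum>i\<in>V. \<Sum>j\<in>V. \<bar>A i j\<bar>) * M"
    using M0 fV i(1) by (intro mult_right_mono member_le_sum) (auto simp: sum_nonneg)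
  finally have "(l - (\<Sum>i\<in>V. \<Sum>j\<in>V. \<bar>A i j\<bar>)) * M \<le> 0" by (simp add: left_diff_distrib)
  then have "M \<le> 0" using l by (simp add: mult_le_0_iff)
  with M show ?thesis by fastforce
qed simp

lemma ssp_realizable_isolated:
  assumes fV: "finite V" and v: "v \<notin> V" and g: "ssp_realizable V R"
    and iso: "\<And>i. (i, v) \<notin> R" "\<And>i. (v, i) \<notin> R"
  shows "ssp_realizable (insert v V) R"
proof -
  obtain A l m where A: "realizes V R A" "ssp_on V A" and lm: "l \<noteq> m" "mult2 V A l" "mult2 V A m"
    using g by (auto simp: ssp_realizable_def)
  have symA: "sym_on V A" using A(1) by (auto simp: realizes_def)
  \<comment> \<open>Larger than every eigenvalue of \<open>A\<close>. Column \<open>v\<close> of a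
    violation for the enlarged matrix satisfies the eigenvector equation of \<open>A\<close> for
    \<open>c\<close>, so it vanishes, and the rest is a violation for \<open>A\<close>.\<close>
  define c where "c = (\<Sum>i\<in>V. \<Sum>j\<in>V. \<bar>A i j\<bar>) + 1"
  define M where "M i j = (if i = v \<and> j = v then c else if i = v \<or> j = v then 0 else A i j)" for i j
  have Mr: "realizes (insert v V) R M"
    using A(1) v iso unfolding realizes_def sym_on_def M_def by auto
  have sumv: "(\<Sum>k\<in>insert v V. g k) = g v + (\<Sum>k\<in>V. g k)" for g :: "nat \<Rightarrow> real"
    using fV v by simp
  have MV: "M i j = A i j" if "i \<in> V" "j \<in> V" for i j using that v by (auto simp: M_def)
  have Mv: "M i v = 0" "M v i = 0" if "i \<in> V" for i using that v by (auto simp: M_def)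
  have Mvv: "M v v = c" by (simp add: M_def)
  have "ssp_on (insert v V) M"
    unfolding ssp_on_def
  proof (intro allI impI)
    fix X assume sX: "sym_on (insert v V) X"
      and pX: "\<forall>i\<in>insert v V. \<forall>j\<in>insert v V. i = j \<or> M i j \<noteq> 0 \<longrightarrow> X i j = 0"
      and cX: "comm_on (insert v V) M X"
    have "eigvec V A c (\<lambda>i. X i v)"
      unfolding eigvec_def
    proof
      fix i assume i: "i \<in> V"
      have "(\<Sum>k\<in>insert v V. M i k * X k v) = (\<Sum>k\<in>insert v V. X i k * M k v)"
        by (rule comm_onD[OF cX]) (use i in auto)
      then show "(\<Sum>k\<in>V. A i k * X k v) = c * X i v"
        using i by (simp add: sumv MV Mv Mvv)
    qed
    then have xv: "\<forall>i\<in>V. X i v = 0" by (rule eigenvalue_bound[OF fV]) (simp add: c_def)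
    have vv: "X v v = 0" using pX by simp
    have "X i j = 0" if ij: "i \<in> V" "j \<in> V" for i j
    proof (rule ssp_onD[OF A(2) _ _ _ ij])
      show "sym_on V X" using sX by (simp add: sym_on_def)
      show "X i j = 0" if "i \<in> V" "j \<in> V" "i = j \<or> A i j \<noteq> 0" for i j
        using pX that MV[OF that(1,2)] by (metis insertI2)
      show "comm_on V A X" unfolding comm_on_def
      proof (intro ballI)
        fix i j assume ij: "i \<in> V" "j \<in> V"
        have "(\<Sum>k\<in>insert v V. M i k * X k j) = (\<Sum>k\<in>insert v V. X i k * M k j)"
          by (rule comm_onD[OF cX]) (use ij in auto)
        then show "(\<Sum>k\<in>V. A i k * X k j) = (\<Sum>k\<in>V. X i k * A k j)"
          using ij by (simp add: sumv MV Mv)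
      qed
    qed
    then show "\<forall>i\<in>insert v V. \<forall>j\<in>insert v V. X i j = 0"
      using xv vv sX by (auto simp: sym_on_def)
  qed
  moreover have "mult2 (insert v V) M k" if "mult2 V A k" for k
  proof (rule mult2_transfer[OF fV _ _ _ that, of _ "\<lambda>i j. kron i j"])
    show "\<forall>j\<in>V. x j = 0" if "\<And>i. i \<in> insert v V \<Longrightarrow> (\<Sum>j\<in>V. kron i j * x j) = 0" for x
    proof
      fix j assume "j \<in> V"
      then show "x j = 0" using that[of j] fV by (simp add: sum_kron)
    qed
    fix i j assume i: "i \<in> insert v V" and j: "j \<in> V"
    have "kron v j = 0" using j v by (auto simp: kron_def)
    then have "(\<Sum>k\<in>insert v V. M i k * kron k j) = M i j"
      using fV j by (simp add: sumv sum_kron)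
    also have "\<dots> = (\<Sum>k\<in>V. kron i k * A k j)"
    proof (cases "i = v")
      case True
      then have "(\<Sum>k\<in>V. kron i k * A k j) = 0" using v by (intro sum.neutral) (auto simp: kron_def)
      then show ?thesis using True Mv[OF j] by simp
    next
      case False
      then show ?thesis using i j fV MV by (simp add: sum_kron)
    qed
    finally show "(\<Sum>k\<in>insert v V. M i k * kron k j) = (\<Sum>k\<in>V. kron i k * A k j)" .
  qed (use fV in auto)
  ultimately show ?thesis unfolding ssp_realizable_def using Mr lm by blast
qed

lemma ssp_realizable_iso:
  assumes b: "bij_betw \<phi> V V'" and fV: "finite V" and g: "ssp_realizable V' R'"
    and R: "\<And>i j. i \<in> V \<Longrightarrow> j \<in> V \<Longrightarrow> (\<phi> i, \<phi> j) \<in> R' \<longleftrightarrow> (i, j) \<in> R"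
  shows "ssp_realizable V R"
proof -
  obtain A l m where A: "realizes V' R' A" "ssp_on V' A" and lm: "l \<noteq> m" "mult2 V' A l" "mult2 V' A m"
    using g by (auto simp: ssp_realizable_def)
  define M where "M i j = A (\<phi> i) (\<phi> j)" for i j
  have \<phi>V: "\<phi> i \<in> V'" if "i \<in> V" for i using b that by (auto dest: bij_betw_apply)
  have inj: "\<phi> i = \<phi> j \<longleftrightarrow> i = j" if "i \<in> V" "j \<in> V" for i j
    using b that by (auto simp: bij_betw_def inj_on_def)
  have s: "(\<Sum>k\<in>V. g (\<phi> k)) = (\<Sum>k\<in>V'. g k)" for g :: "nat \<Rightarrow> real"
    by (rule sum.reindex_bij_betw[OF b])
  have V': "V' = \<phi> ` V" using b by (auto simp: bij_betw_def)
  define \<psi> where "\<psi> = inv_into V \<phi>"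
  have \<psi>: "\<psi> (\<phi> i) = i" if "i \<in> V" for i using b that by (simp add: \<psi>_def bij_betw_inv_into_left)
  have "realizes V R M"
    using A(1) \<phi>V inj R unfolding realizes_def sym_on_def M_def by auto
  moreover have "ssp_on V M"
    unfolding ssp_on_def
  proof (intro allI impI ballI)
    fix X i j assume X: "sym_on V X" "\<forall>i\<in>V. \<forall>j\<in>V. i = j \<or> M i j \<noteq> 0 \<longrightarrow> X i j = 0" "comm_on V M X"
      and ij: "i \<in> V" "j \<in> V"
    define Y where "Y i j = X (\<psi> i) (\<psi> j)" for i j
    have YX: "Y (\<phi> i) (\<phi> j) = X i j" if "i \<in> V" "j \<in> V" for i j using that by (simp add: Y_def \<psi>)
    have "Y (\<phi> i) (\<phi> j) = 0"
    proof (rule ssp_onD[OF A(2) _ _ _ \<phi>V[OF ij(1)] \<phi>V[OF ij(2)]])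
      show "sym_on V' Y" using X(1) by (auto simp: sym_on_def V' YX)
      show "Y i j = 0" if "i \<in> V'" "j \<in> V'" "i = j \<or> A i j \<noteq> 0" for i j
        using that X(2) by (auto simp: V' YX M_def inj)
      show "comm_on V' A Y"
        unfolding comm_on_def
      proof (intro ballI)
        fix i' j' assume "i' \<in> V'" "j' \<in> V'"
        then obtain i j where ij: "i \<in> V" "j \<in> V" "i' = \<phi> i" "j' = \<phi> j" by (auto simp: V')
        have "(\<Sum>k\<in>V'. A i' k * Y k j') = (\<Sum>k\<in>V. M i k * X k j)"
          unfolding s[symmetric] using ij by (intro sum.cong) (auto simp: M_def YX)
        also have "\<dots> = (\<Sum>k\<in>V. X i k * M k j)" by (rule comm_onD[OF X(3) ij(1,2)])
        also have "\<dots> = (\<Sum>k\<in>V'. Y i' k * A k j')"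
          unfolding s[symmetric] using ij by (intro sum.cong) (auto simp: M_def YX)
        finally show "(\<Sum>k\<in>V'. A i' k * Y k j') = (\<Sum>k\<in>V'. Y i' k * A k j')" .
      qed
    qed
    then show "X i j = 0" using YX ij by simp
  qed
  moreover have "mult2 V M k" if "mult2 V' A k" for k
  proof -
    obtain x y where xy: "eigvec V' A k x" "eigvec V' A k y"
      "\<And>a b. \<forall>i\<in>V'. a * x i + b * y i = 0 \<Longrightarrow> a = 0 \<and> b = 0"
      using \<open>mult2 V' A k\<close> unfolding mult2_def by blast
    have "eigvec V M k (x \<circ> \<phi>)" if "eigvec V' A k x" for x
      using that s[of "\<lambda>j. A i j * x j" for i] by (auto simp: eigvec_def M_def \<phi>V)
    moreover have "\<forall>a b. (\<forall>i\<in>V. a * (x \<circ> \<phi>) i + b * (y \<circ> \<phi>) i = 0) \<longrightarrow> a = 0 \<and> b = 0"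
      by (intro allI impI xy(3)) (simp add: V')
    ultimately show ?thesis unfolding mult2_def using xy(1,2) by blast
  qed
  ultimately show ?thesis unfolding ssp_realizable_def using lm by blast
qed

text \<open>
  The vertex \<open>u\<close> is split into \<open>u\<close> and \<open>v\<close>, where \<open>v\<close> takes over the neighbours in \<open>N\<close>.  With respect to
  \<open>(e\<^sub>u + e\<^sub>v)/\<surd>2\<close> and \<open>(e\<^sub>u - e\<^sub>v)/\<surd>2\<close>, the new matrix is the \<open>M\<close> of the lemma \<open>perturbation\<close>, with signs \<open>s\<^sub>i\<close>
  chosen such that one of the entries at \<open>(i, u)\<close> and \<open>(i, v)\<close> vanishes.
\<close>

lemma ssp_realizable_decontract:
  assumes fV: "finite V" and uV: "u \<in> V" and v: "v \<notin> V" and g: "ssp_realizable V R"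
    and symR: "\<And>i j. (i, j) \<in> R \<Longrightarrow> (j, i) \<in> R"
    and R'V: "\<And>i j. i \<in> V - {u} \<Longrightarrow> j \<in> V - {u} \<Longrightarrow> (i, j) \<in> R' \<longleftrightarrow> (i, j) \<in> R"
    and R'u: "\<And>i. i \<in> V - {u} \<Longrightarrow> (i, u) \<in> R' \<longleftrightarrow> (i, u) \<in> R \<and> i \<notin> N"
    and R'v: "\<And>i. i \<in> V - {u} \<Longrightarrow> (i, v) \<in> R' \<longleftrightarrow> (i, u) \<in> R \<and> i \<in> N"
    and R'uv: "(u, v) \<in> R'" and symR': "\<And>i j. (i, j) \<in> R' \<Longrightarrow> (j, i) \<in> R'"
  shows "ssp_realizable (insert v V) R'"
proof -
  obtain A l m where A: "realizes V R A" "ssp_on V A" and lm: "l \<noteq> m" "mult2 V A l" "mult2 V A m"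
    using g by (auto simp: ssp_realizable_def)
  have symA: "sym_on V A" and patA: "\<And>i j. i \<in> V \<Longrightarrow> j \<in> V \<Longrightarrow> i \<noteq> j \<Longrightarrow> A i j \<noteq> 0 \<longleftrightarrow> (i, j) \<in> R"
    using A(1) by (auto simp: realizes_def)
  have uv: "u \<noteq> v" using uV v by auto
  define W where "W = V - {u}"
  have fW: "finite W" and uW: "u \<notin> W" and vW: "v \<notin> W" and VW: "V = insert u W"
    and VW': "insert v V = insert v (insert u W)" using fV uV v by (auto simp: W_def)
  have sumV: "(\<Sum>k\<in>V. g k) = g u + (\<Sum>k\<in>W. g k)" for g :: "nat \<Rightarrow> real"
    using fW uW by (simp add: VW)
  have sumV': "(\<Sum>k\<in>insert v V. g k) = g v + (g u + (\<Sum>k\<in>W. g k))" for g :: "nat \<Rightarrow> real"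
    using fW uW vW uv by (simp add: VW')
  \<comment> \<open>\<open>s u = 0\<close>, since the block on \<open>u\<close> and \<open>v\<close>
    is treated separately: in the rotated basis it is diagonal with entries \<open>C u u\<close> and
    \<open>1 / e\<close>. The constant \<open>c\<close> is \<open>1 / sqrt 2\<close>.\<close>
  define s :: "nat \<Rightarrow> real" where "s i = (if i = u then 0 else if i \<in> N then -1 else 1)" for i
  define c :: real where "c = sqrt 2 / 2"
  have cc: "c * c = 1 / 2" by (simp add: c_def)
  have c0: "c > 0" by (simp add: c_def)
  define P where "P n e C Q q \<longleftrightarrow> 0 < e \<and> e \<le> 1 / Suc n \<and> sym_on V C \<and>
    (\<forall>i\<in>V. \<forall>j\<in>V. i \<noteq> j \<and> A i j = 0 \<longrightarrow> C i j = 0) \<and>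
    (\<forall>i\<in>V. \<forall>j\<in>V. \<bar>C i j - A i j\<bar> \<le> 1 / Suc n) \<and>
    (\<forall>x. (\<forall>i\<in>V. (\<Sum>j\<in>V. Q i j * x j) = 0) \<longrightarrow> (\<forall>i\<in>V. x i = 0)) \<and>
    (\<forall>i\<in>V. \<forall>j\<in>V. (\<Sum>l\<in>V. C i l * Q l j) + e * (s i * C i u) * q j = (\<Sum>l\<in>V. Q i l * A l j)) \<and>
    (\<forall>j\<in>V. (\<Sum>i\<in>V. (s i * C i u) * Q i j) + q j = e * (\<Sum>i\<in>V. q i * A i j))"
    for n :: nat and e :: real and C Q :: "nat \<Rightarrow> nat \<Rightarrow> real" and q :: "nat \<Rightarrow> real"
  have "\<exists>e C Q q. P n e C Q q" for n
  proof -
    have r: "1 / real (Suc n) > 0" by simp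
    have s0: "sym_on V (\<lambda>_ _. 0)" by (simp add: sym_on_def)
    show "\<exists>e C Q q. P n e C Q q"
    proof (rule perturbation[OF fV uV symA A(2) s0 r, where s = s])
      fix e C Q q
      assume "0 < e" "e \<le> 1 / real (Suc n)" "sym_on V C"
        "\<And>i j. i \<in> V \<Longrightarrow> j \<in> V \<Longrightarrow> i \<noteq> j \<Longrightarrow> A i j = 0 \<Longrightarrow> C i j = e * 0"
        "\<And>i j. i \<in> V \<Longrightarrow> j \<in> V \<Longrightarrow> \<bar>C i j - A i j\<bar> \<le> 1 / real (Suc n)"
        "\<And>x. (\<And>i. i \<in> V \<Longrightarrow> (\<Sum>j\<in>V. Q i j * x j) = 0) \<Longrightarrow> \<forall>i\<in>V. x i = 0"
        "\<And>i j. i \<in> V \<Longrightarrow> j \<in> V \<Longrightarrow>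
         (\<Sum>l\<in>V. C i l * Q l j) + e * (s i * C i u) * q j = (\<Sum>l\<in>V. Q i l * A l j)"
        "\<And>j. j \<in> V \<Longrightarrow> (\<Sum>i\<in>V. (s i * C i u) * Q i j) + q j = e * (\<Sum>i\<in>V. q i * A i j)"
      then show ?thesis unfolding P_def
        by (intro exI[of _ e] exI[of _ C] exI[of _ Q] exI[of _ q]) auto
    qed
  qed
  then obtain e C Q q where "\<And>n. P n (e n) (C n) (Q n) (q n)" by metis
  note P = this[unfolded P_def]
  have e0: "e n > 0" and eS: "e n \<le> 1 / Suc n" and symC: "sym_on V (C n)" for n using P by blast+
  have C0: "C n i j = 0" if "i \<in> V" "j \<in> V" "i \<noteq> j" "A i j = 0" for n i j using P that by blast
  have Qinj: "\<forall>i\<in>V. x i = 0" if "\<And>i. i \<in> V \<Longrightarrow> (\<Sum>j\<in>V. Q n i j * x j) = 0" for n x using P that by blast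
  have top: "(\<Sum>l\<in>V. C n i l * Q n l j) + e n * (s i * C n i u) * q n j = (\<Sum>l\<in>V. Q n i l * A l j)"
    if "i \<in> V" "j \<in> V" for n i j using P that by blast
  have bot: "(\<Sum>i\<in>V. (s i * C n i u) * Q n i j) + q n j = e n * (\<Sum>i\<in>V. q n i * A i j)" if "j \<in> V" for n j
    using P that by blast
  have lim: "(\<lambda>n. C n i j) \<longlonglongrightarrow> A i j" if "i \<in> V" "j \<in> V" for i j
    by (rule inverse_Suc_limit) (use P that in auto)
  have elim: "e \<longlonglongrightarrow> 0"
    by (rule inverse_Suc_limit) (use e0 eS in \<open>auto simp: less_imp_le\<close>)
  define M where "M n i j =
    (if i \<in> {u, v} \<and> j \<in> {u, v} then (C n u u + (if i = j then 1 else -1) / e n) / 2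
     else if j = u then c * (1 + s i) * C n i u else if j = v then c * (1 - s i) * C n i u
     else if i = u then c * (1 + s j) * C n j u else if i = v then c * (1 - s j) * C n j u
     else C n i j)" for n i j
  have M1: "M n i j = C n i j" if "i \<in> W" "j \<in> W" for n i j using that uW vW by (auto simp: M_def)
  have M2: "M n i u = c * (1 + s i) * C n i u" "M n i v = c * (1 - s i) * C n i u"
    "M n u i = c * (1 + s i) * C n i u" "M n v i = c * (1 - s i) * C n i u" if "i \<in> W" for n i
    using that uW vW uv by (auto simp: M_def)
  have M3: "M n u u = (C n u u + 1 / e n) / 2" "M n v v = (C n u u + 1 / e n) / 2"
    "M n u v = (C n u u - 1 / e n) / 2" "M n v u = (C n u u - 1 / e n) / 2" for n
    using uv by (auto simp: M_def)
  have "M n v u = M n u v" for n by (simp add: M3)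
  then have symM: "sym_on (insert v V) (M n)" for n
    unfolding sym_on_def VW' using M1 M2 sym_onD[OF symC] VW by auto
  have s2: "1 + s i = (if i \<in> N then 0 else 2)" "1 - s i = (if i \<in> N then 2 else 0)" if "i \<in> W" for i
    using that uW by (auto simp: s_def)
  have tr: "mult2 (insert v V) (M n) k" if "mult2 V A k" for k n
  proof (rule mult2_transfer[OF fV _ _ _ that])
    \<comment> \<open>The intertwining matrix of \<open>perturbation\<close>, with blocks
      \<open>Q\<close> and \<open>e q^T\<close>, rotated back to the coordinates \<open>u\<close>
      and \<open>v\<close>.\<close>
    let ?T = "\<lambda>i j. if i = u then c * (Q n u j + e n * q n j) else if i = v then c * (Q n u j - e n * q n j) else Q n i j"
    show "finite (insert v V)" using fV by simp
    show "\<forall>j\<in>V. x j = 0" if x: "\<And>i. i \<in> insert v V \<Longrightarrow> (\<Sum>j\<in>V. ?T i j * x j) = 0" for x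
    proof (rule Qinj)
      fix i assume i: "i \<in> V"
      show "(\<Sum>j\<in>V. Q n i j * x j) = 0"
      proof (cases "i = u")
        case True
        have "(\<Sum>j\<in>V. c * (Q n u j + e n * q n j) * x j) + (\<Sum>j\<in>V. c * (Q n u j - e n * q n j) * x j) = 0"
          using x[of u] x[of v] uV uv by simp
        moreover have "(\<Sum>j\<in>V. c * (Q n u j + e n * q n j) * x j) + (\<Sum>j\<in>V. c * (Q n u j - e n * q n j) * x j)
          = 2 * c * (\<Sum>j\<in>V. Q n u j * x j)"
          unfolding sum.distrib[symmetric] sum_distrib_left by (intro sum.cong) (auto simp: algebra_simps)
        ultimately show ?thesis using c0 True by simp
      next
        case False
        have "i \<noteq> v" using i v by auto
        with False show ?thesis using x[of i] i by simp
      qed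
    qed
    fix i j assume i: "i \<in> insert v V" and j: "j \<in> V"
    have TW: "(\<Sum>k\<in>W. g k * ?T k j) = (\<Sum>k\<in>W. g k * Q n k j)" for g :: "nat \<Rightarrow> real"
      using uW vW by (intro sum.cong) auto
    have en: "e n \<noteq> 0" using e0[of n] by simp
    have botj: "q n j + (\<Sum>k\<in>W. s k * C n k u * Q n k j) = e n * (\<Sum>k\<in>V. q n k * A k j)"
      using bot[OF j, of n] by (simp add: sumV s_def[of u])
    have topu: "C n u u * Q n u j + (\<Sum>k\<in>W. C n k u * Q n k j) = (\<Sum>k\<in>V. Q n u k * A k j)"
    proof -
      have "(\<Sum>k\<in>W. C n u k * Q n k j) = (\<Sum>k\<in>W. C n k u * Q n k j)"
        using sym_onD[OF symC uV, of _ n] VW by (intro sum.cong) auto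
      then show ?thesis using top[OF uV j, of n] by (simp add: sumV s_def[of u])
    qed
    show "(\<Sum>k\<in>insert v V. M n i k * ?T k j) = (\<Sum>k\<in>V. ?T i k * A k j)"
    proof -
      consider "i \<in> W" | "i = u" | "i = v" using i VW by auto
      then show ?thesis
      proof cases
        case 1
        then have iV: "i \<in> V" and ne: "i \<noteq> u" "i \<noteq> v" using VW uW vW by auto
        have "(\<Sum>k\<in>insert v V. M n i k * ?T k j)
          = (c * (1 - s i) * C n i u) * (c * (Q n u j - e n * q n j)) + ((c * (1 + s i) * C n i u) * (c * (Q n u j + e n * q n j)) + (\<Sum>k\<in>W. C n i k * Q n k j))"
          unfolding sumV' TW using uv 1 by (simp add: M1 M2)
        also have "\<dots> = (c * c) * (2 * (C n i u * Q n u j) + 2 * (e n * (s i * C n i u) * q n j)) + (\<Sum>k\<in>W. C n i k * Q n k j)"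
          by (simp add: algebra_simps)
        also have "\<dots> = (\<Sum>l\<in>V. C n i l * Q n l j) + e n * (s i * C n i u) * q n j"
          by (simp add: cc sumV)
        also have "\<dots> = (\<Sum>l\<in>V. Q n i l * A l j)" by (rule top[OF iV j])
        finally show ?thesis using ne by simp
      next
        case 2
        have "(\<Sum>k\<in>insert v V. M n u k * ?T k j)
          = (C n u u - 1 / e n) / 2 * (c * (Q n u j - e n * q n j)) + ((C n u u + 1 / e n) / 2 * (c * (Q n u j + e n * q n j)) + (\<Sum>k\<in>W. c * (1 + s k) * C n k u * Q n k j))"
          unfolding sumV' TW using uv by (simp add: M2 M3)
        also have "\<dots> = c * ((C n u u * Q n u j + (\<Sum>k\<in>W. C n k u * Q n k j)) + (q n j + (\<Sum>k\<in>W. s k * C n k u * Q n k j)))"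
          using en by (simp add: field_simps sum_distrib_left sum.distrib)
        also have "\<dots> = c * ((\<Sum>k\<in>V. Q n u k * A k j) + e n * (\<Sum>k\<in>V. q n k * A k j))"
          by (simp only: topu botj)
        also have "\<dots> = (\<Sum>k\<in>V. c * (Q n u k + e n * q n k) * A k j)"
          by (simp add: sum_distrib_left sum.distrib distrib_left distrib_right mult_ac)
        finally show ?thesis using 2 by simp
      next
        case 3
        have "(\<Sum>k\<in>insert v V. M n v k * ?T k j)
          = (C n u u + 1 / e n) / 2 * (c * (Q n u j - e n * q n j)) + ((C n u u - 1 / e n) / 2 * (c * (Q n u j + e n * q n j)) + (\<Sum>k\<in>W. c * (1 - s k) * C n k u * Q n k j))"
          unfolding sumV' TW using uv by (simp add: M2 M3)
        also have "\<dots> = c * ((C n u u * Q n u j + (\<Sum>k\<in>W. C n k u * Q n k j)) - (q n j + (\<Sum>k\<in>W. s k * C n k u * Q n k j)))"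
          using en by (simp add: field_simps sum_distrib_left sum.distrib sum_subtractf)
        also have "\<dots> = c * ((\<Sum>k\<in>V. Q n u k * A k j) - e n * (\<Sum>k\<in>V. q n k * A k j))"
          by (simp only: topu botj)
        also have "\<dots> = (\<Sum>k\<in>V. c * (Q n u k - e n * q n k) * A k j)"
          by (simp add: sum_distrib_left sum_subtractf right_diff_distrib left_diff_distrib mult_ac)
        finally show ?thesis using 3 uv by simp
      qed
    qed
  qed
  have "\<forall>\<^sub>F n in sequentially. \<forall>i\<in>V. \<forall>j\<in>V. A i j \<noteq> 0 \<longrightarrow> C n i j \<noteq> 0"
  proof (intro eventually_ball_finite fV ballI)
    fix i j assume ij: "i \<in> V" "j \<in> V"
    show "\<forall>\<^sub>F n in sequentially. A i j \<noteq> 0 \<longrightarrow> C n i j \<noteq> 0"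
    proof (cases "A i j = 0")
      case False
      then show ?thesis using tendsto_imp_eventually_ne[OF lim[OF ij] False] by simp
    qed simp
  qed
  \<comment> \<open>Keeps the entry \<open>(C u u - 1 / e) / 2\<close> on the new edge
    \<open>uv\<close> nonzero.\<close>
  moreover have "\<forall>\<^sub>F n in sequentially. e n * C n u u < 1"
  proof -
    have "(\<lambda>n. e n * C n u u) \<longlonglongrightarrow> 0 * A u u" by (intro tendsto_intros elim lim uV)
    then show ?thesis by (intro order_tendstoD(2)) auto
  qed
  ultimately have "\<forall>\<^sub>F n in sequentially. (\<forall>i\<in>V. \<forall>j\<in>V. A i j \<noteq> 0 \<longrightarrow> C n i j \<noteq> 0) \<and> e n * C n u u < 1"
    by (rule eventually_conj)
  then obtain n0 where n0: "\<And>n i j. n \<ge> n0 \<Longrightarrow> i \<in> V \<Longrightarrow> j \<in> V \<Longrightarrow> A i j \<noteq> 0 \<Longrightarrow> C n i j \<noteq> 0"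
    "\<And>n. n \<ge> n0 \<Longrightarrow> e n * C n u u < 1"
    by (auto simp: eventually_sequentially)
  have patC: "C n i j \<noteq> 0 \<longleftrightarrow> (i, j) \<in> R" if "n \<ge> n0" "i \<in> V" "j \<in> V" "i \<noteq> j" for n i j
    using n0(1)[OF that(1-3)] C0[OF that(2-4)] patA[OF that(2-4)] by blast
  have real: "realizes (insert v V) R' (M n)" if n: "n \<ge> n0" for n
    unfolding realizes_def
  proof (intro conjI ballI impI)
    have key: "(M n i j \<noteq> 0) = ((i, j) \<in> R')" if "i \<in> insert u W" "j \<in> insert v (insert u W)" "i \<noteq> j" for i j
    proof -
      have uv1: "(M n u v \<noteq> 0) = ((u, v) \<in> R')"
        using n0(2)[OF n] e0[of n] R'uv by (auto simp: M3 field_simps)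
      have w1: "(M n i j \<noteq> 0) = ((i, j) \<in> R')" if "i \<in> W" "j \<in> W" "i \<noteq> j" for i j
        using patC[OF n, of i j] that R'V[of i j] by (simp add: M1 W_def)
      have w2: "(M n i u \<noteq> 0) = ((i, u) \<in> R')" "(M n i v \<noteq> 0) = ((i, v) \<in> R')" if "i \<in> W" for i
        using patC[OF n, of i u] that R'u[of i] R'v[of i] uV c0 by (auto simp: M2 s2 W_def)
      have w3: "(M n u i \<noteq> 0) = ((u, i) \<in> R')" if "i \<in> W" for i
        using w2(1)[OF that] symR' M2(1,3)[OF that, of n] by metis
      consider "i = u" "j = v" | "i = u" "j \<in> W" | "i \<in> W" "j = u" | "i \<in> W" "j = v" | "i \<in> W" "j \<in> W"
        using \<open>i \<in> insert u W\<close> \<open>j \<in> insert v (insert u W)\<close> \<open>i \<noteq> j\<close> by blast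
      then show ?thesis
        by cases (use uv1 w3[of j] w2[of i] w1[of i j] \<open>i \<noteq> j\<close> in simp_all)
    qed
    fix i j assume ij: "i \<in> insert v V" "j \<in> insert v V" "i \<noteq> j"
    show "(M n i j \<noteq> 0) = ((i, j) \<in> R')"
    proof (cases "i = v")
      case True
      then have "(M n j i \<noteq> 0) = ((j, i) \<in> R')" using ij key[of j i] VW' by auto
      moreover have "M n i j = M n j i" using sym_onD[OF symM ij(1,2)] .
      ultimately show ?thesis using symR' by metis
    next
      case False
      then show ?thesis using ij key[of i j] VW' by auto
    qed
  qed (rule symM)
  \<comment> \<open>\<open>M n\<close> has no limit because of \<open>1 / e n\<close>, so
    \<open>ssp_eventually\<close> does not apply. A limit \<open>Y\<close> of normalized violations
    is turned into a violation \<open>Z\<close> for \<open>A\<close> on the contracted vertex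
    set.\<close>
  have "\<exists>n. ssp_on (insert v V) (M (n + n0))"
  proof (rule ccontr)
    assume "\<not> ?thesis"
    then have ns: "\<And>n. \<not> ssp_on (insert v V) (M (n + n0))" by blast
    have fV': "finite (insert v V)" using fV by simp
    obtain f X Y where X: "strict_mono f" "\<And>n. sym_on (insert v V) (X n)"
      "\<And>n i j. i \<in> insert v V \<Longrightarrow> j \<in> insert v V \<Longrightarrow> i = j \<or> M (f n + n0) i j \<noteq> 0 \<Longrightarrow> X n i j = 0"
      "\<And>n. comm_on (insert v V) (M (f n + n0)) (X n)"
      "\<And>i j. i \<in> insert v V \<Longrightarrow> j \<in> insert v V \<Longrightarrow> (\<lambda>n. X n i j) \<longlonglongrightarrow> Y i j"
      "\<not> (\<forall>i\<in>insert v V. \<forall>j\<in>insert v V. Y i j = 0)"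
      by (rule not_ssp_cluster[OF fV' ns]) (rule that; assumption)
    define g where "g n = f n + n0" for n
    have gn: "g n \<ge> n0" for n by (simp add: g_def)
    have sg: "strict_mono g" using X(1) by (simp add: g_def strict_mono_def)
    have limg: "(\<lambda>n. C (g n) i j) \<longlonglongrightarrow> A i j" if "i \<in> V" "j \<in> V" for i j
      using LIMSEQ_subseq_LIMSEQ[OF lim[OF that] sg] by (simp add: o_def)
    have elimg: "(\<lambda>n. e (g n)) \<longlonglongrightarrow> 0" using LIMSEQ_subseq_LIMSEQ[OF elim sg] by (simp add: o_def)
    have symY: "sym_on (insert v V) Y" by (rule sym_on_limit[OF X(2) X(5)])
    have Xz: "X n i j = 0" if "i \<in> insert v V" "j \<in> insert v V" "i = j \<or> (i, j) \<in> R'" for n i j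
      using X(3)[OF that(1,2), of n] that real[OF gn[of n]] unfolding realizes_def g_def by blast
    have Yz: "Y i j = 0" if "i \<in> insert v V" "j \<in> insert v V" "i = j \<or> (i, j) \<in> R'" for i j
      using X(5)[OF that(1,2)] Xz[OF that] by (simp add: LIMSEQ_const_iff)
    have in': "u \<in> insert v V" "v \<in> insert v V" "\<And>i. i \<in> W \<Longrightarrow> i \<in> insert v V" "\<And>i. i \<in> W \<Longrightarrow> i \<in> V"
      using VW by auto
    have Xuv: "X n u u = 0" "X n v v = 0" "X n u v = 0" "X n v u = 0" for n
      using Xz in' R'uv symR' by auto
    have eq: "(\<Sum>k\<in>insert v V. M (g n) i k * X n k j) = (\<Sum>k\<in>insert v V. X n i k * M (g n) k j)"
      if "i \<in> insert v V" "j \<in> insert v V" for n i j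
      using comm_onD[OF X(4) that] by (simp add: g_def)
    have scale: "E * (a * ((d - 1 / E) / 2) + (b * ((d + 1 / E) / 2) + S))
      = a * ((E * d - 1) / 2) + (b * ((E * d + 1) / 2) + E * S)" if "E > 0" for E a b d S :: real
      using that by (simp add: field_simps)
    \<comment> \<open>The commutator equation at \<open>(i, u)\<close> is multiplied by
      \<open>e\<close>. In the limit only the terms that carried \<open>1 / e\<close> survive, and
      they say that columns \<open>u\<close> and \<open>v\<close> of \<open>Y\<close> agree.\<close>
    have Yuv: "Y i u = Y i v" if i: "i \<in> W" for i
    proof -
      have *: "\<forall>n. e (g n) * (\<Sum>k\<in>W. C (g n) i k * X n k u) =
        X n i v * ((e (g n) * C (g n) u u - 1) / 2) + (X n i u * ((e (g n) * C (g n) u u + 1) / 2)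
          + e (g n) * (\<Sum>k\<in>W. X n i k * (c * (1 + s k) * C (g n) k u)))" (is "\<forall>n. ?P n")
      proof
        fix n
        have "(\<Sum>k\<in>W. C (g n) i k * X n k u) = X n i v * ((C (g n) u u - 1 / e (g n)) / 2) +
          (X n i u * ((C (g n) u u + 1 / e (g n)) / 2) + (\<Sum>k\<in>W. X n i k * (c * (1 + s k) * C (g n) k u)))"
          using eq[of i u n] in' i unfolding sumV' by (simp add: M1 M2 M3 Xuv)
        then show "?P n" using scale[OF e0[of "g n"]] by (simp only:)
      qed
      have "0 * (\<Sum>k\<in>W. A i k * Y k u) = Y i v * ((0 * A u u - 1) / 2) + (Y i u * ((0 * A u u + 1) / 2)
          + 0 * (\<Sum>k\<in>W. Y i k * (c * (1 + s k) * A k u)))"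
        by (rule limits_eq'[OF *]; intro tendsto_intros elimg limg X(5); use in' i uV in simp)
      then show ?thesis by simp
    qed
    \<comment> \<open>A row of \<open>Y\<close> with equal entries at \<open>u\<close> and
      \<open>v\<close> is a multiple of \<open>(e_u + e_v) / sqrt 2\<close> there, with coefficient
      \<open>sqrt 2 * Y i u\<close>; and \<open>2 * c\<close> is \<open>sqrt 2\<close>.\<close>
    define Z where "Z i j = (if i = u \<or> j = u then 2 * c * Y i j else Y i j)" for i j
    have Z1: "Z i j = Y i j" if "i \<in> W" "j \<in> W" for i j using that uW by (auto simp: Z_def)
    have Z2: "Z i u = 2 * c * Y i u" "Z u i = 2 * c * Y i u" if "i \<in> W" for i
      using sym_onD[OF symY, of i u] in' that by (auto simp: Z_def)
    have Z3: "Z u u = 0" using Yz[of u u] in' by (simp add: Z_def)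
    have symZ: "sym_on V Z" using symY by (auto simp: sym_on_def Z_def)
    have half: "(\<Sum>k\<in>V. A i k * Z k j) = (\<Sum>k\<in>V. Z i k * A k j)" if i: "i \<in> W" and j: "j \<in> V" for i j
    proof (cases "j = u")
      case False
      then have jW: "j \<in> W" using j VW by auto
      have *: "\<forall>n. c * (1 - s i) * C (g n) i u * X n v j + (c * (1 + s i) * C (g n) i u * X n u j + (\<Sum>k\<in>W. C (g n) i k * X n k j))
        = X n i v * (c * (1 - s j) * C (g n) j u) + (X n i u * (c * (1 + s j) * C (g n) j u) + (\<Sum>k\<in>W. X n i k * C (g n) k j))" (is "\<forall>n. ?P n")
      proof
        fix n show "?P n"
          using eq[of i j n] in' i jW unfolding sumV' by (simp add: M1 M2)
      qed
      have "c * (1 - s i) * A i u * Y v j + (c * (1 + s i) * A i u * Y u j + (\<Sum>k\<in>W. A i k * Y k j))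
        = Y i v * (c * (1 - s j) * A j u) + (Y i u * (c * (1 + s j) * A j u) + (\<Sum>k\<in>W. Y i k * A k j))"
        by (rule limits_eq'[OF *]; intro tendsto_intros elimg limg X(5); use in' i jW uV in simp)
      moreover have "Y v j = Y j u" "Y u j = Y j u" "Y i v = Y i u"
        using Yuv i jW sym_onD[OF symY, of v j] sym_onD[OF symY, of u j] in' by auto
      ultimately have "2 * c * A i u * Y j u + (\<Sum>k\<in>W. A i k * Y k j) = 2 * c * Y i u * A j u + (\<Sum>k\<in>W. Y i k * A k j)"
        by (simp add: algebra_simps)
      then show ?thesis using i jW sym_onD[OF symA, of j u] in' uV by (simp add: sumV Z1 Z2 mult_ac)
    next
      case True
      \<comment> \<open>The equations for columns \<open>u\<close> and \<open>v\<close> are added,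
        which cancels the unbounded terms before the limit is taken.\<close>
      have *: "\<forall>n. (\<Sum>k\<in>W. C (g n) i k * (X n k u + X n k v)) = (X n i u + X n i v) * C (g n) u u
        + (\<Sum>k\<in>W. X n i k * (2 * c * C (g n) k u))" (is "\<forall>n. ?P n")
      proof
        fix n
        have "(\<Sum>k\<in>W. C (g n) i k * X n k u) = X n i v * ((C (g n) u u - 1 / e (g n)) / 2) +
          (X n i u * ((C (g n) u u + 1 / e (g n)) / 2) + (\<Sum>k\<in>W. X n i k * (c * (1 + s k) * C (g n) k u)))"
          using eq[of i u n] in' i unfolding sumV' by (simp add: M1 M2 M3 Xuv)
        moreover have "(\<Sum>k\<in>W. C (g n) i k * X n k v) = X n i v * ((C (g n) u u + 1 / e (g n)) / 2) +
          (X n i u * ((C (g n) u u - 1 / e (g n)) / 2) + (\<Sum>k\<in>W. X n i k * (c * (1 - s k) * C (g n) k u)))"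
          using eq[of i v n] in' i unfolding sumV' by (simp add: M1 M2 M3 Xuv)
        ultimately have "(\<Sum>k\<in>W. C (g n) i k * X n k u) + (\<Sum>k\<in>W. C (g n) i k * X n k v)
          = (X n i u + X n i v) * C (g n) u u + ((\<Sum>k\<in>W. X n i k * (c * (1 + s k) * C (g n) k u)) + (\<Sum>k\<in>W. X n i k * (c * (1 - s k) * C (g n) k u)))"
          by (simp add: field_simps)
        then show "?P n" unfolding sum.distrib[symmetric] by (simp add: algebra_simps)
      qed
      have "(\<Sum>k\<in>W. A i k * (Y k u + Y k v)) = (Y i u + Y i v) * A u u + (\<Sum>k\<in>W. Y i k * (2 * c * A k u))"
        by (rule limits_eq'[OF *]; intro tendsto_intros elimg limg X(5); use in' i uV in simp)
      then have "2 * (\<Sum>k\<in>W. A i k * Y k u) = 2 * Y i u * A u u + 2 * c * (\<Sum>k\<in>W. Y i k * A k u)"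
        using Yuv i by (simp add: sum_distrib_left mult_ac)
      then have "c * (2 * (\<Sum>k\<in>W. A i k * Y k u)) = c * (2 * Y i u * A u u + 2 * c * (\<Sum>k\<in>W. Y i k * A k u))"
        by simp
      also have "\<dots> = 2 * c * Y i u * A u u + (\<Sum>k\<in>W. Y i k * A k u)"
        using cc by (simp add: algebra_simps)
      finally have "(\<Sum>k\<in>W. A i k * (2 * c * Y k u)) = 2 * c * Y i u * A u u + (\<Sum>k\<in>W. Y i k * A k u)"
        by (simp add: sum_distrib_left mult_ac)
      then show ?thesis using i True by (simp add: sumV Z1 Z2 Z3)
    qed
    have commZ: "comm_on V A Z"
      unfolding comm_on_def
    proof (intro ballI)
      fix i j assume ij: "i \<in> V" "j \<in> V"
      have sw: "(\<Sum>k\<in>V. A i k * Z k j) = (\<Sum>k\<in>V. Z j k * A k i)" if "i \<in> V" "j \<in> V" for i j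
        using that symA symZ by (intro sum.cong) (auto simp: sym_on_def)
      show "(\<Sum>k\<in>V. A i k * Z k j) = (\<Sum>k\<in>V. Z i k * A k j)"
      proof (cases "i \<in> W")
        case False
        then have iu: "i = u" using ij VW by auto
        show ?thesis
        proof (cases "j \<in> W")
          case True
          then show ?thesis using half[OF True ij(1)] sw[OF ij] sw[OF ij(2,1)] by simp
        next
          case False
          then have "j = u" using ij VW by auto
          then show ?thesis using sw[OF ij] iu by simp
        qed
      qed (use half ij in blast)
    qed
    have Z0: "Z i j = 0" if ij: "i \<in> V" "j \<in> V" for i j
    proof (rule ssp_onD[OF A(2) symZ _ commZ ij])
      fix i j assume ij: "i \<in> V" "j \<in> V" "i = j \<or> A i j \<noteq> 0"
      \<comment> \<open>A neighbour of \<open>u\<close> in the contracted graph is joined to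
        \<open>u\<close> or to \<open>v\<close> in \<open>R'\<close>, so one of the two equal
        entries of \<open>Y\<close> vanishes.\<close>
      have nb: "Y i u = 0" if "i \<in> W" "A i u \<noteq> 0" for i
      proof -
        have "i \<noteq> u" "(i, u) \<in> R" using patA[of i u] that uW uV in' by auto
        then have "(i, u) \<in> R' \<or> (i, v) \<in> R'" using R'u[of i] R'v[of i] that by (auto simp: W_def)
        then show ?thesis using Yz[of i u] Yz[of i v] Yuv[OF that(1)] in' that by auto
      qed
      show "Z i j = 0"
      proof (cases "i = j")
        case True
        then show ?thesis using Yz[of i i] ij by (auto simp: Z_def)
      next
        case False
        then have Aij: "A i j \<noteq> 0" "A j i \<noteq> 0" using ij symA by (auto simp: sym_on_def)
        consider "i \<in> W" "j \<in> W" | "i = u" "j \<in> W" | "j = u" "i \<in> W" using ij False VW by auto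
        then show ?thesis
        proof cases
          case 1
          then have "(i, j) \<in> R'" using patA[OF ij(1,2) False] Aij R'V[of i j] by (auto simp: W_def)
          then show ?thesis using Yz[of i j] 1 in' by (simp add: Z1)
        qed (use nb Aij Z2 in auto)
      qed
    qed
    have Y0: "Y i j = 0" if that': "i \<in> W" "j \<in> insert v V" for i j
    proof -
      have *: "Y i u = 0" using Z0[of i u] Z2(1)[OF that(1)] that in' uV c0 by simp
      consider "j \<in> W" | "j = u" | "j = v" using that' VW by auto
      then show ?thesis using * Z0[of i j] Z1[of i j] Yuv[OF that'(1)] that' in' by cases auto
    qed
    have "Y i j = 0" if "i \<in> insert v V" "j \<in> insert v V" for i j
    proof (cases "i \<in> W \<or> j \<in> W")
      case True
      then show ?thesis using Y0[of i j] Y0[of j i] sym_onD[OF symY that] that by auto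
    next
      case False
      then have "i \<in> {u, v}" "j \<in> {u, v}" using that VW by auto
      then show ?thesis using Yz[of i j] that R'uv symR' by auto
    qed
    with X(6) show False by blast
  qed
  then obtain n where n: "ssp_on (insert v V) (M (n + n0))" by blast
  have "realizes (insert v V) R' (M (n + n0))" by (rule real) simp
  then show ?thesis unfolding ssp_realizable_def using n tr lm by blast
qed

section \<open>Minors\<close>

definition simple_graph :: "'a pair_pre_digraph \<Rightarrow> bool" where
  "simple_graph G \<longleftrightarrow> finite (pverts G) \<and> parcs G \<subseteq> pverts G \<times> pverts G \<and> sym (parcs G) \<and> irrefl (parcs G)"

lemma pair_graph_simple_graph:
  assumes "pair_graph G"
  shows "simple_graph G"
proof -
  interpret pair_graph G by fact
  have "sym (parcs G)" using pair_sym_arcs by (simp add: symmetric_def)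
  then show ?thesis
    unfolding simple_graph_def irrefl_def using pair_finite_verts arc_fst_in_verts arc_snd_in_verts pair_no_loops
    by force
qed

lemma simple_graphD:
  assumes "simple_graph G"
  shows "finite (pverts G)" "(a, b) \<in> parcs G \<Longrightarrow> a \<in> pverts G" "(a, b) \<in> parcs G \<Longrightarrow> b \<in> pverts G"
    "(a, b) \<in> parcs G \<Longrightarrow> (b, a) \<in> parcs G" "(a, b) \<in> parcs G \<Longrightarrow> a \<noteq> b"
  using assms by (auto simp: simple_graph_def sym_def irrefl_def)

lemma contract_edge_parcs:
  assumes "simple_graph G" "(u, v) \<in> parcs G"
  shows "pverts (contract_edge u v G) = pverts G - {v}"
    "(a, b) \<in> parcs (contract_edge u v G) \<longleftrightarrow>
      a \<noteq> v \<and> b \<noteq> v \<and> a \<noteq> b \<and> ((a, b) \<in> parcs G \<or> (a = u \<and> (v, b) \<in> parcs G) \<or> (b = u \<and> (a, v) \<in> parcs G))"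
proof -
  note G = simple_graphD[OF assms(1)]
  have uv: "u \<noteq> v" "u \<in> pverts G" using G assms(2) by auto
  show "pverts (contract_edge u v G) = pverts G - {v}"
    using uv by (auto simp: contract_edge_def Let_def)
  show "(a, b) \<in> parcs (contract_edge u v G) \<longleftrightarrow>
      a \<noteq> v \<and> b \<noteq> v \<and> a \<noteq> b \<and> ((a, b) \<in> parcs G \<or> (a = u \<and> (v, b) \<in> parcs G) \<or> (b = u \<and> (a, v) \<in> parcs G))"
    (is "?L \<longleftrightarrow> ?R")
  proof
    assume ?L
    then obtain x y where "(x, y) \<in> parcs G" "a = (id(v := u)) x" "b = (id(v := u)) y" "a \<noteq> b"
      by (auto simp: contract_edge_def Let_def)
    then show ?R using uv G(5)[of x y] by (auto split: if_splits)
  next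
    assume r: ?R
    have *: "?L" if "(x, y) \<in> parcs G" "(id(v := u)) x = a" "(id(v := u)) y = b" for x y
    proof -
      have "(a, b) \<in> {((id(v := u)) x, (id(v := u)) y) | x y. (x, y) \<in> parcs G \<and> (id(v := u)) x \<noteq> (id(v := u)) y}"
        by (intro CollectI exI[of _ x] exI[of _ y]) (use that r in auto)
      then show ?thesis by (simp add: contract_edge_def Let_def)
    qed
    from r consider "(a, b) \<in> parcs G" | "a = u" "(v, b) \<in> parcs G" | "b = u" "(a, v) \<in> parcs G" by auto
    then show ?L
    proof cases
      case 1 then show ?thesis using *[of a b] r by simp
    next
      case 2 then show ?thesis using *[of v b] r by simp
    next
      case 3 then show ?thesis using *[of a v] r by simp
    qed
  qed
qed

lemma simple_graph_contract_edge:
  assumes "simple_graph G" "(u, v) \<in> parcs G"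
  shows "simple_graph (contract_edge u v G)"
proof -
  note G = simple_graphD[OF assms(1)] and C = contract_edge_parcs[OF assms]
  have "a \<in> pverts G - {v} \<and> b \<in> pverts G - {v} \<and> (b, a) \<in> parcs (contract_edge u v G) \<and> a \<noteq> b"
    if "(a, b) \<in> parcs (contract_edge u v G)" for a b
    using that G(2,3)[OF assms(2)] G(2-5) unfolding C(2) by blast
  then show ?thesis unfolding simple_graph_def sym_def irrefl_def C(1) using G(1) by auto
qed

lemma minor_step_ssp_realizable:
  assumes "minor_step G K" "simple_graph G"
  shows "simple_graph K \<and> (ssp_realizable (pverts K) (parcs K) \<longrightarrow> ssp_realizable (pverts G) (parcs G))"
  using assms
proof (induction rule: minor_step.induct)
  case (edge_deletion u v G)
  note G = simple_graphD[OF edge_deletion(2)]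
  have "simple_graph (delete_edge u v G)"
    using edge_deletion(2) by (auto simp: simple_graph_def delete_edge_def sym_def irrefl_def)
  moreover have "ssp_realizable (pverts G) (parcs G)" if "ssp_realizable (pverts G) (parcs G - {(u, v), (v, u)})"
    by (rule ssp_realizable_add_edges[OF G(1) that]) (use G(4) in auto)
  ultimately show ?case by (auto simp: delete_edge_def)
next
  case (vertex_deletion v G)
  note G = simple_graphD[OF vertex_deletion(2)]
  have "simple_graph (delete_vertex v G)"
    using vertex_deletion(2) by (auto simp: simple_graph_def delete_vertex_def sym_def irrefl_def)
  moreover have "ssp_realizable (pverts G) (parcs G)"
    if g: "ssp_realizable (pverts G - {v}) {(a, b) \<in> parcs G. a \<noteq> v \<and> b \<noteq> v}"
  proof -
    have "ssp_realizable (insert v (pverts G - {v})) {(a, b) \<in> parcs G. a \<noteq> v \<and> b \<noteq> v}"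
      by (rule ssp_realizable_isolated[OF _ _ g]) (use G(1) in auto)
    then have "ssp_realizable (pverts G) {(a, b) \<in> parcs G. a \<noteq> v \<and> b \<noteq> v}"
      using vertex_deletion(1) by (simp add: insert_absorb)
    then show ?thesis by (rule ssp_realizable_add_edges[OF G(1)]) (use G(4) in auto)
  qed
  ultimately show ?case by (auto simp: delete_vertex_def)
next
  case (edge_contraction u v G)
  note G = simple_graphD[OF edge_contraction(2)] and C = contract_edge_parcs[OF edge_contraction(2,1)]
  have uv: "u \<noteq> v" "u \<in> pverts G" "v \<in> pverts G" "(v, u) \<in> parcs G" using G edge_contraction(1) by auto
  have "ssp_realizable (pverts G) (parcs G)" if g: "ssp_realizable (pverts G - {v}) (parcs (contract_edge u v G))"
  proof -
    \<comment> \<open>A splitting joins each old neighbour to exactly one of \<open>u\<close> and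
      \<open>v\<close>. Common neighbours are assigned to \<open>u\<close>; \<open>R'\<close> omits
      their edges to \<open>v\<close>, which are restored as added edges at the end.\<close>
    define N where "N = {i. (i, u) \<notin> parcs G}"
    define R' where "R' = {(a, b) \<in> parcs G. \<not> (a = v \<and> b \<noteq> u \<and> b \<notin> N) \<and> \<not> (b = v \<and> a \<noteq> u \<and> a \<notin> N)}"
    have "ssp_realizable (insert v (pverts G - {v})) R'"
    proof (rule ssp_realizable_decontract[OF _ _ _ g, where u = u and N = N])
      show "(j, i) \<in> parcs (contract_edge u v G)" if "(i, j) \<in> parcs (contract_edge u v G)" for i j
        using that G(4) unfolding C(2) by blast
      show "((i, j) \<in> R') = ((i, j) \<in> parcs (contract_edge u v G))"
        if "i \<in> pverts G - {v} - {u}" "j \<in> pverts G - {v} - {u}" for i j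
        using that G(5) unfolding C(2) R'_def by auto
      show "((i, u) \<in> R') = ((i, u) \<in> parcs (contract_edge u v G) \<and> i \<notin> N)" if "i \<in> pverts G - {v} - {u}" for i
        using that uv unfolding C(2) R'_def N_def by auto
      show "((i, v) \<in> R') = ((i, u) \<in> parcs (contract_edge u v G) \<and> i \<in> N)" if "i \<in> pverts G - {v} - {u}" for i
        using that uv unfolding C(2) R'_def N_def by auto
      show "(u, v) \<in> R'" using edge_contraction(1) uv by (auto simp: R'_def)
      show "(j, i) \<in> R'" if "(i, j) \<in> R'" for i j using that G(4) by (auto simp: R'_def)
    qed (use uv G(1) in auto)
    then have "ssp_realizable (pverts G) R'" using uv by (simp add: insert_absorb)
    then show ?thesis by (rule ssp_realizable_add_edges[OF G(1)]) (use G(4) in \<open>auto simp: R'_def\<close>)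
  qed
  then show ?case using simple_graph_contract_edge[OF edge_contraction(2,1)] by (simp add: C(1))
qed

lemma minor_steps_ssp_realizable:
  assumes "minor_step\<^sup>*\<^sup>* G K" "simple_graph G"
  shows "simple_graph K \<and> (ssp_realizable (pverts K) (parcs K) \<longrightarrow> ssp_realizable (pverts G) (parcs G))"
  using assms by (induction rule: rtranclp_induct) (use minor_step_ssp_realizable in blast)+

lemma is_minor_ssp_realizable:
  assumes "is_minor H G" "simple_graph G" "ssp_realizable (pverts H) (parcs H)"
  shows "ssp_realizable (pverts G) (parcs G)"
proof -
  obtain K where K: "minor_step\<^sup>*\<^sup>* G K" "digraph_iso (with_proj K) (with_proj H)"
    using assms(1) by (auto simp: is_minor_def)
  have sK: "simple_graph K" using minor_steps_ssp_realizable[OF K(1) assms(2)] by blast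
  note KD = simple_graphD[OF sK]
  obtain f where f: "pre_digraph.digraph_isomorphism (with_proj K) f" "with_proj H = app_iso f (with_proj K)"
    using K(2) by (auto simp: digraph_iso_def)
  define \<phi> where "\<phi> = iso_verts f"
  have inj: "inj_on \<phi> (pverts K)"
    using f(1) by (auto simp: pre_digraph.digraph_isomorphism_def \<phi>_def)
  have V: "pverts H = \<phi> ` pverts K" and E: "parcs H = iso_arcs f ` parcs K"
    and ht: "iso_tail f = fst" "iso_head f = snd"
    using f(2) by (auto simp: with_proj_def app_iso_def \<phi>_def)
  \<comment> \<open>With heads and tails given by the projections, the arc map is determined by the
    vertex map.\<close>
  have a: "iso_arcs f (i, j) = (\<phi> i, \<phi> j)" if "(i, j) \<in> parcs K" for i j
  proof -
    have "\<phi> i = fst (iso_arcs f (i, j))" "\<phi> j = snd (iso_arcs f (i, j))"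
      using f(1) that by (auto simp: pre_digraph.digraph_isomorphism_def \<phi>_def ht)
    then show ?thesis by (metis prod.collapse)
  qed
  have "ssp_realizable (pverts K) (parcs K)"
  proof (rule ssp_realizable_iso[OF _ KD(1) assms(3)])
    show "bij_betw \<phi> (pverts K) (pverts H)" using inj V by (simp add: bij_betw_def)
    fix i j assume ij: "i \<in> pverts K" "j \<in> pverts K"
    show "((\<phi> i, \<phi> j) \<in> parcs H) = ((i, j) \<in> parcs K)"
    proof
      assume "(\<phi> i, \<phi> j) \<in> parcs H"
      then obtain x y where xy: "(x, y) \<in> parcs K" "(\<phi> i, \<phi> j) = iso_arcs f (x, y)" unfolding E by auto
      then have "\<phi> i = \<phi> x" "\<phi> j = \<phi> y" using a by auto
      then have "i = x" "j = y" using inj ij KD(2,3)[OF xy(1)] by (auto dest: inj_onD)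
      then show "(i, j) \<in> parcs K" using xy by simp
    next
      assume "(i, j) \<in> parcs K"
      then show "(\<phi> i, \<phi> j) \<in> parcs H" using a E by force
    qed
  qed
  then show ?thesis using minor_steps_ssp_realizable[OF K(1) assms(2)] by blast
qed

section \<open>Minors from embedded subgraphs\<close>

lemma is_minor_step:
  assumes "minor_step G K" "is_minor H K"
  shows "is_minor H G"
  using assms unfolding is_minor_def by (meson converse_rtranclp_into_rtranclp)

lemma delete_vertices_minor:
  assumes "finite D" "D \<subseteq> pverts G"
  shows "minor_step\<^sup>*\<^sup>* G \<lparr>pverts = pverts G - D, parcs = {(a, b) \<in> parcs G. a \<notin> D \<and> b \<notin> D}\<rparr>"
  using assms
proof (induction D rule: finite_induct)
  case empty
  have "\<lparr>pverts = pverts G - {}, parcs = {(a, b) \<in> parcs G. a \<notin> {} \<and> b \<notin> {}}\<rparr> = G" by simp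
  then show ?case by (simp only: rtranclp.rtrancl_refl)
next
  case (insert v D)
  let ?K = "\<lparr>pverts = pverts G - D, parcs = {(a, b) \<in> parcs G. a \<notin> D \<and> b \<notin> D}\<rparr>"
  have "minor_step ?K (delete_vertex v ?K)" by (rule vertex_deletion) (use insert in auto)
  moreover have "delete_vertex v ?K = \<lparr>pverts = pverts G - insert v D,
      parcs = {(a, b) \<in> parcs G. a \<notin> insert v D \<and> b \<notin> insert v D}\<rparr>"
    by (auto simp: delete_vertex_def)
  ultimately show ?case using insert by (metis (lifting) insert_subset rtranclp.rtrancl_into_rtrancl)
qed

lemma delete_edges_minor:
  assumes "finite F" "sym (parcs G)"
  shows "minor_step\<^sup>*\<^sup>* G \<lparr>pverts = pverts G, parcs = parcs G - (F \<union> F\<inverse>)\<rparr>"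
  using assms
proof (induction F rule: finite_induct)
  case empty
  have "\<lparr>pverts = pverts G, parcs = parcs G - ({} \<union> {}\<inverse>)\<rparr> = G" by simp
  then show ?case by (simp only: rtranclp.rtrancl_refl)
next
  case (insert e F)
  obtain u v where e: "e = (u, v)" by (cases e)
  let ?K = "\<lparr>pverts = pverts G, parcs = parcs G - (F \<union> F\<inverse>)\<rparr>"
  have eq: "delete_edge u v ?K = \<lparr>pverts = pverts G, parcs = parcs G - (insert e F \<union> (insert e F)\<inverse>)\<rparr>"
    by (auto simp: delete_edge_def e)
  show ?case
  proof (cases "(u, v) \<in> parcs ?K")
    case True
    then have "minor_step ?K (delete_edge u v ?K)" by (rule edge_deletion)
    then show ?thesis using insert eq by (metis (lifting) rtranclp.rtrancl_into_rtrancl)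
  next
    case False
    then have "(v, u) \<notin> parcs ?K" using insert(4) by (auto simp: sym_def)
    with False have "delete_edge u v ?K = ?K" by (simp add: delete_edge_def)
    then show ?thesis using insert eq by simp
  qed
qed

lemma subgraph_is_minor:
  assumes G: "simple_graph G" and H: "simple_graph H"
    and inj: "inj_on \<phi> (pverts H)" and im: "\<And>i. i \<in> pverts H \<Longrightarrow> \<phi> i \<in> pverts G"
    and ed: "\<And>i j. (i, j) \<in> parcs H \<Longrightarrow> (\<phi> i, \<phi> j) \<in> parcs G"
  shows "is_minor H G"
proof -
  note GD = simple_graphD[OF G] and HD = simple_graphD[OF H]
  define S where "S = \<phi> ` pverts H"
  define E where "E = map_prod \<phi> \<phi> ` parcs H"
  define G1 where "G1 = \<lparr>pverts = pverts G - (pverts G - S),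
      parcs = {(a, b) \<in> parcs G. a \<notin> pverts G - S \<and> b \<notin> pverts G - S}\<rparr>"
  have 1: "minor_step\<^sup>*\<^sup>* G G1" unfolding G1_def by (rule delete_vertices_minor) (use GD(1) in auto)
  have G1: "pverts G1 = S" "parcs G1 = {(a, b) \<in> parcs G. a \<in> S \<and> b \<in> S}"
    using im GD(2,3) by (auto simp: G1_def S_def)
  have sE: "sym E" using HD(4) by (force simp: sym_def E_def)
  have s1: "sym (parcs G1)" using GD(4) by (auto simp: G1 sym_def)
  have EG: "E \<subseteq> parcs G1" using ed HD(2,3) by (auto simp: G1 E_def S_def)
  define F where "F = parcs G1 - E"
  define K where "K = \<lparr>pverts = pverts G1, parcs = parcs G1 - (F \<union> F\<inverse>)\<rparr>"
  have fF: "finite F"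
  proof (rule finite_subset)
    show "F \<subseteq> pverts G \<times> pverts G" using GD(2,3) by (auto simp: F_def G1)
  qed (use GD(1) in simp)
  have 2: "minor_step\<^sup>*\<^sup>* G1 K" unfolding K_def by (rule delete_edges_minor[OF fF s1])
  have "F\<inverse> = F" using sE s1 by (auto simp: F_def sym_def)
  then have K: "pverts K = S" "parcs K = E" using EG by (auto simp: K_def G1(1) F_def)
  define \<psi> where "\<psi> = inv_into (pverts H) \<phi>"
  have \<psi>: "\<psi> (\<phi> i) = i" if "i \<in> pverts H" for i using inj that by (simp add: \<psi>_def)
  have \<psi>S: "inj_on \<psi> S" "\<psi> ` S = pverts H" using \<psi> by (auto simp: S_def inj_on_def image_def)
  have \<psi>E: "map_prod \<psi> \<psi> ` E = parcs H"
  proof -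
    have "map_prod \<psi> \<psi> (map_prod \<phi> \<phi> e) = e" if "e \<in> parcs H" for e
      using that HD(2,3) \<psi> by (cases e) auto
    then show ?thesis unfolding E_def image_image by simp
  qed
  have ES: "E \<subseteq> S \<times> S" using HD(2,3) by (auto simp: E_def S_def)
  have "digraph_iso (with_proj K) (with_proj H)"
    unfolding digraph_iso_def
  proof (intro exI conjI)
    let ?f = "\<lparr>iso_verts = \<psi>, iso_arcs = map_prod \<psi> \<psi>, iso_head = snd, iso_tail = fst\<rparr>"
    have "wf_digraph (with_proj K)" by unfold_locales (use ES in \<open>auto simp: K\<close>)
    moreover have "inj_on (map_prod \<psi> \<psi>) E"
      by (rule inj_on_subset[OF map_prod_inj_on[OF \<psi>S(1) \<psi>S(1)] ES])
    ultimately show "pre_digraph.digraph_isomorphism (with_proj K) ?f"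
      using \<psi>S(1) by (auto simp: pre_digraph.digraph_isomorphism_def K)
    show "with_proj H = app_iso ?f (with_proj K)"
      using \<psi>S(2) \<psi>E by (simp add: with_proj_def app_iso_def K)
  qed
  then show ?thesis unfolding is_minor_def using 1 2 by (meson rtranclp_trans)
qed

lemma graph_of_edges_simps [simp]:
  "pverts (graph_of_edges k E) = {..<k}" "parcs (graph_of_edges k E) = E \<union> E\<inverse>"
  by (simp_all add: graph_of_edges_def)

lemma simple_graph_graph_of_edges: "\<forall>(i, j)\<in>E. i < k \<and> j < k \<and> i \<noteq> j \<Longrightarrow> simple_graph (graph_of_edges k E)"
  by (auto simp: simple_graph_def sym_def irrefl_def)

text \<open>The embedding is given by a list of vertices, so for a concrete graph only distinctness
  and finitely many arcs have to be checked.\<close>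

lemma list_embedding_is_minor:
  assumes G: "simple_graph G" and E: "\<forall>(i, j)\<in>E. i < k \<and> j < k \<and> i \<noteq> j"
    and xs: "distinct xs" "length xs = k" "set xs \<subseteq> pverts G"
    and ed: "\<forall>(i, j)\<in>E. (xs ! i, xs ! j) \<in> parcs G"
  shows "is_minor (graph_of_edges k E) G"
proof (rule subgraph_is_minor[OF G simple_graph_graph_of_edges[OF E], of "\<lambda>i. xs ! i"])
  show "inj_on ((!) xs) (pverts (graph_of_edges k E))" using xs by (auto simp: inj_on_def nth_eq_iff_index_eq)
  show "xs ! i \<in> pverts G" if "i \<in> pverts (graph_of_edges k E)" for i using xs that by auto
  show "(xs ! i, xs ! j) \<in> parcs G" if "(i, j) \<in> parcs (graph_of_edges k E)" for i j
    using that ed simple_graphD(4)[OF G] by fastforce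
qed

lemma list_embedding_union_is_minor:
  assumes G: "simple_graph G" and E: "\<forall>(i, j)\<in>E. i < k \<and> j < k \<and> i \<noteq> j" and E': "\<forall>(i, j)\<in>E'. i < k' \<and> j < k' \<and> i \<noteq> j"
    and xs: "distinct (xs @ ys)" "length xs = k" "length ys = k'" "set (xs @ ys) \<subseteq> pverts G"
    and ed: "\<forall>(i, j)\<in>E. (xs ! i, xs ! j) \<in> parcs G" "\<forall>(i, j)\<in>E'. (ys ! i, ys ! j) \<in> parcs G"
  shows "is_minor (disjoint_union (graph_of_edges k E) (graph_of_edges k' E')) G"
proof (rule subgraph_is_minor[OF G, of _ "\<lambda>i. if even i then xs ! (i div 2) else ys ! (i div 2)"])
  let ?H = "disjoint_union (graph_of_edges k E) (graph_of_edges k' E')"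
  have V: "pverts ?H = (\<lambda>i. 2 * i) ` {..<k} \<union> (\<lambda>i. 2 * i + 1) ` {..<k'}"
    and A: "parcs ?H = (\<lambda>(i, j). (2 * i, 2 * j)) ` (E \<union> E\<inverse>) \<union> (\<lambda>(i, j). (2 * i + 1, 2 * j + 1)) ` (E' \<union> E'\<inverse>)"
    by (simp_all add: disjoint_union_def)
  show "simple_graph ?H"
    unfolding simple_graph_def
  proof (intro conjI)
    show "finite (pverts ?H)" by (simp add: V)
    show "parcs ?H \<subseteq> pverts ?H \<times> pverts ?H" unfolding V A using E E' by force
    show "sym (parcs ?H)" unfolding A sym_def by force
    show "irrefl (parcs ?H)" unfolding A irrefl_def using E E' by force
  qed
  show "inj_on (\<lambda>i. if even i then xs ! (i div 2) else ys ! (i div 2)) (pverts ?H)"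
  proof (rule inj_onI)
    have ne: "xs ! i \<noteq> ys ! j" if "i < k" "j < k'" for i j
      using xs that by (metis disjoint_iff distinct_append nth_mem)
    fix a b assume "a \<in> pverts ?H" "b \<in> pverts ?H"
      "(if even a then xs ! (a div 2) else ys ! (a div 2)) = (if even b then xs ! (b div 2) else ys ! (b div 2))"
    then show "a = b" unfolding V using xs ne ne[symmetric]
      by (auto simp: nth_eq_iff_index_eq)
  qed
  show "(if even i then xs ! (i div 2) else ys ! (i div 2)) \<in> pverts G" if "i \<in> pverts ?H" for i
    using that xs unfolding V by auto
  show "(if even i then xs ! (i div 2) else ys ! (i div 2), if even j then xs ! (j div 2) else ys ! (j div 2)) \<in> parcs G"
    if "(i, j) \<in> parcs ?H" for i j
  proof -
    from that consider i' j' where "i = 2 * i'" "j = 2 * j'" "(i', j') \<in> E \<union> E\<inverse>"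
      | i' j' where "i = 2 * i' + 1" "j = 2 * j' + 1" "(i', j') \<in> E' \<union> E'\<inverse>"
      unfolding A by fastforce
    then show ?thesis
    proof cases
      case 1
      then have "(xs ! i', xs ! j') \<in> parcs G" using ed(1) simple_graphD(4)[OF G] by blast
      with 1 show ?thesis by simp
    next
      case 2
      then have "(ys ! i', ys ! j') \<in> parcs G" using ed(2) simple_graphD(4)[OF G] by blast
      with 2 show ?thesis by simp
    qed
  qed
qed

section \<open>Edge lists of the excluded graphs\<close>

lemma complete_graph_3_edges: "complete_graph 3 = graph_of_edges 3 {(0, 1), (0, 2), (1, 2)}"
  unfolding complete_graph_def by (rule arg_cong[of _ _ "graph_of_edges 3"]) auto

lemma complete_bipartite_1_3_edges: "complete_bipartite 1 3 = graph_of_edges 4 {(0, 1), (0, 2), (0, 3)}"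
proof -
  have "{..<1::nat} \<times> {1..<1+3::nat} = {(0, 1), (0, 2), (0, 3)}" by auto
  then show ?thesis unfolding complete_bipartite_def by simp
qed

lemma complete_bipartite_1_6_edges:
  "complete_bipartite 1 6 = graph_of_edges 7 {(0, 1), (0, 2), (0, 3), (0, 4), (0, 5), (0, 6)}"
proof -
  have "{..<1::nat} \<times> {1..<1+6::nat} = {(0, 1), (0, 2), (0, 3), (0, 4), (0, 5), (0, 6)}" by auto
  then show ?thesis unfolding complete_bipartite_def by simp
qed

lemma cycle_graph_4_edges: "cycle_graph 4 = graph_of_edges 4 {(0, 1), (1, 2), (2, 3), (3, 0)}"
proof -
  have "{(i, Suc i mod 4) | i. i < 4} = (\<lambda>i. (i, Suc i mod 4)) ` {..<4}" by auto
  also have "{..<4::nat} = {0, 1, 2, 3}" by auto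
  also have "(\<lambda>i::nat. (i, Suc i mod 4)) ` {0, 1, 2, 3} = {(0, 1), (1, 2), (2, 3), (3, 0)}"
    by (simp flip: numeral_2_eq_2)
  finally show ?thesis by (simp only: cycle_graph_def)
qed

text \<open>Turns a comprehension into a union of images over initial segments, which can be
  enumerated for concrete arm lengths.\<close>

lemma Collect_bounded_pairs:
  fixes f :: "nat \<Rightarrow> nat \<Rightarrow> 'a"
  shows "{f a j | a j. a < n \<and> j < g a} = (\<Union>a\<in>{..<n}. f a ` {..<g a})"
  by auto

lemma spider_edges_UN:
  fixes ks :: "nat list"
  shows "{(if j = 0 then 0 else sum_list (take a ks) + j, sum_list (take a ks) + j + 1) | a j.
      a < length ks \<and> j < ks ! a}
   = (\<Union>a\<in>{..<length ks}. (\<lambda>j. (if j = 0 then 0 else sum_list (take a ks) + j, sum_list (take a ks) + j + 1)) ` {..<ks ! a})"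
  by (rule Collect_bounded_pairs)

lemma spider_222_edges:
  "spider [2, 2, 2] = graph_of_edges 7 {(0, 1), (1, 2), (0, 3), (3, 4), (0, 5), (5, 6)}"
  unfolding spider_def spider_edges_UN
  by (simp add: lessThan_Suc numeral_eq_Suc insert_commute)

lemma spider_2211_edges:
  "spider [2, 2, 1, 1] = graph_of_edges 7 {(0, 1), (1, 2), (0, 3), (3, 4), (0, 5), (0, 6)}"
  unfolding spider_def spider_edges_UN
  by (simp add: lessThan_Suc numeral_eq_Suc insert_commute)

lemma spider_21111_edges:
  "spider [2, 1, 1, 1, 1] = graph_of_edges 7 {(0, 1), (1, 2), (0, 3), (0, 4), (0, 5), (0, 6)}"
  unfolding spider_def spider_edges_UN
  by (simp add: lessThan_Suc numeral_eq_Suc insert_commute)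

section \<open>Contracting long cycles and long H-shaped trees\<close>

text \<open>Contracting the first edge shortens the cycle until four vertices remain. Chords do no
  harm, as only a subgraph is wanted.\<close>

lemma cycle_is_minor:
  assumes "simple_graph G" "distinct xs" "length xs \<ge> 4" "set xs \<subseteq> pverts G"
    "successively (\<lambda>x y. (x, y) \<in> parcs G) xs" "(last xs, hd xs) \<in> parcs G"
  shows "is_minor (cycle_graph 4) G"
  using assms
proof (induction xs arbitrary: G rule: length_induct)
  case (1 xs)
  show ?case
  proof (cases "length xs = 4")
    case True
    then obtain a b c d where "xs = [a, b, c, d]" by (auto simp: length_Suc_conv numeral_eq_Suc)
    then show ?thesis
      unfolding cycle_graph_4_edges using 1(2-) by (intro list_embedding_is_minor[where xs = xs]) auto
  next
    case False
    then have "length xs \<ge> 5" using 1 by simp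
    then obtain a b c d es where xs: "xs = a # b # c # d # es" "es \<noteq> []"
      by (auto simp: Suc_le_length_iff numeral_eq_Suc)
    have ab: "(a, b) \<in> parcs G" and bc: "(b, c) \<in> parcs G" using 1 xs by auto
    let ?G = "contract_edge a b G"
    note C = contract_edge_parcs[OF 1(2) ab]
    have suc: "successively (\<lambda>x y. (x, y) \<in> parcs ?G) (c # d # es)"
    proof (rule successively_mono)
      show "successively (\<lambda>x y. (x, y) \<in> parcs G) (c # d # es)" using 1 xs by simp
      show "(x, y) \<in> parcs ?G" if "x \<in> set (c # d # es)" "y \<in> set (c # d # es)" "(x, y) \<in> parcs G" for x y
        using that 1(3) xs simple_graphD(5)[OF 1(2) that(3)] unfolding C(2) by auto
    qed
    have "is_minor (cycle_graph 4) ?G"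
    proof (rule 1(1)[rule_format, of "a # c # d # es"])
      show "length (a # c # d # es) < length xs" using xs by simp
      show "simple_graph ?G" by (rule simple_graph_contract_edge[OF 1(2) ab])
      show "4 \<le> length (a # c # d # es)" using xs by (cases es) auto
      show "distinct (a # c # d # es)" using 1 xs by simp
      show "set (a # c # d # es) \<subseteq> pverts ?G" using 1 xs unfolding C(1) by auto
      show "successively (\<lambda>x y. (x, y) \<in> parcs ?G) (a # c # d # es)"
        using suc bc 1(3) xs unfolding C(2) by auto
      have "last es \<noteq> b" "last es \<noteq> a" using 1(3) xs by (metis distinct.simps(2) last_in_set list.set_intros(2))+
      then show "(last (a # c # d # es), hd (a # c # d # es)) \<in> parcs ?G"
        using 1 xs unfolding C(2) by auto
    qed
    then show ?thesis using is_minor_step[OF edge_contraction[OF ab]] by blast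
  qed
qed

text \<open>\<open>xs\<close> joins the two branch vertices; \<open>a\<close>, \<open>b\<close> hang
  at its first and \<open>c\<close>, \<open>d\<close> at its last vertex. Contracting the first edge
  keeps all four while more than one edge is left between them.\<close>

lemma H_tree_is_minor:
  assumes "simple_graph G" "distinct (a # b # c # d # xs)" "length xs \<ge> 2" "set (a # b # c # d # xs) \<subseteq> pverts G"
    "successively (\<lambda>x y. (x, y) \<in> parcs G) xs" "(hd xs, a) \<in> parcs G" "(hd xs, b) \<in> parcs G"
    "(last xs, c) \<in> parcs G" "(last xs, d) \<in> parcs G"
  shows "is_minor H_tree G"
  using assms
proof (induction xs arbitrary: G rule: length_induct)
  case (1 xs)
  show ?case
  proof (cases "length xs = 2")
    case True
    then obtain u v where "xs = [u, v]" by (auto simp: length_Suc_conv numeral_eq_Suc)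
    then show ?thesis
      unfolding H_tree_def using 1(2-) by (intro list_embedding_is_minor[where xs = "[u, v, a, b, c, d]"]) auto
  next
    case False
    then have "length xs \<ge> 3" using 1 by simp
    then obtain u v w es where xs: "xs = u # v # w # es"
      by (auto simp: Suc_le_length_iff numeral_eq_Suc)
    have uv: "(u, v) \<in> parcs G" and vw: "(v, w) \<in> parcs G" using 1 xs by auto
    let ?G = "contract_edge u v G"
    note C = contract_edge_parcs[OF 1(2) uv]
    have keep: "(x, y) \<in> parcs ?G" if "x \<noteq> v" "y \<noteq> v" "(x, y) \<in> parcs G" for x y
      using that simple_graphD(5)[OF 1(2) that(3)] unfolding C(2) by auto
    have suc: "successively (\<lambda>x y. (x, y) \<in> parcs ?G) (w # es)"
    proof (rule successively_mono)
      show "successively (\<lambda>x y. (x, y) \<in> parcs G) (w # es)" using 1 xs by simp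
      show "(x, y) \<in> parcs ?G" if "x \<in> set (w # es)" "y \<in> set (w # es)" "(x, y) \<in> parcs G" for x y
        using that 1(3) xs by (intro keep) auto
    qed
    have lv: "last (w # es) \<noteq> v" using 1(3) xs by (metis distinct.simps(2) last_in_set list.discI list.set_intros(2) distinct_length_2_or_more)
    have "is_minor H_tree ?G"
    proof (rule 1(1)[rule_format, of "u # w # es"])
      show "length (u # w # es) < length xs" using xs by simp
      show "simple_graph ?G" by (rule simple_graph_contract_edge[OF 1(2) uv])
      show "2 \<le> length (u # w # es)" by simp
      show "distinct (a # b # c # d # u # w # es)" using 1 xs by auto
      show "set (a # b # c # d # u # w # es) \<subseteq> pverts ?G" using 1 xs unfolding C(1) by auto
      have "(u, w) \<in> parcs ?G" using vw 1(3) xs unfolding C(2) by auto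
      then show "successively (\<lambda>x y. (x, y) \<in> parcs ?G) (u # w # es)" using suc by simp
      show "(hd (u # w # es), a) \<in> parcs ?G" "(hd (u # w # es), b) \<in> parcs ?G"
        using 1 xs by (auto intro!: keep)
      show "(last (u # w # es), c) \<in> parcs ?G" "(last (u # w # es), d) \<in> parcs ?G"
        using 1 xs lv by (auto intro!: keep split: if_splits)
    qed
    then show ?thesis using is_minor_step[OF edge_contraction[OF uv]] by blast
  qed
qed

section \<open>Multiple eigenvalues of paths and stars\<close>

lemma eigvecD: "eigvec V A l x \<Longrightarrow> i \<in> V \<Longrightarrow> (\<Sum>k\<in>V. A i k * x k) = l * x i"
  by (simp add: eigvec_def)

text \<open>On the span of two independent eigenvectors, \<open>z v = 0\<close> is a single linear
  equation.\<close>

lemma mult2_vanishing: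
  assumes "mult2 V A l"
  obtains z where "eigvec V A l z" "z v = 0" "\<exists>i\<in>V. z i \<noteq> 0"
proof -
  obtain x y where x: "eigvec V A l x" and y: "eigvec V A l y"
    and ind: "\<And>a b. \<forall>i\<in>V. a * x i + b * y i = 0 \<Longrightarrow> a = 0 \<and> b = 0"
    using assms unfolding mult2_def by blast
  show ?thesis
  proof (cases "x v = 0")
    case True
    have "\<exists>i\<in>V. x i \<noteq> 0" using ind[of 1 0] by auto
    with True x that show ?thesis by blast
  next
    case False
    define z where "z i = y v * x i - x v * y i" for i
    have "eigvec V A l z"
      using x y by (simp add: eigvec_def z_def right_diff_distrib sum_subtractf mult.left_commute[of _ "y v"]
          mult.left_commute[of _ "x v"] flip: sum_distrib_left)
    moreover have "z v = 0" by (simp add: z_def)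
    moreover have "\<exists>i\<in>V. z i \<noteq> 0" using ind[of "y v" "- x v"] False by (auto simp: z_def)
    ultimately show ?thesis using that by blast
  qed
qed

text \<open>Reading the eigenvector equation along a path: each row determines the next entry.\<close>

lemma propagate:
  fixes a :: "nat \<Rightarrow> nat \<Rightarrow> real"
  assumes row: "\<And>i. s \<le> i \<Longrightarrow> i < t \<Longrightarrow> (\<Sum>j<m. a i j * y j) = l * y i"
    and nz: "\<And>i. s \<le> i \<Longrightarrow> i < t \<Longrightarrow> a i (Suc i) \<noteq> 0"
    and z: "\<And>i j. s \<le> i \<Longrightarrow> i < t \<Longrightarrow> Suc i < j \<Longrightarrow> j < m \<Longrightarrow> a i j = 0"
    and t: "t < m" and y: "\<And>j. j \<le> s \<Longrightarrow> y j = 0"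
  shows "j \<le> t \<Longrightarrow> y j = 0"
proof (induction j rule: less_induct)
  case (less j)
  show ?case
  proof (cases "j \<le> s")
    case False
    then obtain i where i: "j = Suc i" "s \<le> i" by (cases j) auto
    have it: "i < t" using less.prems i by simp
    have "(\<Sum>k<m. a i k * y k) = (\<Sum>k\<in>{j}. a i k * y k)"
    proof (rule sum.mono_neutral_right)
      show "\<forall>k\<in>{..<m} - {j}. a i k * y k = 0"
      proof
        fix k assume k: "k \<in> {..<m} - {j}"
        show "a i k * y k = 0"
        proof (cases "k < j")
          case True
          then show ?thesis using less.IH[of k] less.prems by simp
        next
          case False
          then have "Suc i < k" using k i by auto
          then show ?thesis using z[OF i(2) it, of k] k by simp
        qed
      qed
    qed (use less.prems t in auto)
    then have "a i j * y j = 0" using row[OF i(2) it] less.IH[of i] less.prems i it by simp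
    then show ?thesis using nz[OF i(2) it] i by simp
  qed (use y in simp)
qed

text \<open>An eigenvector vanishing at the end \<open>p 0\<close> would be zero along the whole
  path.\<close>

lemma path_no_mult2:
  assumes b: "bij_betw p {..<m} W"
    and nz: "\<And>i. Suc i < m \<Longrightarrow> A (p i) (p (Suc i)) \<noteq> 0"
    and z: "\<And>i j. Suc i < j \<Longrightarrow> j < m \<Longrightarrow> A (p i) (p j) = 0"
  shows "\<not> mult2 W A l"
proof
  assume m2: "mult2 W A l"
  obtain x where x: "eigvec W A l x" "x (p 0) = 0" "\<exists>i\<in>W. x i \<noteq> 0"
    using mult2_vanishing[OF m2] by blast
  have W: "W = p ` {..<m}" using b by (simp add: bij_betw_def)
  have m: "m > 0" using x(3) W by auto
  have s: "(\<Sum>k\<in>W. g k) = (\<Sum>j<m. g (p j))" for g :: "_ \<Rightarrow> real"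
    using sum.reindex_bij_betw[OF b, of g] by simp
  have row: "(\<Sum>j<m. A (p i) (p j) * x (p j)) = l * x (p i)" if "i < m" for i
    using eigvecD[OF x(1), of "p i"] that W unfolding s by simp
  have "x (p j) = 0" if "j \<le> m - 1" for j
    by (rule propagate[where s = 0 and t = "m - 1" and m = m and a = "\<lambda>i j. A (p i) (p j)" and y = "\<lambda>j. x (p j)" and l = l])
      (use that row nz z m x(2) in auto)
  then show False using x(3) W by force
qed

text \<open>An eigenvector vanishing at \<open>p 0\<close> vanishes up to the start
  \<open>p k\<close> of the chord. Row \<open>k\<close> then fixes the ratio of the next two
  entries, and row \<open>k + 1\<close> expresses the eigenvalue by entries of \<open>A\<close>
  alone.\<close>

lemma path_chord_mult2_unique:
  assumes b: "bij_betw p {..<m} W" and symA: "sym_on W A"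
    and nz: "\<And>i. Suc i < m \<Longrightarrow> A (p i) (p (Suc i)) \<noteq> 0"
    and z: "\<And>i j. Suc i < j \<Longrightarrow> j < m \<Longrightarrow> A (p i) (p j) \<noteq> 0 \<Longrightarrow> i = k \<and> j = k + 2"
    and l: "mult2 W A l" and l': "mult2 W A l'"
  shows "l = l'"
proof -
  have W: "W = p ` {..<m}" using b by (simp add: bij_betw_def)
  have s: "(\<Sum>k\<in>W. g k) = (\<Sum>j<m. g (p j))" for g :: "_ \<Rightarrow> real"
    using sum.reindex_bij_betw[OF b, of g] by simp
  have chord: "k + 2 < m \<and> A (p k) (p (k + 2)) \<noteq> 0"
  proof (rule ccontr)
    assume n: "\<not> ?thesis"
    have "\<not> mult2 W A l"
      by (rule path_no_mult2[OF b]) (use nz z n in blast)+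
    with l show False by blast
  qed
  have val: "l = A (p (k + 1)) (p (k + 1)) - A (p (k + 1)) (p (k + 2)) * A (p k) (p (k + 1)) / A (p k) (p (k + 2))"
    if m2: "mult2 W A l" for l
  proof -
    obtain x where x: "eigvec W A l x" "x (p 0) = 0" "\<exists>i\<in>W. x i \<noteq> 0"
      using mult2_vanishing[OF m2] by blast
    have row: "(\<Sum>j<m. A (p i) (p j) * x (p j)) = l * x (p i)" if "i < m" for i
      using eigvecD[OF x(1), of "p i"] that W unfolding s by simp
    have y0: "x (p j) = 0" if "j \<le> k" for j
      by (rule propagate[where s = 0 and t = k and m = m and a = "\<lambda>i j. A (p i) (p j)" and y = "\<lambda>j. x (p j)" and l = l])
        (use that row nz z chord x(2) in force)+
    have split: "(\<Sum>j<m. A (p i) (p j) * x (p j)) = A (p i) (p (k+1)) * x (p (k+1)) + A (p i) (p (k+2)) * x (p (k+2))"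
      if "i \<le> k + 1" for i
    proof -
      have "(\<Sum>j<m. A (p i) (p j) * x (p j)) = (\<Sum>j\<in>{k+1, k+2}. A (p i) (p j) * x (p j))"
      proof (rule sum.mono_neutral_right)
        show "\<forall>j\<in>{..<m} - {k + 1, k + 2}. A (p i) (p j) * x (p j) = 0"
        proof
          fix j assume j: "j \<in> {..<m} - {k + 1, k + 2}"
          show "A (p i) (p j) * x (p j) = 0"
          proof (cases "j \<le> k")
            case False
            then have "A (p i) (p j) = 0" using z[of i j] j that by auto
            then show ?thesis by simp
          qed (simp add: y0)
        qed
      qed (use chord in auto)
      then show ?thesis by simp
    qed
    have rk: "A (p k) (p (k+1)) * x (p (k+1)) + A (p k) (p (k+2)) * x (p (k+2)) = 0"
      using row[of k] split[of k] chord y0 by simp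
    have rk1: "A (p (k+1)) (p (k+1)) * x (p (k+1)) + A (p (k+1)) (p (k+2)) * x (p (k+2)) = l * x (p (k+1))"
      using row[of "k+1"] split[of "k+1"] chord by simp
    have nz1: "x (p (k+1)) \<noteq> 0"
    proof
      assume 0: "x (p (k+1)) = 0"
      have "x (p j) = 0" if "j \<le> m - 1" for j
      proof (rule propagate[where s = "k + 1" and t = "m - 1" and m = m and a = "\<lambda>i j. A (p i) (p j)" and y = "\<lambda>j. x (p j)" and l = l])
        show "x (p j) = 0" if "j \<le> k + 1" for j using y0[of j] 0 that by (cases "j = k + 1") auto
        show "A (p i) (p j) = 0" if "k + 1 \<le> i" "Suc i < j" "j < m" for i j using z[of i j] that by force
      qed (use that row nz chord in auto)
      then show False using x(3) W by force
    qed
    have c2: "A (p k) (p (k+2)) \<noteq> 0" using chord by blast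
    have x2: "x (p (k+2)) = - A (p k) (p (k+1)) * x (p (k+1)) / A (p k) (p (k+2))"
      using rk c2 by (simp add: field_simps)
    have "(A (p (k + 1)) (p (k + 1)) - A (p (k + 1)) (p (k + 2)) * A (p k) (p (k + 1)) / A (p k) (p (k + 2)) - l) * x (p (k + 1)) = 0"
      using rk1 unfolding x2 by (simp add: algebra_simps)
    then show ?thesis using nz1 by simp
  qed
  show ?thesis using val[OF l] val[OF l'] by simp
qed

text \<open>The eigenvector vanishes from \<open>p 0\<close> up to the attachment vertex
  \<open>p o'\<close>, so the row of \<open>c\<close> reads \<open>A c c * x c = l * x c\<close>. If
  \<open>x c\<close> were 0, the zeros would propagate beyond \<open>p o'\<close> to the other
  end.\<close>

lemma pendant_mult2_value:
  assumes b: "bij_betw p {..<m} P" and c: "c \<notin> P" and W: "W = insert c P"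
    and nz: "\<And>i. Suc i < m \<Longrightarrow> A (p i) (p (Suc i)) \<noteq> 0"
    and z: "\<And>i j. Suc i < j \<Longrightarrow> j < m \<Longrightarrow> A (p i) (p j) = 0"
    and o: "o' < m" and zc: "\<And>i. i < m \<Longrightarrow> i \<noteq> o' \<Longrightarrow> A (p i) c = 0 \<and> A c (p i) = 0"
    and l: "mult2 W A l"
  shows "l = A c c"
proof -
  have P: "P = p ` {..<m}" using b by (simp add: bij_betw_def)
  have fP: "finite P" by (simp add: P)
  have s: "(\<Sum>k\<in>W. g k) = g c + (\<Sum>j<m. g (p j))" for g :: "_ \<Rightarrow> real"
    using sum.reindex_bij_betw[OF b, of g] fP c by (simp add: W)
  obtain x where x: "eigvec W A l x" "x (p 0) = 0" "\<exists>i\<in>W. x i \<noteq> 0"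
    using mult2_vanishing[OF l] by blast
  have row: "A (p i) c * x c + (\<Sum>j<m. A (p i) (p j) * x (p j)) = l * x (p i)" if "i < m" for i
    using eigvecD[OF x(1), of "p i"] that W P unfolding s by simp
  have rowc: "A c c * x c + (\<Sum>j<m. A c (p j) * x (p j)) = l * x c"
    using eigvecD[OF x(1), of c] W unfolding s by simp
  have y0: "x (p j) = 0" if "j \<le> o'" for j
  proof (rule propagate[where s = 0 and t = o' and m = m and a = "\<lambda>i j. A (p i) (p j)" and y = "\<lambda>j. x (p j)" and l = l])
    show "(\<Sum>j<m. A (p i) (p j) * x (p j)) = l * x (p i)" if "i < o'" for i
      using row[of i] zc[of i] o that by simp
  qed (use that nz z o x(2) in auto)
  have "(\<Sum>j<m. A c (p j) * x (p j)) = 0"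
    by (rule sum.neutral) (use zc y0 in force)
  then have *: "A c c * x c = l * x c" using rowc by simp
  have "x c \<noteq> 0"
  proof
    assume 0: "x c = 0"
    have "x (p j) = 0" if "j \<le> m - 1" for j
      by (rule propagate[where s = o' and t = "m - 1" and m = m and a = "\<lambda>i j. A (p i) (p j)" and y = "\<lambda>j. x (p j)" and l = l])
        (use that row nz z o y0 0 in auto)
    then show False using x(3) 0 unfolding W P by force
  qed
  with * show ?thesis by simp
qed

text \<open>For an eigenvector supported on leaves at \<open>v\<close>, the row of a leaf in the
  support shows that its diagonal entry is \<open>l\<close>, and the row of \<open>v\<close> rules
  out a support of one leaf.\<close>

lemma two_leaves:
  assumes fL: "finite L" and L: "L \<subseteq> W" and o: "v \<in> W" "v \<notin> L" and fW: "finite W"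
    and leaf: "\<And>i j. i \<in> L \<Longrightarrow> j \<in> W \<Longrightarrow> i \<noteq> j \<Longrightarrow> j \<noteq> v \<Longrightarrow> A i j = 0"
    and nz: "\<And>i. i \<in> L \<Longrightarrow> A v i \<noteq> 0"
    and x: "eigvec W A l x" and x0: "\<And>i. i \<in> W \<Longrightarrow> i \<notin> L \<Longrightarrow> x i = 0" and ne: "\<exists>i\<in>W. x i \<noteq> 0"
  shows "\<exists>i\<in>L. \<exists>j\<in>L. i \<noteq> j \<and> x i \<noteq> 0 \<and> x j \<noteq> 0 \<and> A i i = l \<and> A j j = l"
proof -
  have row: "A i i = l" if i: "i \<in> L" "x i \<noteq> 0" for i
  proof -
    have "(\<Sum>k\<in>W. A i k * x k) = (\<Sum>k\<in>{i}. A i k * x k)"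
      by (rule sum.mono_neutral_right) (use fW L i leaf x0 o in auto)
    then show ?thesis using x i L unfolding eigvec_def by auto
  qed
  obtain i where i: "i \<in> L" "x i \<noteq> 0" using ne x0 by blast
  have "\<exists>j\<in>L. j \<noteq> i \<and> x j \<noteq> 0"
  proof (rule ccontr)
    assume n: "\<not> ?thesis"
    have "(\<Sum>k\<in>W. A v k * x k) = (\<Sum>k\<in>{i}. A v k * x k)"
      by (rule sum.mono_neutral_right) (use fW L i n x0 in auto)
    moreover have "(\<Sum>k\<in>W. A v k * x k) = 0" using x x0 o unfolding eigvec_def by auto
    ultimately show False using nz[OF i(1)] i(2) by simp
  qed
  then obtain j where "j \<in> L" "j \<noteq> i" "x j \<noteq> 0" by blast
  with i row show ?thesis by blast
qed

text \<open>Zeros propagate along the handle \<open>q\<close> up to \<open>q t\<close>, so each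
  multiple eigenvalue occurs at least twice among the diagonal entries of the three leaves; two
  eigenvalues would need four leaves.\<close>

lemma broom_mult2_unique:
  assumes b: "bij_betw q {..<Suc t} P" and L: "finite L" "card L = 3" "L \<inter> P = {}" and W: "W = L \<union> P"
    and leaf: "\<And>i j. i \<in> L \<Longrightarrow> j \<in> W \<Longrightarrow> i \<noteq> j \<Longrightarrow> j \<noteq> q t \<Longrightarrow> A i j = 0 \<and> A j i = 0"
    and lnz: "\<And>i. i \<in> L \<Longrightarrow> A (q t) i \<noteq> 0"
    and nz: "\<And>i. Suc i < Suc t \<Longrightarrow> A (q i) (q (Suc i)) \<noteq> 0"
    and z: "\<And>i j. Suc i < j \<Longrightarrow> j < Suc t \<Longrightarrow> A (q i) (q j) = 0"
    and l: "mult2 W A l" and l': "mult2 W A l'"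
  shows "l = l'"
proof (rule ccontr)
  assume ne: "l \<noteq> l'"
  have P: "P = q ` {..<Suc t}" using b by (simp add: bij_betw_def)
  have fP: "finite P" by (simp add: P)
  have qt: "q t \<in> P" by (simp add: P)
  have s: "(\<Sum>k\<in>W. g k) = (\<Sum>k\<in>L. g k) + (\<Sum>j<Suc t. g (q j))" for g :: "_ \<Rightarrow> real"
    using sum.union_disjoint[OF L(1) fP L(3), of g] sum.reindex_bij_betw[OF b, of g] W by simp
  have two: "2 \<le> card {i\<in>L. A i i = l}" if m2: "mult2 W A l" for l
  proof -
    obtain x where x: "eigvec W A l x" "x (q 0) = 0" "\<exists>i\<in>W. x i \<noteq> 0"
      using mult2_vanishing[OF m2] by blast
    have row: "(\<Sum>j<Suc t. A (q i) (q j) * x (q j)) = l * x (q i)" if "i < t" for i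
    proof -
      have "q i \<noteq> q t" using b that by (auto simp: bij_betw_def inj_on_def)
      then have "(\<Sum>k\<in>L. A (q i) k * x k) = 0"
        using that L(3) by (intro sum.neutral) (use leaf[of _ "q i"] W P in force)
      moreover have "q i \<in> W" using that W P by auto
      ultimately show ?thesis using eigvecD[OF x(1), of "q i"] unfolding s by simp
    qed
    have y0: "x (q j) = 0" if "j \<le> t" for j
      by (rule propagate[where s = 0 and t = t and m = "Suc t" and a = "\<lambda>i j. A (q i) (q j)" and y = "\<lambda>j. x (q j)" and l = l])
        (use that row nz z x(2) in auto)
    have x0: "x i = 0" if "i \<in> W" "i \<notin> L" for i using that y0 W P by auto
    have "\<exists>i\<in>L. \<exists>j\<in>L. i \<noteq> j \<and> x i \<noteq> 0 \<and> x j \<noteq> 0 \<and> A i i = l \<and> A j j = l"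
    proof (rule two_leaves[OF L(1) _ _ _ _ _ _ x(1) x0 x(3)])
      show "A i j = 0" if "i \<in> L" "j \<in> W" "i \<noteq> j" "j \<noteq> q t" for i j using leaf[OF that] ..
      show "q t \<notin> L" using qt L(3) by blast
    qed (use L W qt fP lnz in auto)
    then obtain i j where ij: "i \<in> L" "j \<in> L" "i \<noteq> j" "A i i = l" "A j j = l" by blast
    then have "card {i, j} \<le> card {i\<in>L. A i i = l}" using L(1) by (intro card_mono) auto
    then show ?thesis using ij by simp
  qed
  have "card {i\<in>L. A i i = l} + card {i\<in>L. A i i = l'} = card ({i\<in>L. A i i = l} \<union> {i\<in>L. A i i = l'})"
    using L(1) ne by (subst card_Un_disjoint) auto
  also have "\<dots> \<le> card L" using L(1) by (intro card_mono) auto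
  finally show False using two[OF l] two[OF l'] L(2) by simp
qed

text \<open>Each multiple eigenvalue is the diagonal entry of at least three leaves, so two
  eigenvalues would need six. The third leaf comes from an eigenvector that vanishes at a leaf
  \<open>i\<close> already found: the row of \<open>i\<close> makes it vanish at \<open>v\<close> as
  well, and its support contains two leaves other than \<open>i\<close>.\<close>

lemma star_mult2_unique:
  assumes L: "finite L" "card L = 5" "v \<notin> L" and W: "W = insert v L"
    and leaf: "\<And>i j. i \<in> L \<Longrightarrow> j \<in> L \<Longrightarrow> i \<noteq> j \<Longrightarrow> A i j = 0"
    and lnz: "\<And>i. i \<in> L \<Longrightarrow> A v i \<noteq> 0 \<and> A i v \<noteq> 0"
    and l: "mult2 W A l" and l': "mult2 W A l'"
  shows "l = l'"
proof (rule ccontr)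
  assume ne: "l \<noteq> l'"
  have two: "\<exists>i\<in>L. \<exists>j\<in>L. i \<noteq> j \<and> x i \<noteq> 0 \<and> x j \<noteq> 0 \<and> A i i = l \<and> A j j = l"
    if x: "eigvec W A l x" "\<exists>i\<in>W. x i \<noteq> 0" "x v = 0" for x l
  proof -
    have x0: "x i = 0" if "i \<in> W" "i \<notin> L" for i using that x W by auto
    have lf: "A i j = 0" if "i \<in> L" "j \<in> W" "i \<noteq> j" "j \<noteq> v" for i j using leaf that W by auto
    have fW: "finite W" using W L by simp
    show ?thesis
    proof (rule two_leaves[OF L(1) _ _ L(3) fW lf _ x(1) x0 x(2)])
    qed (use W lnz in auto)
  qed
  have three: "3 \<le> card {i\<in>L. A i i = l}" if m2: "mult2 W A l" for l
  proof -
    obtain x where x: "eigvec W A l x" "x v = 0" "\<exists>i\<in>W. x i \<noteq> 0"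
      using mult2_vanishing[OF m2] by blast
    obtain i where i: "i \<in> L" "A i i = l" using two[OF x(1,3,2)] by blast
    obtain y where y: "eigvec W A l y" "y i = 0" "\<exists>i\<in>W. y i \<noteq> 0"
      using mult2_vanishing[OF m2] by blast
    have "(\<Sum>k\<in>W. A i k * y k) = (\<Sum>k\<in>{v}. A i k * y k)"
      by (rule sum.mono_neutral_right) (use i y leaf W L in auto)
    then have "A i v * y v = 0" using y i W unfolding eigvec_def by auto
    then have "y v = 0" using lnz[OF i(1)] by simp
    then obtain j k where jk: "j \<in> L" "k \<in> L" "j \<noteq> k" "y j \<noteq> 0" "y k \<noteq> 0" "A j j = l" "A k k = l"
      using two[OF y(1,3)] by blast
    have "i \<noteq> j" "i \<noteq> k" using jk y(2) by auto
    then have "card {i, j, k} = 3" using jk by simp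
    moreover have "card {i, j, k} \<le> card {i\<in>L. A i i = l}" using L(1) i jk by (intro card_mono) auto
    ultimately show ?thesis by simp
  qed
  have "card {i\<in>L. A i i = l} + card {i\<in>L. A i i = l'} = card ({i\<in>L. A i i = l} \<union> {i\<in>L. A i i = l'})"
    using L(1) ne by (subst card_Un_disjoint) auto
  also have "\<dots> \<le> card L" using L(1) by (intro card_mono) auto
  finally show False using three[OF l] three[OF l'] L(2) by simp
qed

section \<open>Longest paths in graphs without the eleven minors\<close>

lemma minor_family_edges:
  "graph_of_edges 5 {(0, 1), (0, 2), (1, 2), (0, 3), (0, 4)} \<in> minor_family"
  "graph_of_edges 6 {(0, 1), (0, 2), (1, 2), (0, 3), (1, 4), (2, 5)} \<in> minor_family"
  "graph_of_edges 7 {(0, 1), (0, 2), (0, 3), (0, 4), (0, 5), (0, 6)} \<in> minor_family"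
  "graph_of_edges 7 {(0, 1), (1, 2), (0, 3), (0, 4), (0, 5), (0, 6)} \<in> minor_family"
  "graph_of_edges 7 {(0, 1), (1, 2), (0, 3), (3, 4), (0, 5), (0, 6)} \<in> minor_family"
  "graph_of_edges 7 {(0, 1), (1, 2), (0, 3), (3, 4), (0, 5), (5, 6)} \<in> minor_family"
  unfolding minor_family_def campstool_def[symmetric] three_sun_def[symmetric] complete_bipartite_1_6_edges[symmetric]
    spider_21111_edges[symmetric] spider_2211_edges[symmetric] spider_222_edges[symmetric]
  by blast+

text \<open>\<open>W\<close> will be a connected component, whereas the excluded minors refer to all
  of \<open>G\<close>; thus configurations in two parts of the same graph can be combined.\<close>

locale minor_free_part =
  fixes G :: "nat pair_pre_digraph" and W :: "nat set"
  assumes sG: "simple_graph G" and WV: "W \<subseteq> pverts G"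
    and mf: "\<And>H. H \<in> minor_family \<Longrightarrow> \<not> is_minor H G"
begin

abbreviation adj :: "nat \<Rightarrow> nat \<Rightarrow> bool" where
  "adj x y \<equiv> (x, y) \<in> parcs G"

lemma adj_sym: "adj x y \<Longrightarrow> adj y x"
  using simple_graphD(4)[OF sG] .

lemma adj_neq: "adj x y \<Longrightarrow> x \<noteq> y"
  using simple_graphD(5)[OF sG] .

lemma finite_W: "finite W"
  using WV simple_graphD(1)[OF sG] finite_subset by blast

lemma no_cycle:
  "distinct ys \<Longrightarrow> set ys \<subseteq> W \<Longrightarrow> length ys \<ge> 4 \<Longrightarrow> successively adj ys \<Longrightarrow> adj (last ys) (hd ys) \<Longrightarrow> False"
  using cycle_is_minor[OF sG] mf[of "cycle_graph 4"] WV by (auto simp: minor_family_def)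

lemma no_H_tree:
  assumes "distinct (a # b # c # d # ys)" "set (a # b # c # d # ys) \<subseteq> W" "length ys \<ge> 2" "successively adj ys"
    "adj (hd ys) a" "adj (hd ys) b" "adj (last ys) c" "adj (last ys) d"
  shows False
  using H_tree_is_minor[OF sG assms(1,3) _ assms(4-)] mf[of H_tree] assms(2) WV by (auto simp: minor_family_def)

lemma no_embedding:
  assumes "graph_of_edges k E \<in> minor_family" "\<forall>(i, j)\<in>E. i < k \<and> j < k \<and> i \<noteq> j"
    "distinct ys" "length ys = k" "set ys \<subseteq> W" "\<forall>(i, j)\<in>E. adj (ys ! i) (ys ! j)"
  shows False
  using list_embedding_is_minor[OF sG assms(2,3,4) _ assms(6)] mf[OF assms(1)] assms(5) WV by auto

lemma no_campstool:
  assumes "distinct [a, b, c, d, e]" "set [a, b, c, d, e] \<subseteq> W" "adj a b" "adj a c" "adj b c" "adj a d" "adj a e"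
  shows False
  by (rule no_embedding[OF minor_family_edges(1) _ assms(1) _ assms(2)]) (use assms(3-) in simp_all)

lemma no_three_sun:
  assumes "distinct [a, b, c, d, e, f]" "set [a, b, c, d, e, f] \<subseteq> W"
    "adj a b" "adj a c" "adj b c" "adj a d" "adj b e" "adj c f"
  shows False
  by (rule no_embedding[OF minor_family_edges(2) _ assms(1) _ assms(2)]) (use assms(3-) in simp_all)

lemma no_star_6:
  assumes "distinct [v, a, b, c, d, e, f]" "set [v, a, b, c, d, e, f] \<subseteq> W"
    "adj v a" "adj v b" "adj v c" "adj v d" "adj v e" "adj v f"
  shows False
  by (rule no_embedding[OF minor_family_edges(3) _ assms(1) _ assms(2)]) (use assms(3-) in simp_all)

lemma no_spider_21111:
  assumes "distinct [v, a, a', b, c, d, e]" "set [v, a, a', b, c, d, e] \<subseteq> W"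
    "adj v a" "adj a a'" "adj v b" "adj v c" "adj v d" "adj v e"
  shows False
  by (rule no_embedding[OF minor_family_edges(4) _ assms(1) _ assms(2)]) (use assms(3-) in simp_all)

lemma no_spider_2211:
  assumes "distinct [v, a, a', b, b', c, d]" "set [v, a, a', b, b', c, d] \<subseteq> W"
    "adj v a" "adj a a'" "adj v b" "adj b b'" "adj v c" "adj v d"
  shows False
  by (rule no_embedding[OF minor_family_edges(5) _ assms(1) _ assms(2)]) (use assms(3-) in simp_all)

lemma no_spider_222:
  assumes "distinct [v, a, a', b, b', c, c']" "set [v, a, a', b, b', c, c'] \<subseteq> W"
    "adj v a" "adj a a'" "adj v b" "adj b b'" "adj v c" "adj c c'"
  shows False
  by (rule no_embedding[OF minor_family_edges(6) _ assms(1) _ assms(2)]) (use assms(3-) in simp_all)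

text \<open>A triangle or a claw; the centre of the claw comes first.\<close>

definition branching :: "nat list \<Rightarrow> bool" where
  "branching xs \<longleftrightarrow> distinct xs \<and> set xs \<subseteq> W \<and>
    ((length xs = 3 \<and> adj (xs ! 0) (xs ! 1) \<and> adj (xs ! 0) (xs ! 2) \<and> adj (xs ! 1) (xs ! 2)) \<or>
     (length xs = 4 \<and> adj (xs ! 0) (xs ! 1) \<and> adj (xs ! 0) (xs ! 2) \<and> adj (xs ! 0) (xs ! 3)))"

lemma branching_triangle: "distinct [a, b, c] \<Longrightarrow> set [a, b, c] \<subseteq> W \<Longrightarrow> adj a b \<Longrightarrow> adj a c \<Longrightarrow> adj b c \<Longrightarrow> branching [a, b, c]"
  and branching_claw: "distinct [v, a, b, c] \<Longrightarrow> set [v, a, b, c] \<subseteq> W \<Longrightarrow> adj v a \<Longrightarrow> adj v b \<Longrightarrow> adj v c \<Longrightarrow> branching [v, a, b, c]"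
  by (simp_all add: branching_def numeral_2_eq_2 numeral_3_eq_3)

end

text \<open>\<open>W\<close> and \<open>W'\<close> may coincide: this serves both for two components
  and for two places along one path.\<close>

lemma no_disjoint_branching:
  assumes "minor_free_part G W" "minor_free_part G W'"
    and "minor_free_part.branching G W xs" "minor_free_part.branching G W' ys" "set xs \<inter> set ys = {}"
  shows False
proof -
  interpret minor_free_part G W by fact
  interpret W': minor_free_part G W' by fact
  have U: "\<not> is_minor (disjoint_union (complete_graph 3) (complete_graph 3)) G"
    "\<not> is_minor (disjoint_union (complete_graph 3) (complete_bipartite 1 3)) G"
    "\<not> is_minor (disjoint_union (complete_bipartite 1 3) (complete_bipartite 1 3)) G"
    by (rule mf; simp add: minor_family_def)+
  let ?T = "{(0, 1), (0, 2), (1, 2)} :: (nat \<times> nat) set" and ?C = "{(0, 1), (0, 2), (0, 3)} :: (nat \<times> nat) set"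
  have k: "\<forall>(i, j)\<in>?T. i < 3 \<and> j < 3 \<and> i \<noteq> j" "\<forall>(i, j)\<in>?C. i < 4 \<and> j < 4 \<and> i \<noteq> j" by auto
  have V: "set (xs @ ys) \<subseteq> pverts G" "set (ys @ xs) \<subseteq> pverts G" "distinct (xs @ ys)" "distinct (ys @ xs)"
    using assms(3-) WV W'.WV unfolding branching_def W'.branching_def by auto
  have x: "(length xs = 3 \<and> (\<forall>(i, j)\<in>?T. adj (xs ! i) (xs ! j))) \<or> (length xs = 4 \<and> (\<forall>(i, j)\<in>?C. adj (xs ! i) (xs ! j)))"
    using assms(3) unfolding branching_def by auto
  have y: "(length ys = 3 \<and> (\<forall>(i, j)\<in>?T. adj (ys ! i) (ys ! j))) \<or> (length ys = 4 \<and> (\<forall>(i, j)\<in>?C. adj (ys ! i) (ys ! j)))"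
    using assms(4) unfolding W'.branching_def by auto
  note e = list_embedding_union_is_minor[OF sG]
  show False
    using x y
  proof (elim disjE conjE)
    assume "length xs = 3" "\<forall>(i, j)\<in>?T. adj (xs ! i) (xs ! j)" "length ys = 3" "\<forall>(i, j)\<in>?T. adj (ys ! i) (ys ! j)"
    then show False using e[OF k(1) k(1) V(3) _ _ V(1)] U(1) by (simp add: complete_graph_3_edges)
  next
    assume "length xs = 3" "\<forall>(i, j)\<in>?T. adj (xs ! i) (xs ! j)" "length ys = 4" "\<forall>(i, j)\<in>?C. adj (ys ! i) (ys ! j)"
    then show False using e[OF k(1) k(2) V(3) _ _ V(1)] U(2) unfolding complete_graph_3_edges complete_bipartite_1_3_edges by blast
  next
    assume "length xs = 4" "\<forall>(i, j)\<in>?C. adj (xs ! i) (xs ! j)" "length ys = 3" "\<forall>(i, j)\<in>?T. adj (ys ! i) (ys ! j)"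
    then show False using e[OF k(1) k(2) V(4) _ _ V(2)] U(2) unfolding complete_graph_3_edges complete_bipartite_1_3_edges by blast
  next
    assume "length xs = 4" "\<forall>(i, j)\<in>?C. adj (xs ! i) (xs ! j)" "length ys = 4" "\<forall>(i, j)\<in>?C. adj (ys ! i) (ys ! j)"
    then show False using e[OF k(2) k(2) V(3) _ _ V(1)] U(3) unfolding complete_graph_3_edges complete_bipartite_1_3_edges by blast
  qed
qed

section \<open>Structure of a connected part around a longest path\<close>

locale longest_path = minor_free_part +
  fixes xs :: "nat list"
  assumes conn: "\<And>x y. x \<in> W \<Longrightarrow> y \<in> W \<Longrightarrow> (x, y) \<in> (parcs G \<inter> W \<times> W)\<^sup>*"
    and dist: "distinct xs" and sub: "set xs \<subseteq> W" and path: "successively adj xs" and ne: "xs \<noteq> []"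
    and longest: "\<And>ys. distinct ys \<Longrightarrow> set ys \<subseteq> W \<Longrightarrow> successively adj ys \<Longrightarrow> length ys \<le> length xs"
begin

abbreviation p :: "nat \<Rightarrow> nat" where "p i \<equiv> xs ! i"
abbreviation m :: nat where "m \<equiv> length xs"

lemma p_in: "i < m \<Longrightarrow> p i \<in> W" using sub by auto

lemma p_eq: "i < m \<Longrightarrow> j < m \<Longrightarrow> p i = p j \<longleftrightarrow> i = j" using dist by (simp add: nth_eq_iff_index_eq)

lemma p_out: "c \<notin> set xs \<Longrightarrow> i < m \<Longrightarrow> p i \<noteq> c" by auto

lemma step: "Suc i < m \<Longrightarrow> adj (p i) (p (Suc i))" using path by (simp add: successively_conv_nth)

lemma step': "Suc i < m \<Longrightarrow> adj (p (Suc i)) (p i)" using step adj_sym by blast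

definition seg :: "nat \<Rightarrow> nat \<Rightarrow> nat list" where "seg i j = map p [i..<Suc j]"

lemma seg:
  assumes "i \<le> j" "j < m"
  shows "distinct (seg i j)" "set (seg i j) = p ` {i..j}" "set (seg i j) \<subseteq> W" "length (seg i j) = Suc j - i"
    "successively adj (seg i j)" "hd (seg i j) = p i" "last (seg i j) = p j" "seg i j \<noteq> []"
proof -
  show s: "set (seg i j) = p ` {i..j}" by (auto simp: seg_def)
  then show "set (seg i j) \<subseteq> W" using p_in assms by auto
  show "distinct (seg i j)" using p_eq assms by (auto simp: seg_def distinct_map inj_on_def)
  show "successively adj (seg i j)" using step assms by (auto simp: seg_def successively_conv_nth nth_append simp del: upt_Suc)
  show "hd (seg i j) = p i" using assms by (simp add: seg_def hd_map del: upt_Suc)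
  show "last (seg i j) = p j" "seg i j \<noteq> []" using assms by (simp_all add: seg_def)
  show "length (seg i j) = Suc j - i" using assms by (simp add: seg_def)
qed

lemma out_seg: "c \<notin> set xs \<Longrightarrow> j < m \<Longrightarrow> c \<notin> p ` {i..j}"
  by auto

lemma p_seg: "k < m \<Longrightarrow> j < m \<Longrightarrow> k < i \<or> j < k \<Longrightarrow> p k \<notin> p ` {i..j}"
  using p_eq by auto

text \<open>A chord that skips two or more vertices closes a cycle of length at least four.\<close>

lemma chord:
  assumes "adj (p i) (p j)" "i < j" "j < m"
  shows "j = i + 1 \<or> j = i + 2"
proof (rule ccontr)
  assume "\<not> ?thesis"
  then have "4 \<le> Suc j - i" "i \<le> j" using assms by auto
  then show False using no_cycle[of "seg i j"] seg[of i j] assms(3) adj_sym[OF assms(1)] by simp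
qed

text \<open>If the triangles over the two chords share an edge, there is a 4-cycle; if they share
  one vertex, there is a campstool; otherwise they are disjoint.\<close>

lemma two_chords:
  assumes "adj (p i) (p (i + 2))" "adj (p j) (p (j + 2))" "i < j" "j + 2 < m"
  shows False
proof -
  consider "j = i + 1" | "j = i + 2" | "j \<ge> i + 3" using assms by linarith
  then show False
  proof cases
    case 1
    then show False
      using no_cycle[of "[p i, p (i+1), p (i+3), p (i+2)]"] assms p_eq p_in step[of i] step'[of "i+2"] adj_sym[OF assms(1)]
      by (simp add: numeral_eq_Suc)
  next
    case 2
    then show False
      using no_campstool[of "p (i+2)" "p i" "p (i+1)" "p (i+3)" "p (i+4)"] assms p_eq p_in step[of i] step'[of "i+1"] step[of "i+2"] adj_sym[OF assms(1)]
      by (simp add: numeral_eq_Suc)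
  next
    case 3
    have "branching [p i, p (i+1), p (i+2)]" "branching [p j, p (j+1), p (j+2)]"
      using assms p_eq p_in step[of i] step[of "i+1"] step[of j] step[of "j+1"]
      by (auto intro!: branching_triangle simp: numeral_eq_Suc)
    moreover have "set [p i, p (i+1), p (i+2)] \<inter> set [p j, p (j+1), p (j+2)] = {}"
      using 3 assms p_eq by auto
    ultimately show False using no_disjoint_branching[OF minor_free_part_axioms minor_free_part_axioms] by blast
  qed
qed

lemma off_path_inner:
  assumes "d \<in> W" "d \<notin> set xs" "adj d (p i)" "i < m"
  shows "0 < i" "i + 1 < m"
proof -
  show "0 < i"
  proof (rule ccontr)
    assume "\<not> 0 < i"
    then have "successively adj (d # xs)" using assms path ne by (cases xs) auto
    then show False using longest[of "d # xs"] assms dist sub by simp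
  qed
  show "i + 1 < m"
  proof (rule ccontr)
    assume "\<not> i + 1 < m"
    then have "i = m - 1" using assms by linarith
    then have "last xs = p i" using ne by (simp add: last_conv_nth)
    then have "successively adj (xs @ [d])" using assms path ne adj_sym[OF assms(3)] by (simp add: successively_append_iff)
    then show False using longest[of "xs @ [d]"] assms dist sub by simp
  qed
qed

lemma longer_path:
  "distinct ys \<Longrightarrow> set ys \<subseteq> W \<Longrightarrow> successively adj ys \<Longrightarrow> length ys > m \<Longrightarrow> False"
  using longest by fastforce

text \<open>Two consecutive neighbours on the path allow a detour through \<open>d\<close>, hence a
  longer path; neighbours farther apart close a cycle of length at least four.\<close>

lemma off_path_unique:
  assumes d: "d \<in> W" "d \<notin> set xs" and i: "adj d (p i)" and j: "adj d (p j)" "i < j" "j < m"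
  shows False
proof (cases "j = i + 1")
  case True
  let ?ys = "seg 0 i @ [d] @ seg j (m - 1)"
  have s: "i < m" "0 \<le> i" "j \<le> m - 1" "m - 1 < m" using j ne by auto
  note s1 = seg[OF s(2,1)] and s2 = seg[OF s(3,4)]
  have dn: "d \<notin> p ` {0..i}" "d \<notin> p ` {j..m - 1}" using out_seg[OF d(2)] s by blast+
  have dj: "p ` {0..i} \<inter> p ` {j..m - 1} = {}" using p_eq s j by auto
  show False
  proof (rule longer_path[of ?ys])
    show "distinct ?ys" using s1 s2 dn dj by auto
    show "set ?ys \<subseteq> W" using s1 s2 d by auto
    show "successively adj ?ys" using s1 s2 i j adj_sym[OF i] by (auto simp: successively_append_iff successively_Cons)
    show "m < length ?ys" using s1 s2 True s j by simp
  qed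
next
  case False
  then have ij: "i \<le> j" "j < m" "j \<ge> i + 2" using j by auto
  note s = seg[OF ij(1,2)]
  have dn: "d \<notin> p ` {i..j}" using out_seg[OF d(2)] ij by blast
  have "successively adj (d # seg i j)" using s i by (simp add: successively_Cons)
  moreover have "3 \<le> Suc j - i" using ij by linarith
  ultimately show False using no_cycle[of "d # seg i j"] s dn d adj_sym[OF j(1)] by simp
qed

text \<open>Both attachment vertices are inner vertices of the path, so the stretch between them has
  two further neighbours at each end, an H-tree minor.\<close>

lemma off_path_same:
  assumes c: "c \<in> W" "c \<notin> set xs" "adj c (p i)" "i < m" and d: "d \<in> W" "d \<notin> set xs" "adj d (p j)" "j < m"
    and cd: "c \<noteq> d" and ij: "i < j"
  shows False
proof -
  have i: "0 < i" "i + 1 < m" and j: "0 < j" "j + 1 < m" using off_path_inner[OF c] off_path_inner[OF d] by auto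
  note s = seg[OF less_imp_le[OF ij] d(4)]
  have "c \<notin> p ` {i..j}" "d \<notin> p ` {i..j}" using out_seg[OF c(2) d(4)] out_seg[OF d(2) d(4)] by blast+
  moreover have "p (i - 1) \<notin> p ` {i..j}" "p (j + 1) \<notin> p ` {i..j}" "p (i - 1) \<noteq> p (j + 1)" using p_seg[of "i - 1" j i] p_seg[of "j + 1" j i] p_eq[of "i - 1" "j + 1"] i j ij by auto
  moreover have "c \<noteq> p (i - 1)" "c \<noteq> p (j + 1)" "d \<noteq> p (i - 1)" "d \<noteq> p (j + 1)"
    using p_out[OF c(2)] p_out[OF d(2)] i j by (metis Suc_eq_plus1 Suc_lessD diff_Suc_1 less_imp_diff_less)+
  moreover have "adj (p i) (p (i - 1))" "adj (p j) (p (j + 1))" using step'[of "i - 1"] step[of j] i j by auto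
  moreover have "p (i - 1) \<in> W" "p (j + 1) \<in> W" using p_in i j by auto
  moreover have "2 \<le> Suc j - i" using ij by linarith
  ultimately show False
    by (intro no_H_tree[of c "p (i - 1)" d "p (j + 1)" "seg i j"])
      (simp_all add: s(1-7) s(3)[unfolded s(2)] c(1) d(1) cd cd[symmetric] adj_sym[OF c(3)] adj_sym[OF d(3)] p_in)
qed

text \<open>The arm \<open>c\<close>, \<open>d\<close> could replace a shorter end of the path. By
  maximality the path has at least two vertices on either side of \<open>p i\<close>, and with this
  arm they form \<open>S(2,2,2)\<close>.\<close>

lemma off_path_leaf:
  assumes c: "c \<in> W" "c \<notin> set xs" "adj c (p i)" "i < m" and d: "d \<in> W" "d \<notin> set xs" "adj c d"
  shows False
proof -
  have i: "0 < i" "i + 1 < m" using off_path_inner[OF c] by auto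
  have cd: "c \<noteq> d" using adj_neq[OF d(3)] .
  have out: "c \<noteq> p k" "d \<noteq> p k" "p k \<noteq> c" "p k \<noteq> d" if "k < m" for k
    using p_out[OF c(2) that] p_out[OF d(2) that] by auto
  have i2: "i \<ge> 2"
  proof (rule ccontr)
    assume n: "\<not> i \<ge> 2"
    have s: "i \<le> m - 1" "m - 1 < m" using i by auto
    note s = seg[OF s]
    have "c \<notin> p ` {i..m - 1}" "d \<notin> p ` {i..m - 1}" using out_seg[OF c(2)] out_seg[OF d(2)] i by auto
    moreover have "m < Suc (Suc (m - i))" using n i by linarith
    ultimately show False using longer_path[of "[d, c] @ seg i (m - 1)"] s c d cd n i adj_sym[OF d(3)]
      by (simp add: successively_append_iff successively_Cons)
  qed
  have i3: "i + 2 < m"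
  proof (rule ccontr)
    assume n: "\<not> i + 2 < m"
    note s = seg[of 0 i, OF _ c(4)]
    have "c \<notin> p ` {0..i}" "d \<notin> p ` {0..i}" using out_seg[OF c(2) c(4)] out_seg[OF d(2) c(4)] by blast+
    moreover have "m < Suc (Suc (Suc i))" using n i by linarith
    ultimately show False using longer_path[of "seg 0 i @ [c, d]"] s c d cd n i adj_sym[OF c(3)]
      by (simp add: successively_append_iff successively_Cons)
  qed
  obtain k where k: "i = k + 2" using i2 by (metis add.commute le_Suc_ex)
  show False
    using no_spider_222[of "p (k+2)" "p (k+1)" "p k" "p (k+3)" "p (k+4)" c d]
      step'[of k] step'[of "k+1"] step[of "k+2"] step[of "k+3"] p_in p_eq out i3 c d cd adj_sym[OF c(3)]
    unfolding k by (simp add: numeral_eq_Suc)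
qed

lemma exit_edge:
  assumes "set xs \<subseteq> Q" "Q \<subset> W"
  obtains x y where "x \<in> Q" "y \<in> W - Q" "adj x y"
proof -
  obtain w where w: "w \<in> W" "w \<notin> Q" using assms by blast
  have "p 0 \<in> set xs" using ne by simp
  then have p0: "p 0 \<in> Q" "p 0 \<in> W" using assms sub by auto
  have "(p 0, w) \<in> (parcs G \<inter> W \<times> W)\<^sup>*" by (rule conn[OF p0(2) w(1)])
  then have "w \<in> Q \<or> (\<exists>x\<in>Q. \<exists>y\<in>W - Q. adj x y)"
    by (induction rule: rtrancl_induct) (use p0 in auto)
  with w that show ?thesis by blast
qed

lemma off_path_edge:
  assumes "set xs \<noteq> W"
  obtains c i where "c \<in> W" "c \<notin> set xs" "adj c (p i)" "i < m"
proof -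
  obtain x y where "x \<in> set xs" "y \<in> W - set xs" "adj x y"
    using exit_edge[of "set xs"] sub assms by blast
  then show ?thesis using that adj_sym by (metis DiffD1 DiffD2 in_set_conv_nth)
qed

text \<open>Cases by the distance of \<open>p i\<close> from the triangle over the chord. Two or
  more: the claw at \<open>p i\<close> is disjoint from it. One: an H-tree. At an end of the chord:
  a campstool. At the skipped vertex: a 3-sun, because by maximality the path continues beyond both
  ends of the chord.\<close>

lemma off_path_no_chord:
  assumes c: "c \<in> W" "c \<notin> set xs" "adj c (p i)" "i < m" and ch: "adj (p a) (p (a + 2))" "a + 2 < m"
  shows False
proof -
  have i: "0 < i" "i + 1 < m" using off_path_inner[OF c] by auto
  obtain k where k: "i = k + 1" using i by (metis Suc_eq_plus1 gr0_implies_Suc)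
  have out: "c \<noteq> p k" "p k \<noteq> c" if "k < m" for k using p_out[OF c(2) that] by auto
  have ci: "adj (p i) c" using adj_sym[OF c(3)] .
  have st: "adj (p k) (p (k+1))" "adj (p (k+1)) (p k)" "adj (p (k+1)) (p (k+2))"
    using step[of k] step'[of k] step[of "k+1"] i k by simp_all
  have sa: "adj (p a) (p (a+1))" "adj (p (a+1)) (p a)" "adj (p (a+1)) (p (a+2))" "adj (p (a+2)) (p (a+1))" "adj (p (a+2)) (p a)"
    using step[of a] step'[of a] step[of "a+1"] step'[of "a+1"] ch adj_sym[OF ch(1)] by simp_all
  have bc: "branching [p i, c, p k, p (k+2)]"
    using st ci c i p_in p_eq out unfolding k by (intro branching_claw) auto
  have bt: "branching [p a, p (a+1), p (a+2)]"
    using sa ch p_in p_eq by (intro branching_triangle) auto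
  consider "i + 1 < a" | "i + 1 = a" | "i = a" | "i = a + 1" | "i = a + 2" | "i = a + 3" | "i > a + 3" by linarith
  then show False
  proof cases
    case 1
    have "set [p a, p (a+1), p (a+2)] \<inter> set [p i, c, p k, p (k+2)] = {}"
      using 1 k ch i p_eq out by auto
    then show False using no_disjoint_branching[OF minor_free_part_axioms minor_free_part_axioms bt bc] by blast
  next
    case 2
    have "p k \<in> W" using p_in i k by simp
    then show False
      using no_H_tree[of c "p k" "p (a+1)" "p (a+2)" "[p i, p a]"] 2 k ci st sa ch c i p_eq out p_in
      by simp
  next
    case 3
    then show False
      using no_campstool[of "p a" "p (a+1)" "p (a+2)" c "p k"] k ci st sa ch c i p_eq out p_in by simp
  next
    case 4
    then have ak: "a = k" using k by simp
    \<comment> \<open>Otherwise \<open>c\<close>, \<open>p 1\<close>, \<open>p 0\<close>,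
      \<open>p 2\<close> and the rest of the path form a longer path; \<open>a3\<close> is the same
      at the other end.\<close>
    have a0: "a > 0"
    proof (rule ccontr)
      assume "\<not> a > 0"
      then have a: "a = 0" by simp
      have s: "2 \<le> m - 1" "m - 1 < m" using ch a by auto
      note s = seg[OF s]
      have "c \<notin> p ` {2..m - 1}" "p 0 \<notin> p ` {2..m - 1}" "p 1 \<notin> p ` {2..m - 1}"
        using out_seg[OF c(2)] p_seg[of 0 "m - 1" 2] p_seg[of 1 "m - 1" 2] ch a ne by auto
      moreover have "p 0 \<in> W" "p 1 \<in> W" "p 1 \<noteq> p 0" "c \<noteq> p 0" "c \<noteq> p 1"
        using p_in[of 0] p_in[of 1] p_eq[of 1 0] out(1)[of 0] out(1)[of 1] ch a ne by auto
      moreover have "m < Suc (Suc (Suc (m - 2)))" by linarith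
      ultimately show False using longer_path[of "[c, p 1, p 0] @ seg 2 (m - 1)"] s c 4 a ch sa
        by (simp add: successively_append_iff successively_Cons numeral_2_eq_2)
    qed
    have a3: "a + 3 < m"
    proof (rule ccontr)
      assume n: "\<not> a + 3 < m"
      have s: "0 \<le> a" "a < m" using ch by auto
      note s = seg[OF s]
      have "c \<notin> p ` {0..a}" "p (a+1) \<notin> p ` {0..a}" "p (a+2) \<notin> p ` {0..a}"
        using out_seg[OF c(2)] p_seg[of "a+1" a 0] p_seg[of "a+2" a 0] ch by auto
      then show False using longer_path[of "seg 0 a @ [p (a+2), p (a+1), c]"] s c 4 n ch sa p_in p_eq out ci
        by (simp add: successively_append_iff successively_Cons)
    qed
    obtain b where b: "a = b + 1" using a0 by (metis Suc_eq_plus1 gr0_implies_Suc)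
    show False
      using no_three_sun[of "p a" "p (a+1)" "p (a+2)" "p b" c "p (a+3)"] step'[of b] step[of "a+2"] ci sa ch 4 c p_eq out p_in a3 b
      by (simp add: numeral_eq_Suc)
  next
    case 5
    then show False
      using no_campstool[of "p (a+2)" "p a" "p (a+1)" c "p (a+3)"] k ci st sa ch c i p_eq out p_in
      by (simp add: numeral_eq_Suc)
  next
    case 6
    then show False
      using no_H_tree[of "p a" "p (a+1)" c "p (a+4)" "[p (a+2), p (a+3)]"] k ci st sa ch c i p_eq out p_in
      by (simp add: numeral_eq_Suc)
  next
    case 7
    have "set [p a, p (a+1), p (a+2)] \<inter> set [p i, c, p k, p (k+2)] = {}"
      using 7 k ch i p_eq out by auto
    then show False using no_disjoint_branching[OF minor_free_part_axioms minor_free_part_axioms bt bc] by blast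
  qed
qed

section \<open>Multiple eigenvalues read off a longest path\<close>

lemma entry_iff:
  assumes "realizes W (parcs G) A" "x \<in> W" "y \<in> W" "x \<noteq> y"
  shows "A x y \<noteq> 0 \<longleftrightarrow> adj x y"
  using assms by (auto simp: realizes_def)

lemma path_entries:
  assumes "realizes W (parcs G) A"
  shows "Suc i < m \<Longrightarrow> A (p i) (p (Suc i)) \<noteq> 0" "Suc i < m \<Longrightarrow> A (p (Suc i)) (p i) \<noteq> 0"
  using entry_iff[OF assms] step[of i] step'[of i] p_in p_eq by auto

lemma spanning_bij: "set xs = W \<Longrightarrow> bij_betw p {..<m} W"
  using bij_betw_nth[OF dist] by simp

lemma spanning_unique:
  assumes A: "realizes W (parcs G) A" and W: "set xs = W" and l: "mult2 W A l" "mult2 W A l'"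
  shows "l = l'"
proof -
  \<comment> \<open>At most one chord exists; if there is none, every \<open>k\<close> has the
    property.\<close>
  obtain k where k: "\<And>i. i + 2 < m \<Longrightarrow> adj (p i) (p (i + 2)) \<Longrightarrow> i = k"
  proof (cases "\<exists>k. k + 2 < m \<and> adj (p k) (p (k + 2))")
    case True
    then obtain k where "k + 2 < m" "adj (p k) (p (k + 2))" by blast
    then show ?thesis using that[of k] two_chords[of k] two_chords[of _ k] by (metis linorder_neqE_nat)
  next
    case False
    then show ?thesis using that by blast
  qed
  show ?thesis
  proof (rule path_chord_mult2_unique[OF spanning_bij[OF W] _ _ _ l, of k])
    show "sym_on W A" using A by (simp add: realizes_def)
    show "A (p i) (p (Suc i)) \<noteq> 0" if "Suc i < m" for i by (rule path_entries(1)[OF A that])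
    fix i j assume ij: "Suc i < j" "j < m" "A (p i) (p j) \<noteq> 0"
    then have "adj (p i) (p j)" using entry_iff[OF A, of "p i" "p j"] p_in p_eq by auto
    then show "i = k \<and> j = k + 2" using chord[of i j] k[of i] ij by auto
  qed
qed

text \<open>A spanning path needs a chord to carry a multiple eigenvalue, and the chord gives a
  triangle. Otherwise an attached vertex and the two path neighbours of its attachment vertex form a
  claw.\<close>

lemma branching_exists:
  assumes A: "realizes W (parcs G) A" and l: "mult2 W A l"
  shows "\<exists>ys. branching ys"
proof (cases "set xs = W")
  case True
  have "\<exists>i. i + 2 < m \<and> adj (p i) (p (i + 2))"
  proof (rule ccontr)
    assume n: "\<not> ?thesis"
    have "\<not> mult2 W A l"
    proof (rule path_no_mult2[OF spanning_bij[OF True]])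
      show "A (p i) (p (Suc i)) \<noteq> 0" if "Suc i < m" for i by (rule path_entries(1)[OF A that])
      fix i j assume ij: "Suc i < j" "j < m"
      show "A (p i) (p j) = 0"
      proof (rule ccontr)
        assume "A (p i) (p j) \<noteq> 0"
        then have "adj (p i) (p j)" using entry_iff[OF A, of "p i" "p j"] p_in p_eq ij by auto
        then show False using chord[of i j] n ij by auto
      qed
    qed
    with l show False by blast
  qed
  then obtain i where i: "i + 2 < m" "adj (p i) (p (i + 2))" by blast
  have "branching [p i, p (i+1), p (i+2)]"
    using i step[of i] step[of "i+1"] p_in p_eq by (intro branching_triangle) auto
  then show ?thesis by blast
next
  case False
  obtain c i where c: "c \<in> W" "c \<notin> set xs" "adj c (p i)" "i < m" using off_path_edge[OF False] by blast
  have i: "0 < i" "i + 1 < m" using off_path_inner[OF c] by auto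
  obtain k where k: "i = k + 1" using i by (metis Suc_eq_plus1 gr0_implies_Suc)
  have "branching [p i, c, p k, p (k+2)]"
    using step'[of k] step[of "k+1"] adj_sym[OF c(3)] c i p_in p_eq p_out[OF c(2)] unfolding k
    by (intro branching_claw) (auto simp: numeral_2_eq_2)
  then show ?thesis by blast
qed

text \<open>\<open>Q\<close> consists of the path and the vertices attached at \<open>p i\<close>.
  An edge leaving \<open>Q\<close> would start at another path vertex or at a vertex off the path,
  and both are excluded.\<close>

lemma off_path_all_at:
  assumes c: "c \<in> W" "c \<notin> set xs" "adj c (p i)" "i < m" and d: "d \<in> W" "d \<notin> set xs"
  shows "adj d (p i)"
proof (rule ccontr)
  assume nd: "\<not> adj d (p i)"
  define Q where "Q = set xs \<union> {e \<in> W. adj e (p i)}"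
  have "set xs \<subseteq> Q" "Q \<subset> W" using d nd sub by (auto simp: Q_def)
  then obtain x y where xy: "x \<in> Q" "y \<in> W - Q" "adj x y" by (rule exit_edge)
  have y: "y \<in> W" "y \<notin> set xs" "\<not> adj y (p i)" using xy by (auto simp: Q_def)
  show False
  proof (cases "x \<in> set xs")
    case True
    then obtain j where j: "j < m" "x = p j" by (metis in_set_conv_nth)
    then have yj: "adj y (p j)" using adj_sym[OF xy(3)] by simp
    have "c \<noteq> y" using c(3) y(3) by auto
    moreover have "j \<noteq> i" using yj y(3) by auto
    ultimately show False
      using off_path_same[OF c y(1,2) yj j(1)] off_path_same[OF y(1,2) yj j(1) c] by (metis linorder_neqE_nat)
  next
    case False
    then have "x \<in> W" "adj x (p i)" using xy by (auto simp: Q_def)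
    then show False using off_path_leaf[OF _ False _ c(4) y(1,2) xy(3)] by blast
  qed
qed

text \<open>All vertices off the path are leaves at \<open>p i\<close>, and their number decides the
  shape. One: a path with a pendant vertex. Two: excluding \<open>S(2,2,1,1)\<close> puts
  \<open>p i\<close> next to an end, which gives a broom whose third leaf is that end. More:
  excluding \<open>S(2,1,1,1,1)\<close> leaves a path of three vertices, and excluding
  \<open>K_1,6\<close> leaves just three vertices off it, so the part is a star with five
  leaves.\<close>

lemma off_path_unique_value:
  assumes A: "realizes W (parcs G) A" and W: "set xs \<noteq> W" and l: "mult2 W A l" "mult2 W A l'"
  shows "l = l'"
proof -
  obtain c i where c: "c \<in> W" "c \<notin> set xs" "adj c (p i)" "i < m" using off_path_edge[OF W] by blast
  have i: "0 < i" "i + 1 < m" using off_path_inner[OF c] by auto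
  define C where "C = W - set xs"
  have cC: "c \<in> C" using c by (simp add: C_def)
  have finC: "finite C" using finite_W by (simp add: C_def)
  have WC: "W = set xs \<union> C" using sub by (auto simp: C_def)
  have adjC: "adj d (p i)" "adj (p i) d" if "d \<in> C" for d
    using off_path_all_at[OF c, of d] that adj_sym by (auto simp: C_def)
  have nadj: "\<not> adj d y" if "d \<in> C" "y \<in> W" "y \<noteq> p i" for d y
  proof
    assume dy: "adj d y"
    have d: "d \<in> W" "d \<notin> set xs" using that by (auto simp: C_def)
    show False
    proof (cases "y \<in> set xs")
      case True
      then obtain j where j: "j < m" "y = p j" by (metis in_set_conv_nth)
      then have "j < i \<or> i < j" using that by (metis linorder_neqE_nat)
      then show False using off_path_unique[OF d _ adjC(1)[OF that(1)] _ c(4), of j]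
          off_path_unique[OF d adjC(1)[OF that(1)] _ _ j(1)] dy j by blast
    next
      case False
      then show False using off_path_leaf[OF d adjC(1)[OF that(1)] c(4) that(2) False dy] by blast
    qed
  qed
  have zC: "A d y = 0" "A y d = 0" if "d \<in> C" "y \<in> W" "y \<noteq> p i" "y \<noteq> d" for d y
  proof -
    have "d \<in> W" using that by (simp add: C_def)
    then show "A d y = 0" "A y d = 0"
      using nadj[OF that(1-3)] entry_iff[OF A, of d y] entry_iff[OF A, of y d] that adj_sym by blast+
  qed
  have nzC: "A (p i) d \<noteq> 0" "A d (p i) \<noteq> 0" if "d \<in> C" for d
    using entry_iff[OF A, of "p i" d] entry_iff[OF A, of d "p i"] adjC[OF that] that p_in[OF c(4)] adj_neq by (auto simp: C_def)
  have zP: "A (p a) (p b) = 0" "A (p b) (p a) = 0" if "Suc a < b" "b < m" for a b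
  proof -
    have "\<not> adj (p a) (p b)"
      using chord[of a b] off_path_no_chord[OF c, of a] that by auto
    then show "A (p a) (p b) = 0" "A (p b) (p a) = 0"
      using entry_iff[OF A, of "p a" "p b"] entry_iff[OF A, of "p b" "p a"] p_in p_eq that adj_sym by auto
  qed
  have Cp: "d \<noteq> p k" "p k \<noteq> d" if "d \<in> C" "k < m" for d k using that by (auto simp: C_def)
  have CW: "d \<in> W" if "d \<in> C" for d using that by (simp add: C_def)
  obtain k where k: "i = k + 1" using i by (metis Suc_eq_plus1 gr0_implies_Suc)
  have xsP: "set xs = p ` {..<m}" by (auto simp: set_conv_nth)
  consider "C = {c}" | d where "d \<noteq> c" "C = {c, d}" | d e where "d \<in> C" "e \<in> C" "d \<noteq> c" "e \<noteq> c" "d \<noteq> e"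
    using cC by blast
  then show ?thesis
  proof cases
    case 1
    have val: "l = A c c" if "mult2 W A l" for l
    proof (rule pendant_mult2_value[OF _ c(2) _ _ _ c(4) _ that])
      show "bij_betw p {..<m} (set xs)" by (rule bij_betw_nth[OF dist]) auto
      show "W = insert c (set xs)" using WC 1 by auto
      show "A (p j) c = 0 \<and> A c (p j) = 0" if "j < m" "j \<noteq> i" for j
        using zC[OF cC, of "p j"] that p_in p_eq c(4) Cp[OF cC] by auto
    qed (use path_entries[OF A] zP in auto)
    show ?thesis using val[OF l(1)] val[OF l(2)] by simp
  next
    case (2 d)
    have dC: "d \<in> C" using 2 by simp
    have "i = 1 \<or> i + 2 = m"
    proof (rule ccontr)
      assume n: "\<not> ?thesis"
      then obtain a where a: "i = a + 2" using k by (metis One_nat_def Suc_eq_plus1 add_2_eq_Suc' not0_implies_Suc)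
      have "i + 2 < m" using n i by linarith
      then show False
        using no_spider_2211[of "p (a+2)" "p (a+1)" "p a" "p (a+3)" "p (a+4)" c d]
          step'[of a] step'[of "a+1"] step[of "a+2"] step[of "a+3"] p_in p_eq Cp cC dC CW 2(1) adjC
        unfolding a by (simp add: numeral_eq_Suc)
    qed
    then show ?thesis
    proof
      assume i1: "i = 1"
      obtain t where t: "m = t + 2" using i by (metis add.commute i1 le_Suc_ex less_imp_le_nat nat_1_add_1)
      \<comment> \<open>The path read backwards without \<open>p 0\<close>: as
        \<open>m = t + 2\<close>, the index \<open>Suc t - j\<close> is \<open>m - 1 - j\<close>,
        and the handle ends at \<open>q t = p 1\<close>.\<close>
      define q where "q j = p (Suc t - j)" for j
      have qt: "q t = p 1" by (simp add: q_def)
      have inj: "q a = q b \<longleftrightarrow> a = b" if "a < Suc t" "b < Suc t" for a b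
        using p_eq[of "Suc t - a" "Suc t - b"] that t by (auto simp: q_def)
      have imq: "q ` {..<Suc t} = p ` {1..<m}"
      proof -
        have "p j \<in> q ` {..<Suc t}" if "1 \<le> j" "j < m" for j
          using that t by (intro image_eqI[of _ _ "Suc t - j"]) (auto simp: q_def)
        moreover have "q j \<in> p ` {1..<m}" if "j < Suc t" for j
          unfolding q_def by (rule imageI) (use that t in auto)
        ultimately show ?thesis by auto
      qed
      have "{..<m} = insert 0 {1..<m}" using i by auto
      then have Pm: "set xs = insert (p 0) (p ` {1..<m})" unfolding xsP by simp
      have p0: "p 0 \<notin> p ` {1..<m}"
      proof
        assume "p 0 \<in> p ` {1..<m}"
        then obtain j where "1 \<le> j" "j < m" "p 0 = p j" by auto
        then show False using p_eq[of 0 j] ne by simp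
      qed
      show ?thesis
      proof (rule broom_mult2_unique[of q t "q ` {..<Suc t}" "{p 0, c, d}" W A, OF _ _ _ _ _ _ _ _ _ l])
        show "bij_betw q {..<Suc t} (q ` {..<Suc t})" using inj by (auto simp: bij_betw_def inj_on_def)
        show "card {p 0, c, d} = 3" using Cp[OF cC, of 0] Cp[OF dC, of 0] i ne 2(1) by auto
        show "{p 0, c, d} \<inter> q ` {..<Suc t} = {}" unfolding imq using p0 cC dC by (auto simp: C_def)
        show "W = {p 0, c, d} \<union> q ` {..<Suc t}" unfolding imq WC Pm 2(2) by auto
        show "A x y = 0 \<and> A y x = 0" if xy: "x \<in> {p 0, c, d}" "y \<in> W" "x \<noteq> y" "y \<noteq> q t" for x y
        proof (cases "x = p 0")
          case True
          show ?thesis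
          proof (cases "y \<in> C")
            case True
            then show ?thesis using zC[of y "p 0"] \<open>x = p 0\<close> Cp[OF True, of 0] i i1 ne p_in[of 0] p_eq[of 0 1] by auto
          next
            case False
            then obtain j where j: "j < m" "y = p j" using xy WC xsP by auto
            then have "Suc 0 < j" using xy True qt by (metis One_nat_def less_one linorder_neqE_nat)
            then show ?thesis using zP[of 0 j] j True by simp
          qed
        next
          case False
          then have "x \<in> C" using xy 2 by auto
          then show ?thesis using zC[of x y] xy qt i1 by auto
        qed
        show "A (q t) x \<noteq> 0" if "x \<in> {p 0, c, d}" for x
          using that nzC cC dC path_entries(2)[OF A, of 0] i i1 qt by auto
        show "A (q j) (q (Suc j)) \<noteq> 0" if "Suc j < Suc t" for j
        proof -
          have "Suc t - j = Suc (Suc t - Suc j)" using that by simp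
          then show ?thesis using path_entries(2)[OF A, of "Suc t - Suc j"] that t by (simp add: q_def)
        qed
        show "A (q a) (q b) = 0" if "Suc a < b" "b < Suc t" for a b
          using zP(2)[of "Suc t - b" "Suc t - a"] that t by (simp add: q_def)
      qed simp
    next
      \<comment> \<open>The mirror image: the last path vertex \<open>p (Suc i)\<close> is the third
        leaf, and the handle needs no reversal.\<close>
      assume im: "i + 2 = m"
      have Pm: "set xs = insert (p (Suc i)) (p ` {..<Suc i})"
        unfolding xsP im[symmetric] by (auto simp: lessThan_Suc)
      have p0: "p (Suc i) \<notin> p ` {..<Suc i}" using p_eq im by auto
      show ?thesis
      proof (rule broom_mult2_unique[of p i "p ` {..<Suc i}" "{p (Suc i), c, d}" W A, OF _ _ _ _ _ _ _ _ _ l])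
        show "bij_betw p {..<Suc i} (p ` {..<Suc i})" using p_eq im by (auto simp: bij_betw_def inj_on_def)
        show "card {p (Suc i), c, d} = 3" using Cp[OF cC, of "Suc i"] Cp[OF dC, of "Suc i"] i 2(1) by auto
        show "{p (Suc i), c, d} \<inter> p ` {..<Suc i} = {}" using p0 cC dC im by (auto simp: C_def)
        show "W = {p (Suc i), c, d} \<union> p ` {..<Suc i}" unfolding WC Pm 2(2) by auto
        show "A x y = 0 \<and> A y x = 0" if xy: "x \<in> {p (Suc i), c, d}" "y \<in> W" "x \<noteq> y" "y \<noteq> p i" for x y
        proof (cases "x = p (Suc i)")
          case True
          show ?thesis
          proof (cases "y \<in> C")
            case True
            then show ?thesis using zC[of y "p (Suc i)"] \<open>x = p (Suc i)\<close> Cp[OF True, of "Suc i"] i p_in[of "Suc i"] p_eq[of "Suc i" i] by auto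
          next
            case False
            then obtain j where j: "j < m" "y = p j" using xy WC xsP by auto
            then have "j \<noteq> Suc i" "j \<noteq> i" using xy True by auto
            then have "Suc j < Suc i" using j im by linarith
            then show ?thesis using zP[of j "Suc i"] i j True by simp
          qed
        next
          case False
          then have "x \<in> C" using xy 2 by auto
          then show ?thesis using zC[of x y] xy by auto
        qed
        show "A (p i) x \<noteq> 0" if "x \<in> {p (Suc i), c, d}" for x
          using that nzC cC dC path_entries(1)[OF A, of i] i by auto
        show "A (p j) (p (Suc j)) \<noteq> 0" if "Suc j < Suc i" for j
          using path_entries(1)[OF A, of j] that i by simp
        show "A (p a) (p b) = 0" if "Suc a < b" "b < Suc i" for a b
          using zP(1)[of a b] that i by simp
      qed simp
    qed
  next
    case (3 d e)
    have k0: "k = 0"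
    proof (rule ccontr)
      assume "k \<noteq> 0"
      then obtain a where a: "k = a + 1" by (metis Suc_eq_plus1 not0_implies_Suc)
      show False
        using no_spider_21111[of "p (a+2)" "p (a+1)" "p a" "p (a+3)" c d e] step'[of a] step'[of "a+1"] step[of "a+2"]
          p_in p_eq Cp cC 3 CW adjC i
        unfolding k a by (simp add: numeral_eq_Suc)
    qed
    have m3: "m = 3"
    proof (rule ccontr)
      assume "m \<noteq> 3"
      then have "3 < m" using i k k0 by simp
      then show False
        using no_spider_21111[of "p 1" "p 2" "p 3" "p 0" c d e] step[of 1] step[of 2] step'[of 0]
          p_in p_eq Cp cC 3 CW adjC i ne
        unfolding k k0 by (simp add: numeral_eq_Suc)
    qed
    have i1: "i = 1" using k k0 by simp
    have C3: "C = {c, d, e}"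
    proof (rule ccontr)
      assume "\<not> ?thesis"
      then obtain f where f: "f \<in> C" "f \<noteq> c" "f \<noteq> d" "f \<noteq> e" using cC 3 by blast
      then show False
        using no_star_6[of "p 1" "p 0" "p 2" c d e f] step[of 1] step'[of 0]
          p_in p_eq Cp cC 3 CW adjC i ne
        unfolding i1 m3 by (simp add: numeral_eq_Suc)
    qed
    have xs3: "set xs = {p 0, p 1, p 2}"
    proof -
      have "{..<m} = {0, 1, 2}" using m3 by auto
      then show ?thesis unfolding xsP by simp
    qed
    have q: "p 0 \<noteq> p 1" "p 0 \<noteq> p 2" "p 1 \<noteq> p 2" using p_eq m3 by auto
    have pin: "p 0 \<in> W" "p 1 \<in> W" "p 2 \<in> W" using p_in m3 by auto
    have Cq: "x \<noteq> p 0" "x \<noteq> p 1" "x \<noteq> p 2" if "x \<in> C" for x using Cp[OF that] m3 by auto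
    show ?thesis
    proof (rule star_mult2_unique[of "{p 0, p 2, c, d, e}" "p 1" W A, OF _ _ _ _ _ _ l])
      show "card {p 0, p 2, c, d, e} = 5"
        using q Cq[OF cC] Cq[OF 3(1)] Cq[OF 3(2)] 3 by auto
      show "p 1 \<notin> {p 0, p 2, c, d, e}" using q Cq[OF cC] Cq[OF 3(1)] Cq[OF 3(2)] by auto
      show "W = insert (p 1) {p 0, p 2, c, d, e}" unfolding WC C3 xs3 by auto
      have zz: "A x y = 0" "A y x = 0" if "x \<in> C" "y \<in> {p 0, p 2, c, d, e}" "x \<noteq> y" for x y
        using zC[of x y] that q Cq pin CW cC 3 i1 by auto
      fix x y assume xy: "x \<in> {p 0, p 2, c, d, e}" "y \<in> {p 0, p 2, c, d, e}" "x \<noteq> y"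
      show "A x y = 0"
      proof (cases "x \<in> C \<or> y \<in> C")
        case True
        then show ?thesis using zz[of x y] zz[of y x] xy by auto
      next
        case False
        then have "(x = p 0 \<and> y = p 2) \<or> (x = p 2 \<and> y = p 0)" using xy C3 by auto
        then show ?thesis using zP[of 0 2] m3 by auto
      qed
    next
      fix x assume "x \<in> {p 0, p 2, c, d, e}"
      then consider "x \<in> C" | "x = p 0" | "x = p 2" using C3 by auto
      then show "A (p 1) x \<noteq> 0 \<and> A x (p 1) \<noteq> 0"
      proof cases
        case 1 then show ?thesis using nzC[of x] i1 by simp
      next
        case 2 then show ?thesis using path_entries[OF A, of 0] m3 by simp
      next
        case 3 then show ?thesis using path_entries[OF A, of 1] m3 by (simp add: numeral_2_eq_2)
      qed
    qed simp
  qed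
qed

lemma multiple_unique:
  assumes "realizes W (parcs G) A" "mult2 W A l" "mult2 W A l'"
  shows "l = l'"
  using assms spanning_unique off_path_unique_value by blast

end

lemma (in minor_free_part) longest_path_exists:
  assumes conn: "\<And>x y. x \<in> W \<Longrightarrow> y \<in> W \<Longrightarrow> (x, y) \<in> (parcs G \<inter> W \<times> W)\<^sup>*" and ne: "W \<noteq> {}"
  shows "\<exists>xs. longest_path G W xs"
proof -
  obtain w where w: "w \<in> W" using ne by blast
  define P where "P ys \<longleftrightarrow> distinct ys \<and> set ys \<subseteq> W \<and> successively adj ys" for ys
  have "P [w]" using w by (simp add: P_def)
  moreover have "\<forall>ys. P ys \<longrightarrow> length ys < card W + 1"
    using finite_W card_mono distinct_card unfolding P_def by (metis Suc_eq_plus1 le_imp_less_Suc)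
  ultimately obtain xs where xs: "P xs" "\<forall>ys. P ys \<longrightarrow> length ys \<le> length xs"
    using ex_has_greatest_nat[of P "[w]" length "card W + 1"] by blast
  have "xs \<noteq> []" using xs(2) \<open>P [w]\<close> by fastforce
  then have "longest_path G W xs"
    using xs conn unfolding P_def by unfold_locales auto
  then show ?thesis by blast
qed

section \<open>The eleven graphs\<close>

text \<open>Explicit matrices are lists of rows, so that simplification evaluates all
  entries.\<close>

definition eigen_list :: "nat \<Rightarrow> real list list \<Rightarrow> real \<Rightarrow> real list \<Rightarrow> bool" where
  "eigen_list k A l x \<longleftrightarrow> (\<forall>i<k. (\<Sum>j<k. A ! i ! j * x ! j) = l * x ! i)"

text \<open>A candidate violation of the SSP, with zero diagonal and independent unknowns above
  it.\<close>

definition sym_ext :: "(nat \<Rightarrow> nat \<Rightarrow> real) \<Rightarrow> nat \<Rightarrow> nat \<Rightarrow> real" where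
  "sym_ext Z i j = (if i < j then Z i j else if j < i then Z j i else 0)"

definition comm_entry :: "nat \<Rightarrow> real list list \<Rightarrow> (nat \<Rightarrow> nat \<Rightarrow> real) \<Rightarrow> nat \<Rightarrow> nat \<Rightarrow> bool" where
  "comm_entry k A Z i j \<longleftrightarrow> (\<Sum>p<k. A ! i ! p * sym_ext Z p j) = (\<Sum>p<k. sym_ext Z i p * A ! p ! j)"

lemma mult2_listI:
  assumes "eigen_list k A l x" "eigen_list k A l y" "a < k" "b < k"
    "x ! a = 1" "x ! b = 0" "y ! a = 0" "y ! b = 1"
  shows "mult2 {..<k} (\<lambda>i j. A ! i ! j) l"
  unfolding mult2_def
proof (intro exI conjI allI impI)
  show "eigvec {..<k} (\<lambda>i j. A ! i ! j) l (\<lambda>i. x ! i)" "eigvec {..<k} (\<lambda>i j. A ! i ! j) l (\<lambda>i. y ! i)"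
    using assms(1,2) by (auto simp: eigvec_def eigen_list_def)
  fix s t assume "\<forall>i\<in>{..<k}. s * x ! i + t * y ! i = 0"
  then have "s * x ! a + t * y ! a = 0" "s * x ! b + t * y ! b = 0" using assms(3,4) by auto
  then show "s = 0" "t = 0" using assms(5-) by auto
qed

text \<open>\<open>vs\<close> names the vertices belonging to the rows. Each pair of eigenvectors is
  independent because at two positions it looks like a pair of unit vectors. The commutator of
  symmetric matrices is skew-symmetric, so its entries above the diagonal say everything.\<close>

lemma ssp_realizable_listI:
  assumes "distinct vs" "length vs = k"
    and A: "\<forall>i<k. \<forall>j<k. A ! i ! j = A ! j ! i \<and> (i \<noteq> j \<longrightarrow> (A ! i ! j \<noteq> 0 \<longleftrightarrow> (vs ! i, vs ! j) \<in> R))"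
    and l: "eigen_list k A l x" "eigen_list k A l y" "a < k" "b < k"
      "x ! a = 1 \<and> x ! b = 0" "y ! a = 0 \<and> y ! b = 1"
    and m: "eigen_list k A m u" "eigen_list k A m w" "c < k" "d < k"
      "u ! c = 1 \<and> u ! d = 0" "w ! c = 0 \<and> w ! d = 1"
    and lm: "l \<noteq> m"
    and ssp: "\<And>Z. \<forall>j<k. \<forall>i<j. A ! i ! j \<noteq> 0 \<longrightarrow> Z i j = 0 \<Longrightarrow> \<forall>j<k. \<forall>i<j. comm_entry k A Z i j \<Longrightarrow>
      \<forall>j<k. \<forall>i<j. Z i j = 0"
  shows "ssp_realizable (set vs) R"
proof -
  define R' where "R' = {(i, j). (vs ! i, vs ! j) \<in> R}"
  let ?M = "\<lambda>i j. A ! i ! j"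
  have "realizes {..<k} R' ?M" using A by (simp add: realizes_def sym_on_def R'_def)
  moreover have "ssp_on {..<k} ?M"
    unfolding ssp_on_def
  proof (intro allI impI)
    fix X assume s: "sym_on {..<k} X" and p: "\<forall>i\<in>{..<k}. \<forall>j\<in>{..<k}. i = j \<or> ?M i j \<noteq> 0 \<longrightarrow> X i j = 0"
      and c: "comm_on {..<k} ?M X"
    have e: "sym_ext X i j = X i j" if "i < k" "j < k" for i j
      using s p that by (auto simp: sym_ext_def sym_on_def)
    have "\<forall>j<k. \<forall>i<j. X i j = 0"
    proof (rule ssp)
      show "\<forall>j<k. \<forall>i<j. A ! i ! j \<noteq> 0 \<longrightarrow> X i j = 0" using p by simp
      show "\<forall>j<k. \<forall>i<j. comm_entry k A X i j"
        using c e by (simp add: comm_entry_def comm_on_def)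
    qed
    then have "X i j = 0" if "i < k" "j < k" for i j
      using e[OF that] that by (metis sym_ext_def)
    then show "\<forall>i\<in>{..<k}. \<forall>j\<in>{..<k}. X i j = 0" by simp
  qed
  ultimately have "ssp_realizable {..<k} R'"
    unfolding ssp_realizable_def using mult2_listI[OF l(1-4)] l(5,6) mult2_listI[OF m(1-4)] m(5,6) lm by blast
  moreover have b: "bij_betw ((!) vs) {..<k} (set vs)" using assms(1,2) bij_betw_nth by blast
  ultimately show ?thesis
    using bij_betw_inv_into[OF b] bij_betw_inv_into_right[OF b]
    by (intro ssp_realizable_iso[of "inv_into {..<k} ((!) vs)" "set vs" "{..<k}" R' R]) (auto simp: R'_def)
qed

lemma disjoint_union_edges:
  "pverts (disjoint_union G H) = (\<lambda>i. 2 * i) ` pverts G \<union> (\<lambda>i. 2 * i + 1) ` pverts H"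
  "parcs (disjoint_union G H) = (\<lambda>(i, j). (2 * i, 2 * j)) ` parcs G \<union> (\<lambda>(i, j). (2 * i + 1, 2 * j + 1)) ` parcs H"
  by (simp_all add: disjoint_union_def)

lemma converse_insert_pair: "(insert (a, b) r)\<inverse> = insert (b, a) (r\<inverse>)"
  by auto

section \<open>Explicit matrices with the SSP and two double eigenvalues\<close>

lemma ssp_realizable_cycle_4: "ssp_realizable (pverts (cycle_graph 4)) (parcs (cycle_graph 4))"
proof -
  \<comment> \<open>The square of this matrix is 25 times the identity and its trace is 0, so 5 and
    -5 are double. The Pythagorean triple avoids irrational eigenvalues: entries of modulus 1 would
    give the eigenvalues \<open>\<plusminus> sqrt 2\<close>.\<close>
  let ?A = "[[0, 3, 0, 4],
      [3, 0, 4, 0],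
      [0, 4, 0, -3],
      [4, 0, -3, 0]] :: real list list"
  let ?R = "parcs (cycle_graph 4)"
  have V: "pverts (cycle_graph 4) = set [0, 1, 2, 3]" unfolding cycle_graph_4_edges by auto
  have R: "\<forall>i<4. \<forall>j<4. ?A ! i ! j = ?A ! j ! i \<and> (i \<noteq> j \<longrightarrow> (?A ! i ! j \<noteq> 0 \<longleftrightarrow> ([0, 1, 2, 3] ! i, [0, 1, 2, 3] ! j) \<in> ?R))"
    unfolding cycle_graph_4_edges by (simp add: numeral_eq_Suc All_less_Suc converse_insert_pair)
  have x: "eigen_list 4 ?A (5) [3/4, 5/4, 1, 0]" "eigen_list 4 ?A (5) [5/4, 3/4, 0, 1]"
    "eigen_list 4 ?A (-5) [3/4, -5/4, 1, 0]" "eigen_list 4 ?A (-5) [-5/4, 3/4, 0, 1]"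
    by (simp_all add: eigen_list_def numeral_eq_Suc All_less_Suc)
  show ?thesis
    unfolding V
  proof (rule ssp_realizable_listI[OF _ _ R x(1,2), where a = 2 and b = 3, OF _ _ _ _ _ _ x(3,4), where c = 2 and d = 3])
    fix Z
    assume "\<forall>j<4. \<forall>i<j. ?A ! i ! j \<noteq> 0 \<longrightarrow> Z i j = 0" and c: "\<forall>j<4. \<forall>i<j. comm_entry 4 ?A Z i j"
    \<comment> \<open>The commutator entries expand to linear equations in the unknown entries of
      \<open>Z\<close>; linear arithmetic then shows each unknown to be 0.\<close>
    then show "\<forall>j<4. \<forall>i<j. Z i j = 0"
      by (simp (no_asm_use) add: comm_entry_def sym_ext_def numeral_eq_Suc All_less_Suc, (elim conjE)?, (intro conjI)?; argo)
  qed (simp_all add: eval_nat_numeral)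
qed

lemma ssp_realizable_star_6: "ssp_realizable (pverts (complete_bipartite 1 6)) (parcs (complete_bipartite 1 6))"
proof -
  \<comment> \<open>Three leaves with equal diagonal entry give two independent eigenvectors that
    vanish at the centre.\<close>
  let ?A = "[[0, 1, 1, 1, 1, 1, 1],
      [1, 0, 0, 0, 0, 0, 0],
      [1, 0, 0, 0, 0, 0, 0],
      [1, 0, 0, 0, 0, 0, 0],
      [1, 0, 0, 0, 1, 0, 0],
      [1, 0, 0, 0, 0, 1, 0],
      [1, 0, 0, 0, 0, 0, 1]] :: real list list"
  let ?R = "parcs (complete_bipartite 1 6)"
  have V: "pverts (complete_bipartite 1 6) = set [0, 1, 2, 3, 4, 5, 6]" unfolding complete_bipartite_1_6_edges by auto
  have R: "\<forall>i<7. \<forall>j<7. ?A ! i ! j = ?A ! j ! i \<and> (i \<noteq> j \<longrightarrow> (?A ! i ! j \<noteq> 0 \<longleftrightarrow> ([0, 1, 2, 3, 4, 5, 6] ! i, [0, 1, 2, 3, 4, 5, 6] ! j) \<in> ?R))"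
    unfolding complete_bipartite_1_6_edges by (simp add: numeral_eq_Suc All_less_Suc converse_insert_pair)
  have x: "eigen_list 7 ?A (0) [0, -1, 1, 0, 0, 0, 0]" "eigen_list 7 ?A (0) [0, -1, 0, 1, 0, 0, 0]"
    "eigen_list 7 ?A (1) [0, 0, 0, 0, -1, 1, 0]" "eigen_list 7 ?A (1) [0, 0, 0, 0, -1, 0, 1]"
    by (simp_all add: eigen_list_def numeral_eq_Suc All_less_Suc)
  show ?thesis
    unfolding V
  proof (rule ssp_realizable_listI[OF _ _ R x(1,2), where a = 2 and b = 3, OF _ _ _ _ _ _ x(3,4), where c = 5 and d = 6])
    fix Z
    assume "\<forall>j<7. \<forall>i<j. ?A ! i ! j \<noteq> 0 \<longrightarrow> Z i j = 0" and c: "\<forall>j<7. \<forall>i<j. comm_entry 7 ?A Z i j"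
    then show "\<forall>j<7. \<forall>i<j. Z i j = 0"
      by (simp (no_asm_use) add: comm_entry_def sym_ext_def numeral_eq_Suc All_less_Suc, (elim conjE)?, (intro conjI)?; argo)
  qed (simp_all add: eval_nat_numeral)
qed

lemma ssp_realizable_spider_21111: "ssp_realizable (pverts (spider [2, 1, 1, 1, 1])) (parcs (spider [2, 1, 1, 1, 1]))"
proof -
  \<comment> \<open>The arm of two vertices has eigenvalues 1 and -1. Together with the leaves, each
    of them is an eigenvalue of three branches at the centre, hence double. The next two spiders
    follow the same principle.\<close>
  let ?A = "[[0, 1, 0, 1, 1, 1, 1],
      [1, 0, 1, 0, 0, 0, 0],
      [0, 1, 0, 0, 0, 0, 0],
      [1, 0, 0, 1, 0, 0, 0],
      [1, 0, 0, 0, 1, 0, 0],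
      [1, 0, 0, 0, 0, -1, 0],
      [1, 0, 0, 0, 0, 0, -1]] :: real list list"
  let ?R = "parcs (spider [2, 1, 1, 1, 1])"
  have V: "pverts (spider [2, 1, 1, 1, 1]) = set [0, 1, 2, 3, 4, 5, 6]" unfolding spider_21111_edges by auto
  have R: "\<forall>i<7. \<forall>j<7. ?A ! i ! j = ?A ! j ! i \<and> (i \<noteq> j \<longrightarrow> (?A ! i ! j \<noteq> 0 \<longleftrightarrow> ([0, 1, 2, 3, 4, 5, 6] ! i, [0, 1, 2, 3, 4, 5, 6] ! j) \<in> ?R))"
    unfolding spider_21111_edges by (simp add: numeral_eq_Suc All_less_Suc converse_insert_pair)
  have x: "eigen_list 7 ?A (1) [0, -1, -1, 1, 0, 0, 0]" "eigen_list 7 ?A (1) [0, -1, -1, 0, 1, 0, 0]"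
    "eigen_list 7 ?A (-1) [0, -1, 1, 0, 0, 1, 0]" "eigen_list 7 ?A (-1) [0, -1, 1, 0, 0, 0, 1]"
    by (simp_all add: eigen_list_def numeral_eq_Suc All_less_Suc)
  show ?thesis
    unfolding V
  proof (rule ssp_realizable_listI[OF _ _ R x(1,2), where a = 3 and b = 4, OF _ _ _ _ _ _ x(3,4), where c = 5 and d = 6])
    fix Z
    assume "\<forall>j<7. \<forall>i<j. ?A ! i ! j \<noteq> 0 \<longrightarrow> Z i j = 0" and c: "\<forall>j<7. \<forall>i<j. comm_entry 7 ?A Z i j"
    then show "\<forall>j<7. \<forall>i<j. Z i j = 0"
      by (simp (no_asm_use) add: comm_entry_def sym_ext_def numeral_eq_Suc All_less_Suc, (elim conjE)?, (intro conjI)?; argo)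
  qed (simp_all add: eval_nat_numeral)
qed

lemma ssp_realizable_spider_2211: "ssp_realizable (pverts (spider [2, 2, 1, 1])) (parcs (spider [2, 2, 1, 1]))"
proof -
  let ?A = "[[0, 1, 0, 1, 0, 1, 1],
      [1, 0, 1, 0, 0, 0, 0],
      [0, 1, 0, 0, 0, 0, 0],
      [1, 0, 0, 0, 1, 0, 0],
      [0, 0, 0, 1, 0, 0, 0],
      [1, 0, 0, 0, 0, 1, 0],
      [1, 0, 0, 0, 0, 0, -1]] :: real list list"
  let ?R = "parcs (spider [2, 2, 1, 1])"
  have V: "pverts (spider [2, 2, 1, 1]) = set [0, 1, 2, 3, 4, 5, 6]" unfolding spider_2211_edges by auto
  have R: "\<forall>i<7. \<forall>j<7. ?A ! i ! j = ?A ! j ! i \<and> (i \<noteq> j \<longrightarrow> (?A ! i ! j \<noteq> 0 \<longleftrightarrow> ([0, 1, 2, 3, 4, 5, 6] ! i, [0, 1, 2, 3, 4, 5, 6] ! j) \<in> ?R))"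
    unfolding spider_2211_edges by (simp add: numeral_eq_Suc All_less_Suc converse_insert_pair)
  have x: "eigen_list 7 ?A (1) [0, -1, -1, 1, 1, 0, 0]" "eigen_list 7 ?A (1) [0, -1, -1, 0, 0, 1, 0]"
    "eigen_list 7 ?A (-1) [0, 1, -1, -1, 1, 0, 0]" "eigen_list 7 ?A (-1) [0, -1, 1, 0, 0, 0, 1]"
    by (simp_all add: eigen_list_def numeral_eq_Suc All_less_Suc)
  show ?thesis
    unfolding V
  proof (rule ssp_realizable_listI[OF _ _ R x(1,2), where a = 4 and b = 5, OF _ _ _ _ _ _ x(3,4), where c = 4 and d = 6])
    fix Z
    assume "\<forall>j<7. \<forall>i<j. ?A ! i ! j \<noteq> 0 \<longrightarrow> Z i j = 0" and c: "\<forall>j<7. \<forall>i<j. comm_entry 7 ?A Z i j"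
    then show "\<forall>j<7. \<forall>i<j. Z i j = 0"
      by (simp (no_asm_use) add: comm_entry_def sym_ext_def numeral_eq_Suc All_less_Suc, (elim conjE)?, (intro conjI)?; argo)
  qed (simp_all add: eval_nat_numeral)
qed

lemma ssp_realizable_spider_222: "ssp_realizable (pverts (spider [2, 2, 2])) (parcs (spider [2, 2, 2]))"
proof -
  let ?A = "[[0, 1, 0, 1, 0, 1, 0],
      [1, 0, 1, 0, 0, 0, 0],
      [0, 1, 0, 0, 0, 0, 0],
      [1, 0, 0, 0, 1, 0, 0],
      [0, 0, 0, 1, 0, 0, 0],
      [1, 0, 0, 0, 0, 0, 1],
      [0, 0, 0, 0, 0, 1, 0]] :: real list list"
  let ?R = "parcs (spider [2, 2, 2])"
  have V: "pverts (spider [2, 2, 2]) = set [0, 1, 2, 3, 4, 5, 6]" unfolding spider_222_edges by auto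
  have R: "\<forall>i<7. \<forall>j<7. ?A ! i ! j = ?A ! j ! i \<and> (i \<noteq> j \<longrightarrow> (?A ! i ! j \<noteq> 0 \<longleftrightarrow> ([0, 1, 2, 3, 4, 5, 6] ! i, [0, 1, 2, 3, 4, 5, 6] ! j) \<in> ?R))"
    unfolding spider_222_edges by (simp add: numeral_eq_Suc All_less_Suc converse_insert_pair)
  have x: "eigen_list 7 ?A (1) [0, -1, -1, 1, 1, 0, 0]" "eigen_list 7 ?A (1) [0, -1, -1, 0, 0, 1, 1]"
    "eigen_list 7 ?A (-1) [0, 1, -1, -1, 1, 0, 0]" "eigen_list 7 ?A (-1) [0, 1, -1, 0, 0, -1, 1]"
    by (simp_all add: eigen_list_def numeral_eq_Suc All_less_Suc)
  show ?thesis
    unfolding V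
  proof (rule ssp_realizable_listI[OF _ _ R x(1,2), where a = 4 and b = 6, OF _ _ _ _ _ _ x(3,4), where c = 4 and d = 6])
    fix Z
    assume "\<forall>j<7. \<forall>i<j. ?A ! i ! j \<noteq> 0 \<longrightarrow> Z i j = 0" and c: "\<forall>j<7. \<forall>i<j. comm_entry 7 ?A Z i j"
    then show "\<forall>j<7. \<forall>i<j. Z i j = 0"
      by (simp (no_asm_use) add: comm_entry_def sym_ext_def numeral_eq_Suc All_less_Suc, (elim conjE)?, (intro conjI)?; argo)
  qed (simp_all add: eval_nat_numeral)
qed

lemma ssp_realizable_H_tree: "ssp_realizable (pverts (H_tree)) (parcs (H_tree))"
proof -
  \<comment> \<open>Leaf entries 0 at one branch vertex and 1 at the other. The entries -1 and 2
    give the branch of vertex 0 the eigenvalue 1 and that of vertex 1 the eigenvalue 0, which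
    supplies the second eigenvector for each.\<close>
  let ?A = "[[-1, 1, 1, 1, 0, 0],
      [1, 2, 0, 0, 1, 1],
      [1, 0, 0, 0, 0, 0],
      [1, 0, 0, 0, 0, 0],
      [0, 1, 0, 0, 1, 0],
      [0, 1, 0, 0, 0, 1]] :: real list list"
  let ?R = "parcs (H_tree)"
  have V: "pverts (H_tree) = set [0, 1, 2, 3, 4, 5]" unfolding H_tree_def by auto
  have R: "\<forall>i<6. \<forall>j<6. ?A ! i ! j = ?A ! j ! i \<and> (i \<noteq> j \<longrightarrow> (?A ! i ! j \<noteq> 0 \<longleftrightarrow> ([0, 1, 2, 3, 4, 5] ! i, [0, 1, 2, 3, 4, 5] ! j) \<in> ?R))"
    unfolding H_tree_def by (simp add: numeral_eq_Suc All_less_Suc converse_insert_pair)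
  have x: "eigen_list 6 ?A (0) [0, 0, -1, 1, 0, 0]" "eigen_list 6 ?A (0) [0, -1, 1, 0, 1, 1]"
    "eigen_list 6 ?A (1) [-1, 0, -1, -1, 1, 0]" "eigen_list 6 ?A (1) [-1, 0, -1, -1, 0, 1]"
    by (simp_all add: eigen_list_def numeral_eq_Suc All_less_Suc)
  show ?thesis
    unfolding V
  proof (rule ssp_realizable_listI[OF _ _ R x(1,2), where a = 3 and b = 5, OF _ _ _ _ _ _ x(3,4), where c = 4 and d = 5])
    fix Z
    assume "\<forall>j<6. \<forall>i<j. ?A ! i ! j \<noteq> 0 \<longrightarrow> Z i j = 0" and c: "\<forall>j<6. \<forall>i<j. comm_entry 6 ?A Z i j"
    then show "\<forall>j<6. \<forall>i<j. Z i j = 0"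
      by (simp (no_asm_use) add: comm_entry_def sym_ext_def numeral_eq_Suc All_less_Suc, (elim conjE)?, (intro conjI)?; argo)
  qed (simp_all add: eval_nat_numeral)
qed

lemma ssp_realizable_campstool: "ssp_realizable (pverts (campstool)) (parcs (campstool))"
proof -
  \<comment> \<open>Without vertex 0, the value -1 is an eigenvalue of three branches. For 1, the
    edge signs make the vector \<open>(1, 1)\<close> on vertices 1 and 2 orthogonal to row 0, and
    the diagonal entry at 0 admits a second eigenvector.\<close>
  let ?A = "[[-1, 1, -1, 1, 1],
      [1, 0, 1, 0, 0],
      [-1, 1, 0, 0, 0],
      [1, 0, 0, -1, 0],
      [1, 0, 0, 0, -1]] :: real list list"
  let ?R = "parcs (campstool)"
  have V: "pverts (campstool) = set [0, 1, 2, 3, 4]" unfolding campstool_def by auto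
  have R: "\<forall>i<5. \<forall>j<5. ?A ! i ! j = ?A ! j ! i \<and> (i \<noteq> j \<longrightarrow> (?A ! i ! j \<noteq> 0 \<longleftrightarrow> ([0, 1, 2, 3, 4] ! i, [0, 1, 2, 3, 4] ! j) \<in> ?R))"
    unfolding campstool_def by (simp add: numeral_eq_Suc All_less_Suc converse_insert_pair)
  have x: "eigen_list 5 ?A (1) [0, 1, 1, 0, 0]" "eigen_list 5 ?A (1) [2, 2, 0, 1, 1]"
    "eigen_list 5 ?A (-1) [0, -1/2, 1/2, 1, 0]" "eigen_list 5 ?A (-1) [0, -1/2, 1/2, 0, 1]"
    by (simp_all add: eigen_list_def numeral_eq_Suc All_less_Suc)
  show ?thesis
    unfolding V
  proof (rule ssp_realizable_listI[OF _ _ R x(1,2), where a = 2 and b = 4, OF _ _ _ _ _ _ x(3,4), where c = 3 and d = 4])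
    fix Z
    assume "\<forall>j<5. \<forall>i<j. ?A ! i ! j \<noteq> 0 \<longrightarrow> Z i j = 0" and c: "\<forall>j<5. \<forall>i<j. comm_entry 5 ?A Z i j"
    then show "\<forall>j<5. \<forall>i<j. Z i j = 0"
      by (simp (no_asm_use) add: comm_entry_def sym_ext_def numeral_eq_Suc All_less_Suc, (elim conjE)?, (intro conjI)?; argo)
  qed (simp_all add: eval_nat_numeral)
qed

lemma ssp_realizable_three_sun: "ssp_realizable (pverts (three_sun)) (parcs (three_sun))"
proof -
  \<comment> \<open>With blocks \<open>J\<close>, \<open>2 I\<close>, \<open>2 I\<close>,
    \<open>3 I\<close>, where \<open>J\<close> is all ones: on vectors of sum 0 it acts as the 2 by
    2 matrix with rows \<open>(0, 2)\<close> and \<open>(2, 3)\<close>, whose eigenvalues are 4 and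
    -1.\<close>
  let ?A = "[[1, 1, 1, 2, 0, 0],
      [1, 1, 1, 0, 2, 0],
      [1, 1, 1, 0, 0, 2],
      [2, 0, 0, 3, 0, 0],
      [0, 2, 0, 0, 3, 0],
      [0, 0, 2, 0, 0, 3]] :: real list list"
  let ?R = "parcs (three_sun)"
  have V: "pverts (three_sun) = set [0, 1, 2, 3, 4, 5]" unfolding three_sun_def by auto
  have R: "\<forall>i<6. \<forall>j<6. ?A ! i ! j = ?A ! j ! i \<and> (i \<noteq> j \<longrightarrow> (?A ! i ! j \<noteq> 0 \<longleftrightarrow> ([0, 1, 2, 3, 4, 5] ! i, [0, 1, 2, 3, 4, 5] ! j) \<in> ?R))"
    unfolding three_sun_def by (simp add: numeral_eq_Suc All_less_Suc converse_insert_pair)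
  have x: "eigen_list 6 ?A (4) [-1/2, 1/2, 0, -1, 1, 0]" "eigen_list 6 ?A (4) [-1/2, 0, 1/2, -1, 0, 1]"
    "eigen_list 6 ?A (-1) [2, -2, 0, -1, 1, 0]" "eigen_list 6 ?A (-1) [2, 0, -2, -1, 0, 1]"
    by (simp_all add: eigen_list_def numeral_eq_Suc All_less_Suc)
  show ?thesis
    unfolding V
  proof (rule ssp_realizable_listI[OF _ _ R x(1,2), where a = 4 and b = 5, OF _ _ _ _ _ _ x(3,4), where c = 4 and d = 5])
    fix Z
    assume "\<forall>j<6. \<forall>i<j. ?A ! i ! j \<noteq> 0 \<longrightarrow> Z i j = 0" and c: "\<forall>j<6. \<forall>i<j. comm_entry 6 ?A Z i j"
    then show "\<forall>j<6. \<forall>i<j. Z i j = 0"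
      by (simp (no_asm_use) add: comm_entry_def sym_ext_def numeral_eq_Suc All_less_Suc, (elim conjE)?, (intro conjI)?; argo)
  qed (simp_all add: eval_nat_numeral)
qed

lemma ssp_realizable_triangle_triangle: "ssp_realizable (pverts (disjoint_union (complete_graph 3) (complete_graph 3))) (parcs (disjoint_union (complete_graph 3) (complete_graph 3)))"
proof -
  \<comment> \<open>The all-ones matrix has the double eigenvalue 0. In this and the next two
    matrices, adding the identity to the second block gives the double eigenvalue 1 and makes the
    two spectra disjoint, so the part of a violation between the blocks vanishes.\<close>
  let ?A = "[[1, 1, 1, 0, 0, 0],
      [1, 1, 1, 0, 0, 0],
      [1, 1, 1, 0, 0, 0],
      [0, 0, 0, 2, 1, 1],
      [0, 0, 0, 1, 2, 1],
      [0, 0, 0, 1, 1, 2]] :: real list list"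
  let ?R = "parcs (disjoint_union (complete_graph 3) (complete_graph 3))"
  have V: "pverts (disjoint_union (complete_graph 3) (complete_graph 3)) = set [0, 2, 4, 1, 3, 5]" unfolding complete_graph_3_edges disjoint_union_edges by auto
  have R: "\<forall>i<6. \<forall>j<6. ?A ! i ! j = ?A ! j ! i \<and> (i \<noteq> j \<longrightarrow> (?A ! i ! j \<noteq> 0 \<longleftrightarrow> ([0, 2, 4, 1, 3, 5] ! i, [0, 2, 4, 1, 3, 5] ! j) \<in> ?R))"
    unfolding complete_graph_3_edges disjoint_union_edges by (simp add: numeral_eq_Suc All_less_Suc converse_insert_pair)
  have x: "eigen_list 6 ?A (0) [-1, 1, 0, 0, 0, 0]" "eigen_list 6 ?A (0) [-1, 0, 1, 0, 0, 0]"
    "eigen_list 6 ?A (1) [0, 0, 0, -1, 1, 0]" "eigen_list 6 ?A (1) [0, 0, 0, -1, 0, 1]"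
    by (simp_all add: eigen_list_def numeral_eq_Suc All_less_Suc)
  show ?thesis
    unfolding V
  proof (rule ssp_realizable_listI[OF _ _ R x(1,2), where a = 1 and b = 2, OF _ _ _ _ _ _ x(3,4), where c = 4 and d = 5])
    fix Z
    assume "\<forall>j<6. \<forall>i<j. ?A ! i ! j \<noteq> 0 \<longrightarrow> Z i j = 0" and c: "\<forall>j<6. \<forall>i<j. comm_entry 6 ?A Z i j"
    then show "\<forall>j<6. \<forall>i<j. Z i j = 0"
      by (simp (no_asm_use) add: comm_entry_def sym_ext_def numeral_eq_Suc All_less_Suc, (elim conjE)?, (intro conjI)?; argo)
  qed (simp_all add: eval_nat_numeral)
qed

lemma ssp_realizable_triangle_claw: "ssp_realizable (pverts (disjoint_union (complete_graph 3) (complete_bipartite 1 3))) (parcs (disjoint_union (complete_graph 3) (complete_bipartite 1 3)))"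
proof -
  let ?A = "[[1, 1, 1, 0, 0, 0, 0],
      [1, 1, 1, 0, 0, 0, 0],
      [1, 1, 1, 0, 0, 0, 0],
      [0, 0, 0, 1, 1, 1, 1],
      [0, 0, 0, 1, 1, 0, 0],
      [0, 0, 0, 1, 0, 1, 0],
      [0, 0, 0, 1, 0, 0, 1]] :: real list list"
  let ?R = "parcs (disjoint_union (complete_graph 3) (complete_bipartite 1 3))"
  have V: "pverts (disjoint_union (complete_graph 3) (complete_bipartite 1 3)) = set [0, 2, 4, 1, 3, 5, 7]" unfolding complete_graph_3_edges complete_bipartite_1_3_edges disjoint_union_edges by auto
  have R: "\<forall>i<7. \<forall>j<7. ?A ! i ! j = ?A ! j ! i \<and> (i \<noteq> j \<longrightarrow> (?A ! i ! j \<noteq> 0 \<longleftrightarrow> ([0, 2, 4, 1, 3, 5, 7] ! i, [0, 2, 4, 1, 3, 5, 7] ! j) \<in> ?R))"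
    unfolding complete_graph_3_edges complete_bipartite_1_3_edges disjoint_union_edges by (simp add: numeral_eq_Suc All_less_Suc converse_insert_pair)
  have x: "eigen_list 7 ?A (0) [-1, 1, 0, 0, 0, 0, 0]" "eigen_list 7 ?A (0) [-1, 0, 1, 0, 0, 0, 0]"
    "eigen_list 7 ?A (1) [0, 0, 0, 0, -1, 1, 0]" "eigen_list 7 ?A (1) [0, 0, 0, 0, -1, 0, 1]"
    by (simp_all add: eigen_list_def numeral_eq_Suc All_less_Suc)
  show ?thesis
    unfolding V
  proof (rule ssp_realizable_listI[OF _ _ R x(1,2), where a = 1 and b = 2, OF _ _ _ _ _ _ x(3,4), where c = 5 and d = 6])
    fix Z
    assume "\<forall>j<7. \<forall>i<j. ?A ! i ! j \<noteq> 0 \<longrightarrow> Z i j = 0" and c: "\<forall>j<7. \<forall>i<j. comm_entry 7 ?A Z i j"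
    then show "\<forall>j<7. \<forall>i<j. Z i j = 0"
      by (simp (no_asm_use) add: comm_entry_def sym_ext_def numeral_eq_Suc All_less_Suc, (elim conjE)?, (intro conjI)?; argo)
  qed (simp_all add: eval_nat_numeral)
qed

lemma ssp_realizable_claw_claw: "ssp_realizable (pverts (disjoint_union (complete_bipartite 1 3) (complete_bipartite 1 3))) (parcs (disjoint_union (complete_bipartite 1 3) (complete_bipartite 1 3)))"
proof -
  let ?A = "[[0, 1, 1, 1, 0, 0, 0, 0],
      [1, 0, 0, 0, 0, 0, 0, 0],
      [1, 0, 0, 0, 0, 0, 0, 0],
      [1, 0, 0, 0, 0, 0, 0, 0],
      [0, 0, 0, 0, 1, 1, 1, 1],
      [0, 0, 0, 0, 1, 1, 0, 0],
      [0, 0, 0, 0, 1, 0, 1, 0],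
      [0, 0, 0, 0, 1, 0, 0, 1]] :: real list list"
  let ?R = "parcs (disjoint_union (complete_bipartite 1 3) (complete_bipartite 1 3))"
  have V: "pverts (disjoint_union (complete_bipartite 1 3) (complete_bipartite 1 3)) = set [0, 2, 4, 6, 1, 3, 5, 7]" unfolding complete_bipartite_1_3_edges disjoint_union_edges by auto
  have R: "\<forall>i<8. \<forall>j<8. ?A ! i ! j = ?A ! j ! i \<and> (i \<noteq> j \<longrightarrow> (?A ! i ! j \<noteq> 0 \<longleftrightarrow> ([0, 2, 4, 6, 1, 3, 5, 7] ! i, [0, 2, 4, 6, 1, 3, 5, 7] ! j) \<in> ?R))"
    unfolding complete_bipartite_1_3_edges disjoint_union_edges by (simp add: numeral_eq_Suc All_less_Suc converse_insert_pair)
  have x: "eigen_list 8 ?A (0) [0, -1, 1, 0, 0, 0, 0, 0]" "eigen_list 8 ?A (0) [0, -1, 0, 1, 0, 0, 0, 0]"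
    "eigen_list 8 ?A (1) [0, 0, 0, 0, 0, -1, 1, 0]" "eigen_list 8 ?A (1) [0, 0, 0, 0, 0, -1, 0, 1]"
    by (simp_all add: eigen_list_def numeral_eq_Suc All_less_Suc)
  show ?thesis
    unfolding V
  proof (rule ssp_realizable_listI[OF _ _ R x(1,2), where a = 2 and b = 3, OF _ _ _ _ _ _ x(3,4), where c = 6 and d = 7])
    fix Z
    assume "\<forall>j<8. \<forall>i<j. ?A ! i ! j \<noteq> 0 \<longrightarrow> Z i j = 0" and c: "\<forall>j<8. \<forall>i<j. comm_entry 8 ?A Z i j"
    then show "\<forall>j<8. \<forall>i<j. Z i j = 0"
      by (simp (no_asm_use) add: comm_entry_def sym_ext_def numeral_eq_Suc All_less_Suc, (elim conjE)?, (intro conjI)?; argo)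
  qed (simp_all add: eval_nat_numeral)
qed

section \<open>Real symmetric matrices\<close>

abbreviation entries :: "real mat \<Rightarrow> nat \<Rightarrow> nat \<Rightarrow> real" where
  "entries A \<equiv> \<lambda>i j. A $$ (i, j)"

section \<open>Algebraic and geometric multiplicity\<close>

lemma eigenvalue_iff_eigvec:
  fixes A :: "real mat"
  assumes A: "A \<in> carrier_mat n n"
  shows "eigenvalue A l \<longleftrightarrow> (\<exists>x. eigvec {..<n} (entries A) l x \<and> (\<exists>i<n. x i \<noteq> 0))"
proof
  assume "eigenvalue A l"
  then obtain v where v: "v \<in> carrier_vec n" "v \<noteq> 0\<^sub>v n" "A *\<^sub>v v = l \<cdot>\<^sub>v v"
    using A by (auto simp: eigenvalue_def eigenvector_def)
  have "eigvec {..<n} (entries A) l (\<lambda>i. v $ i)"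
    unfolding eigvec_def
  proof
    fix i assume i: "i \<in> {..<n}"
    have "(A *\<^sub>v v) $ i = (l \<cdot>\<^sub>v v) $ i" using v by simp
    then show "(\<Sum>k<n. A $$ (i, k) * v $ k) = l * v $ i"
      using i A v(1) by (simp add: scalar_prod_def atLeast0LessThan)
  qed
  moreover have "\<exists>i<n. v $ i \<noteq> 0"
  proof (rule ccontr)
    assume "\<not> ?thesis"
    then have "v = 0\<^sub>v n" using v(1) by (intro eq_vecI) auto
    with v(2) show False by simp
  qed
  ultimately show "\<exists>x. eigvec {..<n} (entries A) l x \<and> (\<exists>i<n. x i \<noteq> 0)" by blast
next
  assume "\<exists>x. eigvec {..<n} (entries A) l x \<and> (\<exists>i<n. x i \<noteq> 0)"
  then obtain x i where x: "eigvec {..<n} (entries A) l x" "i < n" "x i \<noteq> 0" by blast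
  have "A *\<^sub>v vec n x = l \<cdot>\<^sub>v vec n x"
  proof (rule eq_vecI)
    fix i assume "i < dim_vec (l \<cdot>\<^sub>v vec n x)"
    then show "(A *\<^sub>v vec n x) $ i = (l \<cdot>\<^sub>v vec n x) $ i"
      using x(1) A by (simp add: scalar_prod_def atLeast0LessThan eigvec_def)
  qed (use A in simp)
  moreover have "vec n x \<noteq> 0\<^sub>v n"
  proof
    assume "vec n x = 0\<^sub>v n"
    then have "vec n x $ i = 0\<^sub>v n $ i" by simp
    then show False using x(2,3) by simp
  qed
  ultimately show "eigenvalue A l"
    unfolding eigenvalue_def eigenvector_def using A by (intro exI[of _ "vec n x"]) auto
qed

lemma mult_entries:
  "A \<in> carrier_mat n n \<Longrightarrow> B \<in> carrier_mat n n \<Longrightarrow> i < n \<Longrightarrow> j < n \<Longrightarrow>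
    (A * B) $$ (i, j) = (\<Sum>k<n. A $$ (i, k) * B $$ (k, j))"
  by (simp add: scalar_prod_def atLeast0LessThan)

text \<open>The reflection that exchanges \<open>e_0\<close> and the unit vector \<open>c x\<close>,
  used to split off the eigenvector \<open>x\<close>.\<close>

lemma householder:
  fixes x :: "nat \<Rightarrow> real"
  assumes x: "\<exists>i<n. x i \<noteq> 0"
  shows "\<exists>H c. (\<forall>i j. H i j = H j i) \<and> (\<forall>i<n. \<forall>j<n. (\<Sum>k<n. H i k * H k j) = kron i j) \<and>
    c \<noteq> 0 \<and> (\<forall>i<n. H i 0 = c * x i)"
proof -
  define N where "N = sqrt (\<Sum>i<n. x i * x i)"
  obtain i0 where i0: "i0 < n" "x i0 \<noteq> 0" using x by blast
  have "0 < x i0 * x i0" using i0 not_real_square_gt_zero by blast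
  also have "\<dots> \<le> (\<Sum>i<n. x i * x i)" using i0 by (intro member_le_sum) auto
  finally have S: "(\<Sum>i<n. x i * x i) > 0" .
  then have N: "N > 0" "N * N = (\<Sum>i<n. x i * x i)" by (simp_all add: N_def)
  \<comment> \<open>The sign makes \<open>v 0 \<le> 0\<close>, so \<open>s = 1 - v 0\<close> is
    positive even when \<open>x\<close> is a multiple of \<open>e_0\<close>.\<close>
  define c where "c = (if x 0 > 0 then - 1 / N else 1 / N)"
  define v where "v i = c * x i" for i
  have c0: "c \<noteq> 0" using N by (simp add: c_def)
  have cc: "c * c * (N * N) = 1" using N(1) by (simp add: c_def)
  have vv: "(\<Sum>i<n. v i * v i) = 1"
  proof -
    have "(\<Sum>i<n. v i * v i) = c * c * (\<Sum>i<n. x i * x i)" by (simp add: v_def sum_distrib_left mult_ac)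
    then show ?thesis using cc N(2) by simp
  qed
  have v0: "v 0 \<le> 0" using N(1) by (auto simp: v_def c_def divide_le_0_iff mult_le_0_iff)
  define w where "w i = v i - kron i 0" for i
  define s where "s = 1 - v 0"
  have s: "s > 0" using v0 by (simp add: s_def)
  have n: "0 \<in> {..<n}" using i0 by simp
  have ww: "(\<Sum>i<n. w i * w i) = 2 * s"
  proof -
    have "(\<Sum>i<n. w i * w i) = (\<Sum>i<n. v i * v i) - 2 * (\<Sum>i<n. kron i 0 * v i) + (\<Sum>i<n. kron i 0 * kron i 0)"
      by (simp add: w_def algebra_simps sum.distrib sum_subtractf sum_distrib_left)
    then show ?thesis using n vv by (simp add: sum_kron kron_def[of 0 0] s_def)
  qed
  define H where "H i j = kron i j - w i * w j / s" for i j
  show ?thesis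
  proof (intro exI[of _ H] exI[of _ c] conjI allI impI)
    show "H i j = H j i" for i j by (simp add: H_def kron_def mult.commute)
    show "(\<Sum>k<n. H i k * H k j) = kron i j" if "i < n" "j < n" for i j
    proof -
      have "(\<Sum>k<n. H i k * H k j) = (\<Sum>k<n. kron i k * kron k j) - (\<Sum>k<n. kron i k * (w k * w j / s))
          - (\<Sum>k<n. w i * w k / s * kron k j) + w i * w j / (s * s) * (\<Sum>k<n. w k * w k)"
        unfolding sum_distrib_left sum_subtractf[symmetric] sum.distrib[symmetric]
        by (rule sum.cong) (simp_all add: H_def algebra_simps)
      also have "\<dots> = kron i j"
        using that s sum_kron(2)[of "{..<n}" i "\<lambda>k. w k * w j / s"] sum_kron(3)[of "{..<n}" j "\<lambda>k. w i * w k / s"]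
          sum_kron(2)[of "{..<n}" i "\<lambda>k. kron k j"] by (simp add: ww)
      finally show ?thesis .
    qed
    show "H i 0 = c * x i" if "i < n" for i
    proof -
      have "w 0 = - s" by (simp add: w_def s_def kron_def)
      then show ?thesis using s by (simp add: H_def w_def v_def)
    qed
  qed (rule c0)
qed

text \<open>\<open>e_0\<close> is an eigenvector for \<open>l\<close>. A second independent one can
  be taken to vanish at 0, and then it is an eigenvector of the remaining block.\<close>

lemma mult2_block:
  assumes b0: "\<And>i. i < Suc m \<Longrightarrow> b i 0 = l * kron i 0"
    and sb: "\<And>i j. i < Suc m \<Longrightarrow> j < Suc m \<Longrightarrow> b i j = b j i"
  shows "mult2 {..<Suc m} b l \<longleftrightarrow> (\<exists>x. eigvec {..<m} (\<lambda>i j. b (Suc i) (Suc j)) l x \<and> (\<exists>i<m. x i \<noteq> 0))"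
proof
  have b0': "b (Suc i) 0 = 0" "b 0 (Suc i) = 0" if "i < m" for i
    using b0[of "Suc i"] sb[of "Suc i" 0] that by (auto simp: kron_def)
  have b00: "b 0 0 = l" using b0[of 0] by (simp add: kron_def)
  {
    assume "mult2 {..<Suc m} b l"
    then obtain z where z: "eigvec {..<Suc m} b l z" "z 0 = 0" "\<exists>i\<in>{..<Suc m}. z i \<noteq> 0"
      by (rule mult2_vanishing)
    have "eigvec {..<m} (\<lambda>i j. b (Suc i) (Suc j)) l (\<lambda>i. z (Suc i))"
      unfolding eigvec_def
    proof
      fix i assume "i \<in> {..<m}"
      then show "(\<Sum>k<m. b (Suc i) (Suc k) * z (Suc k)) = l * z (Suc i)"
        using eigvecD[OF z(1), of "Suc i"] z(2) by (simp add: sum.lessThan_Suc_shift del: sum.lessThan_Suc)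
    qed
    moreover have "\<exists>i<m. z (Suc i) \<noteq> 0" using z(2,3) by (metis lessThan_iff less_Suc_eq_0_disj)
    ultimately show "\<exists>x. eigvec {..<m} (\<lambda>i j. b (Suc i) (Suc j)) l x \<and> (\<exists>i<m. x i \<noteq> 0)" by blast
  next
    assume "\<exists>x. eigvec {..<m} (\<lambda>i j. b (Suc i) (Suc j)) l x \<and> (\<exists>i<m. x i \<noteq> 0)"
    then obtain x j where x: "eigvec {..<m} (\<lambda>i j. b (Suc i) (Suc j)) l x" "j < m" "x j \<noteq> 0" by blast
    define y where "y i = (case i of 0 \<Rightarrow> 0 | Suc i \<Rightarrow> x i)" for i
    have y: "y 0 = 0" "y (Suc i) = x i" for i by (simp_all add: y_def)
    have ey: "eigvec {..<Suc m} b l y"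
      unfolding eigvec_def
    proof
      fix i assume i: "i \<in> {..<Suc m}"
      show "(\<Sum>k<Suc m. b i k * y k) = l * y i"
      proof (cases i)
        case 0
        have "(\<Sum>k<m. b 0 (Suc k) * x k) = 0" by (rule sum.neutral) (simp add: b0')
        then show ?thesis using 0 by (simp add: sum.lessThan_Suc_shift y del: sum.lessThan_Suc)
      next
        case (Suc i')
        then show ?thesis using eigvecD[OF x(1), of i'] i
          by (simp add: sum.lessThan_Suc_shift y del: sum.lessThan_Suc)
      qed
    qed
    have e0: "eigvec {..<Suc m} b l (\<lambda>i. kron i 0)"
      unfolding eigvec_def using b0 by (simp add: sum_kron del: sum.lessThan_Suc)
    show "mult2 {..<Suc m} b l"
      unfolding mult2_def
    proof (intro exI conjI allI impI)
      show "eigvec {..<Suc m} b l (\<lambda>i. kron i 0)" "eigvec {..<Suc m} b l y" by fact+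
      fix s t assume st: "\<forall>i\<in>{..<Suc m}. s * kron i 0 + t * y i = 0"
      show "s = 0" using st[rule_format, of 0] by (simp add: kron_def y)
      show "t = 0" using st[rule_format, of "Suc j"] x by (simp add: kron_def y)
    qed
  }
qed

text \<open>A single deflation suffices: conjugation by the reflection of an eigenvector splits
  \<open>A\<close> into \<open>l\<close> and a block \<open>B'\<close>. Both the root order being at
  least two and the eigenspace having dimension at least two amount to \<open>l\<close> being an
  eigenvalue of \<open>B'\<close>.\<close>

lemma multiple_eigenvalue_iff_mult2:
  assumes A: "A \<in> sym_mats n"
  shows "multiple_eigenvalue A l \<longleftrightarrow> mult2 {..<n} (entries A) l"
proof (cases "eigenvalue A l")
  case False
  have cA: "A \<in> carrier_mat n n" using A by (simp add: sym_mats_def)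
  have "\<not> mult2 {..<n} (entries A) l"
  proof
    assume m2: "mult2 {..<n} (entries A) l"
    obtain z where "eigvec {..<n} (entries A) l z" "\<exists>i\<in>{..<n}. z i \<noteq> 0"
      using mult2_vanishing[OF m2] by blast
    then show False using False eigenvalue_iff_eigvec[OF cA] by auto
  qed
  then show ?thesis using False by (simp add: multiple_eigenvalue_def)
next
  case True
  have cA: "A \<in> carrier_mat n n" and tA: "A\<^sup>T = A" using A by (auto simp: sym_mats_def)
  have sA: "A $$ (i, j) = A $$ (j, i)" if "i < n" "j < n" for i j
    using arg_cong[OF tA, of "\<lambda>M. M $$ (j, i)"] that cA by simp
  obtain x where x: "eigvec {..<n} (entries A) l x" "\<exists>i<n. x i \<noteq> 0"
    using True eigenvalue_iff_eigvec[OF cA] by blast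
  obtain m where n: "n = Suc m" using x(2) by (cases n) auto
  obtain H c where H: "\<And>i j. H i j = H j i" "\<And>i j. i < n \<Longrightarrow> j < n \<Longrightarrow> (\<Sum>k<n. H i k * H k j) = kron i j"
    and c: "c \<noteq> 0" "\<And>i. i < n \<Longrightarrow> H i 0 = c * x i"
    using householder[OF x(2)] by blast
  define P where "P = mat n n (\<lambda>(i, j). H i j)"
  have cP: "P \<in> carrier_mat n n" and Pe: "P $$ (i, j) = H i j" if "i < n" "j < n" for i j
    using that by (simp_all add: P_def)
  have cP: "P \<in> carrier_mat n n" by (simp add: P_def)
  have PP: "P * P = 1\<^sub>m n"
  proof (rule eq_matI)
    fix i j assume "i < dim_row (1\<^sub>m n :: real mat)" "j < dim_col (1\<^sub>m n :: real mat)"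
    then have ij: "i < n" "j < n" by simp_all
    have "(P * P) $$ (i, j) = (\<Sum>k<n. H i k * H k j)"
      unfolding mult_entries[OF cP cP ij] using ij by (intro sum.cong) (auto simp: Pe)
    then show "(P * P) $$ (i, j) = 1\<^sub>m n $$ (i, j)" using ij by (simp add: H(2) kron_def)
  qed (use cP in auto)
  define B where "B = P * A * P"
  have cB: "B \<in> carrier_mat n n" using cP cA by (simp add: B_def)
  have AB: "A = P * B * P"
  proof -
    have "P * B * P = P * (P * A * P) * P" by (simp add: B_def)
    also have "\<dots> = (P * P) * A * (P * P)" using cP cA by (simp add: assoc_mult_mat[of _ n n _ n _ n])
    finally show ?thesis using PP cA by simp
  qed
  have PA: "P * A = B * P"
  proof -
    have "B * P = P * A * (P * P)" using cP cA by (simp add: B_def assoc_mult_mat[of _ n n _ n _ n])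
    then show ?thesis using PP cP cA by simp
  qed
  have AP: "A * P = P * B"
  proof -
    have "P * B = (P * P) * A * P" using cP cA by (simp add: B_def assoc_mult_mat[of _ n n _ n _ n])
    then show ?thesis using PP cP cA by simp
  qed
  have tB: "B\<^sup>T = B"
  proof -
    have "P\<^sup>T = P" using H(1) by (auto simp: P_def intro!: eq_matI)
    then show ?thesis using cP cA tA by (simp add: B_def transpose_mult[of _ n n _ n] assoc_mult_mat[of _ n n _ n _ n])
  qed
  have sB: "B $$ (i, j) = B $$ (j, i)" if "i < n" "j < n" for i j
    using arg_cong[OF tB, of "\<lambda>M. M $$ (j, i)"] that cB by simp
  have B0: "B $$ (i, 0) = l * kron i 0" if i: "i < n" for i
  proof -
    have z: "0 < n" using n by simp
    have AP0: "(A * P) $$ (k, 0) = l * P $$ (k, 0)" if "k < n" for k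
      using eigvecD[OF x(1), of k] that z c(2)
      by (simp add: mult_entries[OF cA cP] Pe sum_distrib_left mult.left_commute[of _ c] del: index_mult_mat(1))
        (simp add: sum_distrib_left[symmetric] mult.left_commute)
    have "B = P * (A * P)" using cP cA by (simp add: B_def assoc_mult_mat[of _ n n _ n _ n])
    then have "B $$ (i, 0) = (\<Sum>k<n. P $$ (i, k) * (A * P) $$ (k, 0))"
      using mult_entries[of P n "A * P" i 0] cP cA i z by simp
    also have "\<dots> = l * (\<Sum>k<n. H i k * H k 0)"
      using i z by (simp add: AP0 Pe sum_distrib_left mult.left_commute del: index_mult_mat(1))
    finally show ?thesis using H(2)[OF i z] by simp
  qed
  define B' where "B' = mat m m (\<lambda>(i, j). B $$ (Suc i, Suc j))"
  have cB': "B' \<in> carrier_mat m m" by (simp add: B'_def)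
  let ?L = "mat 1 1 (\<lambda>_. l)"
  have blk: "B = four_block_mat ?L (0\<^sub>m 1 m) (0\<^sub>m m 1) B'"
  proof (rule eq_matI)
    fix i j assume "i < dim_row (four_block_mat ?L (0\<^sub>m 1 m) (0\<^sub>m m 1) B')"
      "j < dim_col (four_block_mat ?L (0\<^sub>m 1 m) (0\<^sub>m m 1) B')"
    then have ij: "i < n" "j < n" by (auto simp: n B'_def)
    then show "B $$ (i, j) = four_block_mat ?L (0\<^sub>m 1 m) (0\<^sub>m m 1) B' $$ (i, j)"
      using B0[of i] B0[of j] sB[of 0 j] n by (cases i; cases j) (auto simp: B'_def kron_def)
  qed (use cB n in \<open>auto simp: B'_def\<close>)
  have sim: "similar_mat A B"
    unfolding similar_mat_def similar_mat_wit_def Let_def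
    by (rule exI[of _ P], rule exI[of _ P]) (use cA cB cP PP AB in auto)
  have cpL: "char_poly ?L = [:- l, 1:]"
    by (simp add: char_poly_defs det_def sign_def)
  have cp: "char_poly A = [:- l, 1:] * char_poly B'"
  proof -
    have "char_poly A = char_poly (four_block_mat ?L (0\<^sub>m 1 m) (0\<^sub>m m 1) B')"
      using char_poly_similar[OF sim] arg_cong[OF blk, of char_poly] by simp
    also have "\<dots> = char_poly ?L * char_poly B'"
      by (rule char_poly_four_block_zeros_col) (use cB' in auto)
    finally show ?thesis unfolding cpL .
  qed
  have nz: "char_poly B' \<noteq> 0" using degree_monic_char_poly[OF cB'] by (metis coeff_0 zero_neq_one)
  have nz2: "[:- l, 1:] * char_poly B' \<noteq> 0" by (intro no_zero_divisors nz) simp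
  have "order l (char_poly A) = Suc (order l (char_poly B'))"
    unfolding cp order_mult[OF nz2] using order_power_n_n[of l 1] by simp
  then have "multiple_eigenvalue A l \<longleftrightarrow> order l (char_poly B') \<noteq> 0"
    using True by (auto simp: multiple_eigenvalue_def)
  also have "\<dots> \<longleftrightarrow> eigenvalue B' l"
    using order_root[of "char_poly B'" l] nz eigenvalue_root_char_poly[OF cB'] by simp
  also have "\<dots> \<longleftrightarrow> (\<exists>x. eigvec {..<m} (\<lambda>i j. B $$ (Suc i, Suc j)) l x \<and> (\<exists>i<m. x i \<noteq> 0))"
    unfolding eigenvalue_iff_eigvec[OF cB'] by (simp add: eigvec_def B'_def)
  also have "\<dots> \<longleftrightarrow> mult2 {..<n} (entries B) l"
    unfolding n by (rule mult2_block[symmetric]) (use B0 sB n in auto)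
  also have "\<dots> \<longleftrightarrow> mult2 {..<n} (entries A) l"
  proof -
    have inj: "\<forall>j\<in>{..<n}. y j = 0" if y: "\<And>i. i \<in> {..<n} \<Longrightarrow> (\<Sum>j<n. H i j * y j) = 0" for y
    proof
      fix i assume i: "i \<in> {..<n}"
      have "0 = (\<Sum>k<n. H i k * (\<Sum>j<n. H k j * y j))" using y by simp
      also have "\<dots> = (\<Sum>k<n. \<Sum>j<n. H i k * H k j * y j)" by (simp add: sum_distrib_left mult.assoc)
      also have "\<dots> = (\<Sum>j<n. \<Sum>k<n. H i k * H k j * y j)" by (rule sum.swap)
      also have "\<dots> = (\<Sum>j<n. kron i j * y j)" using i by (simp add: sum_distrib_right[symmetric] H(2))
      also have "\<dots> = y i" using i by (simp add: sum_kron)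
      finally show "y i = 0" by simp
    qed
    show ?thesis
    proof
      assume "mult2 {..<n} (entries B) l"
      then show "mult2 {..<n} (entries A) l"
      proof (rule mult2_transfer[OF finite_lessThan finite_lessThan inj, rotated 2])
        fix i j assume ij: "i \<in> {..<n}" "j \<in> {..<n}"
        then show "(\<Sum>k<n. A $$ (i, k) * H k j) = (\<Sum>k<n. H i k * B $$ (k, j))"
          using arg_cong[OF AP, of "\<lambda>M. M $$ (i, j)"]
          by (simp add: mult_entries[OF cA cP] mult_entries[OF cP cB] Pe del: index_mult_mat(1))
      qed
    next
      assume "mult2 {..<n} (entries A) l"
      then show "mult2 {..<n} (entries B) l"
      proof (rule mult2_transfer[OF finite_lessThan finite_lessThan inj, rotated 2])
        fix i j assume ij: "i \<in> {..<n}" "j \<in> {..<n}"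
        then show "(\<Sum>k<n. B $$ (i, k) * H k j) = (\<Sum>k<n. H i k * A $$ (k, j))"
          using arg_cong[OF PA, of "\<lambda>M. M $$ (i, j)"]
          by (simp add: mult_entries[OF cB cP] mult_entries[OF cP cA] Pe del: index_mult_mat(1))
      qed
    qed
  qed
  finally show ?thesis .
qed

section \<open>The SSP and the SMP for matrices\<close>

lemma sym_mats_sym_on:
  assumes "X \<in> sym_mats n"
  shows "sym_on {..<n} (entries X)"
proof -
  have cX: "X \<in> carrier_mat n n" and tX: "X\<^sup>T = X" using assms by (auto simp: sym_mats_def)
  have "X $$ (i, j) = X $$ (j, i)" if "i < n" "j < n" for i j
    using arg_cong[OF tX, of "\<lambda>M. M $$ (j, i)"] that cX by simp
  then show ?thesis by (simp add: sym_on_def)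
qed

lemma mats_of_graph_iff:
  "A \<in> mats_of_graph n G \<longleftrightarrow> A \<in> sym_mats n \<and> realizes {..<n} (parcs G) (entries A)"
  using sym_mats_sym_on by (auto simp: mats_of_graph_def realizes_def)

lemma ssp_on_imp_has_SSP:
  assumes A: "A \<in> carrier_mat n n" and ssp: "ssp_on {..<n} (entries A)"
  shows "has_SSP A"
proof -
  have "X = 0\<^sub>m n n"
    if X: "X \<in> sym_mats n" "hadamard A X = 0\<^sub>m n n" "hadamard (1\<^sub>m n) X = 0\<^sub>m n n" "A * X - X * A = 0\<^sub>m n n" for X
  proof -
    have cX: "X \<in> carrier_mat n n" using X(1) by (simp add: sym_mats_def)
    have "entries X i j = 0" if ij: "i \<in> {..<n}" "j \<in> {..<n}" for i j
    proof (rule ssp_onD[OF ssp sym_mats_sym_on[OF X(1)] _ _ ij])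
      fix i j assume ij: "i \<in> {..<n}" "j \<in> {..<n}" "i = j \<or> A $$ (i, j) \<noteq> 0"
      have "hadamard A X $$ (i, j) = 0" "hadamard (1\<^sub>m n) X $$ (i, j) = 0" using X(2,3) ij by auto
      then show "X $$ (i, j) = 0" using ij A by (auto simp: hadamard_def)
    next
      show "comm_on {..<n} (entries A) (entries X)"
        unfolding comm_on_def
      proof (intro ballI)
        fix i j assume "i \<in> {..<n}" "j \<in> {..<n}"
        then have ij: "i < n" "j < n" by auto
        have "(A * X - X * A) $$ (i, j) = (A * X) $$ (i, j) - (X * A) $$ (i, j)"
          using ij A cX by (intro index_minus_mat) auto
        then have "(A * X) $$ (i, j) = (X * A) $$ (i, j)" using X(4) ij by simp
        then show "(\<Sum>k<n. A $$ (i, k) * X $$ (k, j)) = (\<Sum>k<n. X $$ (i, k) * A $$ (k, j))"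
          unfolding mult_entries[OF A cX ij] mult_entries[OF cX A ij] .
      qed
    qed
    then show ?thesis using cX by (intro eq_matI) auto
  qed
  then show ?thesis using A unfolding has_SSP_def Let_def by auto
qed

lemma has_SSP_imp_has_SMP: "has_SSP A \<Longrightarrow> has_SMP A"
  by (auto simp: has_SSP_def has_SMP_def Let_def)

text \<open>The matrix \<open>x y\<^sup>T + y x\<^sup>T\<close> violates the SMP.\<close>

lemma has_SMP_separated_eigvecs:
  assumes A: "A \<in> sym_mats n" and smp: "has_SMP A"
    and x: "eigvec {..<n} (entries A) l x" and y: "eigvec {..<n} (entries A) l y"
    and sep: "\<And>i j. i < n \<Longrightarrow> j < n \<Longrightarrow> x i \<noteq> 0 \<Longrightarrow> y j \<noteq> 0 \<Longrightarrow> i \<noteq> j \<and> A $$ (i, j) = 0"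
    and i: "i < n" "x i \<noteq> 0" and j: "j < n" "y j \<noteq> 0"
  shows False
proof -
  have cA: "A \<in> carrier_mat n n" using A by (simp add: sym_mats_def)
  have sA: "A $$ (a, b) = A $$ (b, a)" if "a < n" "b < n" for a b
    using sym_mats_sym_on[OF A] that by (simp add: sym_on_def)
  define X where "X = mat n n (\<lambda>(a, b). x a * y b + y a * x b)"
  have cX: "X \<in> carrier_mat n n" and dA: "dim_row A = n" using cA by (auto simp: X_def)
  have Xe: "X $$ (a, b) = x a * y b + y a * x b" if "a < n" "b < n" for a b using that by (simp add: X_def)
  have "X\<^sup>T = X" by (rule eq_matI) (auto simp: X_def)
  then have sX: "X \<in> sym_mats n" using cX by (simp add: sym_mats_def)
  have ex: "(\<Sum>k<n. A $$ (a, k) * x k) = l * x a" "(\<Sum>k<n. A $$ (a, k) * y k) = l * y a" if "a < n" for a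
    using eigvecD[OF x, of a] eigvecD[OF y, of a] that by auto
  have ex': "(\<Sum>k<n. x k * A $$ (k, a)) = l * x a" "(\<Sum>k<n. y k * A $$ (k, a)) = l * y a" if "a < n" for a
    using ex[OF that] sA that by (simp_all add: mult.commute)
  have AX: "A * X = l \<cdot>\<^sub>m X"
  proof (rule eq_matI)
    fix a b assume "a < dim_row (l \<cdot>\<^sub>m X)" "b < dim_col (l \<cdot>\<^sub>m X)"
    then have ab: "a < n" "b < n" using cX by auto
    have "(A * X) $$ (a, b) = (\<Sum>k<n. A $$ (a, k) * (x k * y b + y k * x b))"
      unfolding mult_entries[OF cA cX ab] using ab by (intro sum.cong) (auto simp: Xe)
    also have "\<dots> = (\<Sum>k<n. A $$ (a, k) * x k) * y b + (\<Sum>k<n. A $$ (a, k) * y k) * x b"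
      by (simp add: distrib_left sum.distrib sum_distrib_right mult.assoc)
    also have "\<dots> = (l \<cdot>\<^sub>m X) $$ (a, b)" using ab cX by (simp add: ex Xe distrib_left mult.assoc)
    finally show "(A * X) $$ (a, b) = (l \<cdot>\<^sub>m X) $$ (a, b)" .
  qed (use cA cX in auto)
  have XA: "X * A = l \<cdot>\<^sub>m X"
  proof (rule eq_matI)
    fix a b assume "a < dim_row (l \<cdot>\<^sub>m X)" "b < dim_col (l \<cdot>\<^sub>m X)"
    then have ab: "a < n" "b < n" using cX by auto
    have "(X * A) $$ (a, b) = (\<Sum>k<n. (x a * y k + y a * x k) * A $$ (k, b))"
      unfolding mult_entries[OF cX cA ab] using ab by (intro sum.cong) (auto simp: Xe)
    also have "\<dots> = x a * (\<Sum>k<n. y k * A $$ (k, b)) + y a * (\<Sum>k<n. x k * A $$ (k, b))"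
      by (simp add: distrib_right sum.distrib sum_distrib_left mult.assoc)
    also have "\<dots> = (l \<cdot>\<^sub>m X) $$ (a, b)" using ab cX by (simp add: ex' Xe distrib_left mult_ac)
    finally show "(X * A) $$ (a, b) = (l \<cdot>\<^sub>m X) $$ (a, b)" .
  qed (use cA cX in auto)
  \<comment> \<open>Turns each trace condition of the SMP into \<open>l^k\<close> times the trace of
    \<open>X\<close>, and the diagonal of \<open>X\<close> is zero.\<close>
  have pw: "(A ^\<^sub>m k) * X = l ^ k \<cdot>\<^sub>m X" for k
  proof (induction k)
    case (Suc k)
    have "(A ^\<^sub>m Suc k) * X = (A ^\<^sub>m k) * (A * X)" using cA cX by (simp add: assoc_mult_mat[of _ n n _ n _ n])
    also have "\<dots> = l \<cdot>\<^sub>m ((A ^\<^sub>m k) * X)" unfolding AX using cA cX by (simp add: mult_smult_distrib[of _ n n _ n])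
    also have "\<dots> = l ^ Suc k \<cdot>\<^sub>m X" unfolding Suc using cX by (intro eq_matI) auto
    finally show ?case .
  next
    case 0
    show ?case using cA cX by (intro eq_matI) auto
  qed
  have diag: "X $$ (a, a) = 0" if "a < n" for a using sep[of a a] that by (auto simp: Xe)
  have pat: "A $$ (a, b) * X $$ (a, b) = 0" if "a < n" "b < n" for a b
  proof (cases "A $$ (a, b) = 0")
    case False
    then have "x a * y b = 0" "y a * x b = 0" using sep[of a b] sep[of b a] sA[OF that] that by auto
    then show ?thesis using that by (simp add: Xe del: mult_eq_0_iff)
  qed simp
  have "X = 0\<^sub>m n n"
  proof (rule smp[unfolded has_SMP_def Let_def dA, rule_format, OF sX], intro conjI ballI)
    show "hadamard A X = 0\<^sub>m n n"
      by (rule eq_matI) (use cA pat in \<open>auto simp: hadamard_def\<close>)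
    show "hadamard (1\<^sub>m n) X = 0\<^sub>m n n"
      by (rule eq_matI) (use diag in \<open>auto simp: hadamard_def\<close>)
    show "A * X - X * A = 0\<^sub>m n n" unfolding AX XA using cX by auto
    show "trace_mat (A ^\<^sub>m k * X) = 0" for k
      unfolding pw trace_mat_def using cX diag by auto
  qed
  then have "X $$ (i, j) = 0" using i j by simp
  moreover have "y i = 0" using sep[of i i] i by auto
  ultimately show False using i j by (simp add: Xe)
qed

section \<open>Connected components\<close>

text \<open>As no nonzero entry joins \<open>W\<close> to the rest, the eigenvector equation can be
  read on \<open>W\<close> alone, and cutting the vector off outside \<open>W\<close> preserves
  it.\<close>

lemma eigvec_restrict:
  assumes V: "finite V" "W \<subseteq> V" and sep: "\<And>i j. i \<in> V \<Longrightarrow> j \<in> V \<Longrightarrow> (i \<in> W) \<noteq> (j \<in> W) \<Longrightarrow> A i j = 0"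
    and x: "eigvec V A l x"
  shows "eigvec V A l (\<lambda>i. if i \<in> W then x i else 0)" "eigvec W A l x"
proof -
  have a: "(\<Sum>k\<in>V. A i k * (if k \<in> W then x k else 0)) = (\<Sum>k\<in>W. A i k * x k)" for i
    by (rule sum.mono_neutral_cong_right) (use V in auto)
  have b: "(\<Sum>k\<in>W. A i k * x k) = l * x i" if "i \<in> W" for i
  proof -
    have "(\<Sum>k\<in>W. A i k * x k) = (\<Sum>k\<in>V. A i k * x k)"
      by (rule sum.mono_neutral_left) (use V sep that in auto)
    then show ?thesis using eigvecD[OF x, of i] V that by auto
  qed
  have c: "(\<Sum>k\<in>W. A i k * x k) = 0" if "i \<in> V" "i \<notin> W" for i
    by (rule sum.neutral) (use V sep that in auto)
  show "eigvec V A l (\<lambda>i. if i \<in> W then x i else 0)" unfolding eigvec_def a using b c by auto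
  show "eigvec W A l x" unfolding eigvec_def using b by auto
qed

definition component :: "'a pair_pre_digraph \<Rightarrow> 'a \<Rightarrow> 'a set" where
  "component G i = {j \<in> pverts G. (i, j) \<in> (parcs G)\<^sup>*}"

lemma component_connected:
  assumes G: "simple_graph G" and xy: "x \<in> component G i" "y \<in> component G i"
  shows "(x, y) \<in> (parcs G \<inter> component G i \<times> component G i)\<^sup>*"
proof -
  have "sym ((parcs G)\<^sup>*)" using G by (simp add: simple_graph_def sym_rtrancl)
  then have "(x, y) \<in> (parcs G)\<^sup>*" using xy unfolding component_def sym_def by (blast intro: rtrancl_trans)
  then show ?thesis
  proof (induction rule: rtrancl_induct)
    case (step a b)
    have "(i, a) \<in> (parcs G)\<^sup>*" using xy(1) step(1) by (auto simp: component_def)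
    then have "a \<in> component G i" "b \<in> component G i"
      using step(2) simple_graphD(2,3)[OF G step(2)] by (auto simp: component_def)
    then show ?case using step by (meson IntI SigmaI rtrancl.rtrancl_into_rtrancl)
  qed simp
qed

lemma component_closed:
  assumes G: "simple_graph G" and e: "(a, b) \<in> parcs G"
  shows "a \<in> component G i \<longleftrightarrow> b \<in> component G i"
  using simple_graphD(2-4)[OF G e] e simple_graphD(4)[OF G e] by (auto simp: component_def intro: rtrancl_into_rtrancl)

lemma component_eq:
  assumes G: "simple_graph G" and x: "x \<in> component G i" "x \<in> component G j"
  shows "component G i = component G j"
proof -
  have s: "sym ((parcs G)\<^sup>*)" using G by (simp add: simple_graph_def sym_rtrancl)
  then have "(i, j) \<in> (parcs G)\<^sup>*" "(j, i) \<in> (parcs G)\<^sup>*"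
    using x unfolding component_def sym_def by (blast intro: rtrancl_trans)+
  then show ?thesis unfolding component_def by (blast intro: rtrancl_trans)
qed

lemma realizes_subset: "realizes V R A \<Longrightarrow> W \<subseteq> V \<Longrightarrow> realizes W R A"
  unfolding realizes_def sym_on_def by blast

text \<open>Eigenvectors for \<open>l\<close> that are nonzero on two components could be cut down
  to separated ones, contradicting the SMP. So all of them are supported on the component of one
  vertex, which carries the full multiplicity.\<close>

lemma has_SMP_component:
  assumes G: "simple_graph G" "pverts G = {..<n}" and A: "A \<in> mats_of_graph n G" and smp: "has_SMP A"
    and m2: "mult2 {..<n} (entries A) l"
  shows "\<exists>i. mult2 (component G i) (entries A) l"
proof -
  have sA: "A \<in> sym_mats n" and rA: "realizes {..<n} (parcs G) (entries A)" using A by (auto simp: mats_of_graph_iff)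
  have sep: "A $$ (a, b) = 0" if "a \<in> {..<n}" "b \<in> {..<n}" "(a \<in> component G i) \<noteq> (b \<in> component G i)" for a b i
  proof -
    have "a \<noteq> b" "(a, b) \<notin> parcs G" using that component_closed[OF G(1), of a b i] by auto
    then show ?thesis using rA that(1,2) by (auto simp: realizes_def)
  qed
  have sub: "component G i \<subseteq> {..<n}" for i using G(2) by (auto simp: component_def)
  have self: "i \<in> component G i" if "i < n" for i using that G(2) by (simp add: component_def)
  obtain x y where x: "eigvec {..<n} (entries A) l x" and y: "eigvec {..<n} (entries A) l y"
    and ind: "\<And>a b. \<forall>i\<in>{..<n}. a * x i + b * y i = 0 \<Longrightarrow> a = 0 \<and> b = 0"
    using m2 unfolding mult2_def by blast
  obtain i where i: "i < n" "x i \<noteq> 0" using ind[of 1 0] by auto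
  have supp: "j \<in> component G i" if z: "eigvec {..<n} (entries A) l z" and j: "j < n" "z j \<noteq> 0" for z j
  proof (rule ccontr)
    assume nj: "j \<notin> component G i"
    have dj: "component G i \<inter> component G j = {}"
      using component_eq[OF G(1), of _ i j] self[OF j(1)] nj by blast
    show False
    proof (rule has_SMP_separated_eigvecs[OF sA smp _ _ _ i(1) _ j(1)])
      show "eigvec {..<n} (entries A) l (\<lambda>k. if k \<in> component G i then x k else 0)"
        by (rule eigvec_restrict(1)[OF _ sub sep x]) auto
      show "eigvec {..<n} (entries A) l (\<lambda>k. if k \<in> component G j then z k else 0)"
        by (rule eigvec_restrict(1)[OF _ sub sep z]) auto
      fix a b assume ab: "a < n" "b < n" "(if a \<in> component G i then x a else 0) \<noteq> 0"
        "(if b \<in> component G j then z b else 0) \<noteq> 0"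
      then have "a \<in> component G i" "b \<in> component G j" by (auto split: if_splits)
      then show "a \<noteq> b \<and> A $$ (a, b) = 0" using dj sep[of a b i] ab by auto
    qed (use i j self in auto)
  qed
  show ?thesis
    unfolding mult2_def
  proof (intro exI conjI allI impI)
    show "eigvec (component G i) (entries A) l x" "eigvec (component G i) (entries A) l y"
      by (rule eigvec_restrict(2)[OF _ sub sep]; (rule x y)?; simp)+
    fix a b assume ab: "\<forall>k\<in>component G i. a * x k + b * y k = 0"
    have "\<forall>k\<in>{..<n}. a * x k + b * y k = 0"
    proof
      fix k assume k: "k \<in> {..<n}"
      show "a * x k + b * y k = 0"
      proof (cases "k \<in> component G i")
        case False
        then have "x k = 0" "y k = 0" using supp[OF x, of k] supp[OF y, of k] k by blast+
        then show ?thesis by simp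
      qed (use ab in blast)
    qed
    from ind[OF this] show "a = 0" "b = 0" by auto
  qed
qed

section \<open>Combining components, minors and matrices\<close>

lemma connected_multiple_unique:
  assumes mf: "minor_free_part G W" and conn: "\<And>x y. x \<in> W \<Longrightarrow> y \<in> W \<Longrightarrow> (x, y) \<in> (parcs G \<inter> W \<times> W)\<^sup>*"
    and A: "realizes W (parcs G) A" and l: "mult2 W A l" and l': "mult2 W A l'"
  shows "l = l'"
proof -
  obtain xs where "longest_path G W xs"
    using minor_free_part.longest_path_exists[OF mf conn mult2_nonempty[OF l]] by blast
  then show ?thesis using longest_path.multiple_unique A l l' by blast
qed

lemma connected_branching:
  assumes mf: "minor_free_part G W" and conn: "\<And>x y. x \<in> W \<Longrightarrow> y \<in> W \<Longrightarrow> (x, y) \<in> (parcs G \<inter> W \<times> W)\<^sup>*"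
    and A: "realizes W (parcs G) A" and l: "mult2 W A l"
  obtains ys where "minor_free_part.branching G W ys"
proof -
  obtain xs where "longest_path G W xs"
    using minor_free_part.longest_path_exists[OF mf conn mult2_nonempty[OF l]] by blast
  then show ?thesis using that longest_path.branching_exists A l by blast
qed

lemma has_SMP_imp_minor:
  assumes G: "simple_graph G" "pverts G = {..<n}" and A: "A \<in> mats_of_graph n G" and smp: "has_SMP A"
    and l: "multiple_eigenvalue A l" "multiple_eigenvalue A l'" "l \<noteq> l'"
  shows "\<exists>H \<in> minor_family. is_minor H G"
proof (rule ccontr)
  assume nm: "\<not> ?thesis"
  have sA: "A \<in> sym_mats n" and rA: "realizes {..<n} (parcs G) (entries A)" using A by (auto simp: mats_of_graph_iff)
  have "mult2 {..<n} (entries A) l" "mult2 {..<n} (entries A) l'"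
    using l multiple_eigenvalue_iff_mult2[OF sA] by auto
  then obtain i j where m: "mult2 (component G i) (entries A) l" "mult2 (component G j) (entries A) l'"
    using has_SMP_component[OF G A smp] by blast
  have sub: "component G i \<subseteq> {..<n}" for i using G(2) by (auto simp: component_def)
  have mf: "minor_free_part G (component G i)" for i
    by unfold_locales (use nm G sub in auto)
  note conn = component_connected[OF G(1)] and re = realizes_subset[OF rA sub]
  show False
  proof (cases "component G i \<inter> component G j = {}")
    case True
    obtain ys where ys: "minor_free_part.branching G (component G i) ys"
      using connected_branching[OF mf conn re m(1)] by blast
    obtain zs where zs: "minor_free_part.branching G (component G j) zs"
      using connected_branching[OF mf conn re m(2)] by blast
    have "set ys \<inter> set zs = {}"
      using ys zs True unfolding minor_free_part.branching_def[OF mf] by blast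
    then show False using no_disjoint_branching[OF mf mf ys zs] by blast
  next
    case False
    then have "component G i = component G j" using component_eq[OF G(1)] by blast
    then show False using connected_multiple_unique[OF mf conn re m(1)] m(2) l(3) by simp
  qed
qed

lemma ssp_realizable_minor_family:
  assumes "H \<in> minor_family"
  shows "ssp_realizable (pverts H) (parcs H)"
  using assms unfolding minor_family_def
  using ssp_realizable_cycle_4 ssp_realizable_star_6 ssp_realizable_spider_21111 ssp_realizable_spider_2211 ssp_realizable_spider_222 ssp_realizable_H_tree ssp_realizable_campstool
    ssp_realizable_three_sun ssp_realizable_triangle_triangle ssp_realizable_triangle_claw ssp_realizable_claw_claw by auto

lemma minor_imp_has_SSP:
  assumes G: "simple_graph G" "pverts G = {..<n}" and H: "H \<in> minor_family" "is_minor H G"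
  shows "\<exists>A \<in> mats_of_graph n G. has_SSP A \<and> (\<exists>x y. x \<noteq> y \<and> multiple_eigenvalue A x \<and> multiple_eigenvalue A y)"
proof -
  have "ssp_realizable {..<n} (parcs G)" using is_minor_ssp_realizable[OF H(2) G(1) ssp_realizable_minor_family[OF H(1)]] G(2) by simp
  then obtain a l m where a: "realizes {..<n} (parcs G) a" "ssp_on {..<n} a" "l \<noteq> m"
    "mult2 {..<n} a l" "mult2 {..<n} a m" by (auto simp: ssp_realizable_def)
  define A where "A = mat n n (\<lambda>(i, j). a i j)"
  have cA: "A \<in> carrier_mat n n" by (simp add: A_def)
  have e: "A $$ (i, j) = a i j" if "i < n" "j < n" for i j using that by (simp add: A_def)
  have "A\<^sup>T = A" using a(1) by (intro eq_matI) (auto simp: A_def realizes_def sym_on_def)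
  then have sA: "A \<in> sym_mats n" using cA by (simp add: sym_mats_def)
  have rA: "realizes {..<n} (parcs G) (entries A)" using a(1) by (simp add: realizes_def sym_on_def e)
  have "ssp_on {..<n} (entries A)" using a(2) by (simp add: ssp_on_def comm_on_def e)
  then have "has_SSP A" by (rule ssp_on_imp_has_SSP[OF cA])
  have "mult2 {..<n} (entries A) k \<longleftrightarrow> mult2 {..<n} a k" for k
    by (simp add: mult2_def eigvec_def e)
  then have "multiple_eigenvalue A l" "multiple_eigenvalue A m"
    using a(4,5) multiple_eigenvalue_iff_mult2[OF sA] by blast+
  moreover have "A \<in> mats_of_graph n G" using sA rA by (simp add: mats_of_graph_iff)
  ultimately show ?thesis using \<open>has_SSP A\<close> a(3) by blast
qed

lemma connected_rtrancl:
  assumes G: "simple_graph G" and c: "Digraph_Component.connected (with_proj G)" and xy: "x \<in> pverts G" "y \<in> pverts G"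
  shows "(x, y) \<in> (parcs G)\<^sup>*"
proof -
  \<comment> \<open>Connectedness is defined through the symmetric closure, which is the graph
    itself here.\<close>
  have "(\<Union>e\<in>parcs G. {(fst e, snd e), (snd e, fst e)}) = parcs G"
    using simple_graphD(4)[OF G] by force
  then have m: "mk_symmetric (with_proj G) = G" by (simp add: mk_symmetric_def)
  have "(x, y) \<in> rtrancl_on (pverts G) (parcs G)"
    using c xy unfolding Digraph_Component.connected_def m strongly_connected_def reachable_def by simp
  then show ?thesis by (induction rule: rtrancl_on.induct) auto
qed

theorem theorem5p1:
  fixes G :: "nat pair_pre_digraph" and n :: nat
  assumes "pair_graph G" and "pverts G = {..<n}"
  shows "(Digraph_Component.connected (with_proj G) \<and> (\<forall>H \<in> minor_family. \<not> is_minor H G) \<longrightarrow>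
           (\<forall>A \<in> mats_of_graph n G. \<forall>x y.
              multiple_eigenvalue A x \<and> multiple_eigenvalue A y \<longrightarrow> x = y))
       \<and> ((\<exists>A \<in> mats_of_graph n G. has_SSP A \<and>
             (\<exists>x y. x \<noteq> y \<and> multiple_eigenvalue A x \<and> multiple_eigenvalue A y))
           \<longleftrightarrow> (\<exists>H \<in> minor_family. is_minor H G))
       \<and> ((\<exists>A \<in> mats_of_graph n G. has_SMP A \<and>
             (\<exists>x y. x \<noteq> y \<and> multiple_eigenvalue A x \<and> multiple_eigenvalue A y))
           \<longleftrightarrow> (\<exists>H \<in> minor_family. is_minor H G))"
proof -
  have G: "simple_graph G" by (rule pair_graph_simple_graph[OF assms(1)])
  note GV = G assms(2)
  have one: "x = y" if c: "Digraph_Component.connected (with_proj G)" and nm: "\<forall>H \<in> minor_family. \<not> is_minor H G"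
    and A: "A \<in> mats_of_graph n G" and xy: "multiple_eigenvalue A x" "multiple_eigenvalue A y" for A x y
  proof -
    have sA: "A \<in> sym_mats n" and rA: "realizes (pverts G) (parcs G) (entries A)"
      using A assms(2) by (auto simp: mats_of_graph_iff)
    \<comment> \<open>For a connected graph the whole vertex set is taken as the part.\<close>
    have mf: "minor_free_part G (pverts G)" by unfold_locales (use nm G in auto)
    have "parcs G \<inter> pverts G \<times> pverts G = parcs G" using G by (auto simp: simple_graph_def)
    then have conn: "(a, b) \<in> (parcs G \<inter> pverts G \<times> pverts G)\<^sup>*" if "a \<in> pverts G" "b \<in> pverts G" for a b
      using connected_rtrancl[OF G c that] by simp
    show ?thesis
      by (rule connected_multiple_unique[OF mf conn rA])
        (use xy multiple_eigenvalue_iff_mult2[OF sA] assms(2) in auto)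
  qed
  show ?thesis
    using one has_SMP_imp_minor[OF GV] minor_imp_has_SSP[OF GV] has_SSP_imp_has_SMP by (intro conjI) blast+
qed

end
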